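(* Let $0<\alpha,\beta<\infty$, let $\varphi,\psi\in S(\mathbb{D})$ and $g,h\in H(\mathbb{D})$. If both $C^g_\varphi$ and $C^h_\psi$ are bounded from $\mathcal{B}^\alpha$ to $\mathcal{B}^\beta$, then $$\|C^g_\varphi-C^h_\psi\|_{e,\mathcal{B}^\alpha\to\mathcal{B}^\beta}\approx \lim_{r\to1}\sup_{|\varphi(z)|>r}|D_{\varphi,g}(z)|\rho(z)+\lim_{r\to1}\sup_{|\psi(z)|>r}|D_{\psi,h}(z)|\rho(z)+\lim_{r\to1}\sup_{|\varphi(z)|>r,\ |\psi(z)|>r}|D_{\varphi,g}(z)-D_{\psi,h}(z)|$$ and $$\|C^g_\varphi-C^h_\psi\|_{e,\mathcal{B}^\alpha\to\mathcal{B}^\beta}\approx\limsup_{n\to\infty}\sup_{z\in\mathbb{D}}(n+1)^\alpha(1-|z|^2)^\beta\,|\varphi(z)^n g(z)-\psi(z)^n h(z)|.$$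
   Context: $\mathbb{D}$ is the open unit disk in $\mathbb{C}$, $H(\mathbb{D})$ is the set of analytic functions on $\mathbb{D}$, and $S(\mathbb{D})$ is the set of analytic self-maps of $\mathbb{D}$. For $0<\alpha<\infty$, the $\alpha$-Bloch space $\mathcal{B}^\alpha$ is the set of $f\in H(\mathbb{D})$ with $\|f\|_\alpha=\sup_{z\in\mathbb{D}}(1-|z|^2)^\alpha|f'(z)|<\infty$, a Banach space under the norm $\|f\|_{\mathcal{B}^\alpha}=|f(0)|+\|f\|_\alpha$. For $g\in H(\mathbb{D})$ and $\varphi\in S(\mathbb{D})$, the generalized composition operator is $C^g_\varphi f(z)=\int_0^z f'(\varphi(\xi))g(\xi)\,d\xi$, $z\in\mathbb{D}$. For $\varphi,\psi\in S(\mathbb{D})$ and $g,h\in H(\mathbb{D})$ put $$\rho(z)=\left|\frac{\psi(z)-\varphi(z)}{1-\overline{\psi(z)}\varphi(z)}\right|,\quad D_{\varphi,g}(z)=\frac{(1-|z|^2)^\beta g(z)}{(1-|\varphi(z)|^2)^\alpha},\quad D_{\psi,h}(z)=\frac{(1-|z|^2)^\beta h(z)}{(1-|\psi(z)|^2)^\alpha}.$$ The essential norm of a bounded linear operator $T:X\to Y$ between Banach spaces is $\|T\|_{e,X\to Y}=\inf\{\|T-K\|_{X\to Y}: K:X\to Y \text{ compact}\}$, with $\|\cdot\|_{X\to Y}$ the operator norm. $A\lesssim B$ means $A\le CB$ for some positive constant $C$ independent of $\varphi$ and $\psi$; $A\approx B$ means $A\lesssim B\lesssim A$. Suprema are over $z\in\mathbb{D}$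 satisfying the indicated conditions, and a supremum over the empty set is $0$; $r\to1$ means $r\to1^-$. *)

theory Defs
  imports "HOL-Complex_Analysis.Complex_Analysis"
begin

abbreviation disk :: "complex set" where
  "disk \<equiv> ball 0 1"

definition disk_self_maps :: "(complex \<Rightarrow> complex) set" where
  "disk_self_maps = {\<phi>. \<phi> holomorphic_on disk \<and> \<phi> ` disk \<subseteq> disk}"


section \<open>Bloch-type spaces\<close>

text \<open>The (semi)norms are extended-valued, so that the supremum of an unbounded set is
  \<open>\<infinity>\<close> and the supremum of the empty set is \<open>0\<close>.\<close>

definition bloch_seminorm :: "real \<Rightarrow> (complex \<Rightarrow> complex) \<Rightarrow> ennreal" where
  "bloch_seminorm \<alpha> f = (SUP z\<in>disk. ennreal ((1 - (cmod z)\<^sup>2) powr \<alpha> * cmod (deriv f z)))"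

definition bloch_norm :: "real \<Rightarrow> (complex \<Rightarrow> complex) \<Rightarrow> ennreal" where
  "bloch_norm \<alpha> f = ennreal (cmod (f 0)) + bloch_seminorm \<alpha> f"

text \<open>An element of the space is a function on the disk; it is represented by its extension by
  \<open>0\<close> to the whole plane, so that distinct representatives are distinct elements.\<close>

definition bloch :: "real \<Rightarrow> (complex \<Rightarrow> complex) set" where
  "bloch \<alpha> = {f. f holomorphic_on disk \<and> (\<forall>z. z \<notin> disk \<longrightarrow> f z = 0) \<and> bloch_seminorm \<alpha> f < \<infinity>}"

definition bloch_dist :: "real \<Rightarrow> (complex \<Rightarrow> complex) \<Rightarrow> (complex \<Rightarrow> complex) \<Rightarrow> real" where
  "bloch_dist \<alpha> f g = enn2real (bloch_norm \<alpha> (\<lambda>z. f z - g z))"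

abbreviation bloch_topology :: "real \<Rightarrow> (complex \<Rightarrow> complex) topology" where
  "bloch_topology \<alpha> \<equiv> Metric_space.mtopology (bloch \<alpha>) (bloch_dist \<alpha>)"


section \<open>Operators between Bloch-type spaces\<close>

text \<open>Operators are maps of functions, of which only the restriction to \<open>bloch \<alpha>\<close> matters.\<close>

type_synonym fun_op = "(complex \<Rightarrow> complex) \<Rightarrow> (complex \<Rightarrow> complex)"

definition bloch_linear :: "real \<Rightarrow> real \<Rightarrow> fun_op \<Rightarrow> bool" where
  "bloch_linear \<alpha> \<beta> T \<longleftrightarrow>
     (\<forall>f\<in>bloch \<alpha>. T f \<in> bloch \<beta>) \<and>
     (\<forall>f\<in>bloch \<alpha>. \<forall>g\<in>bloch \<alpha>. T (\<lambda>z. f z + g z) = (\<lambda>z. T f z + T g z)) \<and>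
     (\<forall>c. \<forall>f\<in>bloch \<alpha>. T (\<lambda>z. c * f z) = (\<lambda>z. c * T f z))"

definition bloch_bounded :: "real \<Rightarrow> real \<Rightarrow> fun_op \<Rightarrow> bool" where
  "bloch_bounded \<alpha> \<beta> T \<longleftrightarrow> bloch_linear \<alpha> \<beta> T \<and>
     (\<exists>C\<ge>0. \<forall>f\<in>bloch \<alpha>. bloch_norm \<beta> (T f) \<le> ennreal C * bloch_norm \<alpha> f)"

definition bloch_compact :: "real \<Rightarrow> real \<Rightarrow> fun_op \<Rightarrow> bool" where
  "bloch_compact \<alpha> \<beta> K \<longleftrightarrow> bloch_linear \<alpha> \<beta> K \<and>
     compactin (bloch_topology \<beta>)
       (bloch_topology \<beta> closure_of (K ` {f \<in> bloch \<alpha>. bloch_norm \<alpha> f \<le> 1}))"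

definition bloch_opnorm :: "real \<Rightarrow> real \<Rightarrow> fun_op \<Rightarrow> ennreal" where
  "bloch_opnorm \<alpha> \<beta> T = (SUP f\<in>{f \<in> bloch \<alpha>. bloch_norm \<alpha> f \<le> 1}. bloch_norm \<beta> (T f))"

definition essential_norm :: "real \<Rightarrow> real \<Rightarrow> fun_op \<Rightarrow> ennreal" where
  "essential_norm \<alpha> \<beta> T =
     (INF K\<in>{K. bloch_compact \<alpha> \<beta> K}. bloch_opnorm \<alpha> \<beta> (\<lambda>f z. T f z - K f z))"

definition gen_comp :: "(complex \<Rightarrow> complex) \<Rightarrow> (complex \<Rightarrow> complex) \<Rightarrow> fun_op" where
  "gen_comp g \<phi> f = (\<lambda>z. if z \<in> disk
     then contour_integral (linepath 0 z) (\<lambda>\<xi>. deriv f (\<phi> \<xi>) * g \<xi>) else 0)"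


section \<open>The quantities in the estimates\<close>

definition pseudo_dist :: "(complex \<Rightarrow> complex) \<Rightarrow> (complex \<Rightarrow> complex) \<Rightarrow> complex \<Rightarrow> real" where
  "pseudo_dist \<phi> \<psi> z = cmod ((\<psi> z - \<phi> z) / (1 - cnj (\<psi> z) * \<phi> z))"

definition weight_quot ::
    "real \<Rightarrow> real \<Rightarrow> (complex \<Rightarrow> complex) \<Rightarrow> (complex \<Rightarrow> complex) \<Rightarrow> complex \<Rightarrow> complex" where
  "weight_quot \<alpha> \<beta> \<phi> g z =
     of_real ((1 - (cmod z)\<^sup>2) powr \<beta>) * g z / of_real ((1 - (cmod (\<phi> z))\<^sup>2) powr \<alpha>)"


section \<open>Well-posedness of the definitions\<close>

lemma bloch_deriv_diff:
  assumes "f \<in> bloch \<alpha>" "g \<in> bloch \<alpha>" "z \<in> disk"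
  shows "deriv (\<lambda>z. f z - g z) z = deriv f z - deriv g z"
proof -
  have "f field_differentiable at z" "g field_differentiable at z"
    using assms unfolding bloch_def
    by (auto intro!: holomorphic_on_imp_differentiable_at[OF _ open_ball])
  then show ?thesis by (rule deriv_diff)
qed

lemma bloch_norm_triangle:
  assumes "f \<in> bloch \<alpha>" "g \<in> bloch \<alpha>" "h \<in> bloch \<alpha>"
  shows "bloch_norm \<alpha> (\<lambda>z. f z - h z)
           \<le> bloch_norm \<alpha> (\<lambda>z. f z - g z) + bloch_norm \<alpha> (\<lambda>z. g z - h z)"
proof -
  let ?w = "\<lambda>z. (1 - (cmod z)\<^sup>2) powr \<alpha>"
  let ?s = "bloch_seminorm \<alpha>"
  have "?s (\<lambda>z. f z - h z) \<le> ?s (\<lambda>z. f z - g z) + ?s (\<lambda>z. g z - h z)"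
    unfolding bloch_seminorm_def[of \<alpha> "\<lambda>z. f z - h z"]
  proof (rule SUP_least)
    fix z assume z: "z \<in> disk"
    have "?w z * cmod (deriv (\<lambda>z. f z - h z) z) \<le>
        ?w z * cmod (deriv (\<lambda>z. f z - g z) z) + ?w z * cmod (deriv (\<lambda>z. g z - h z) z)"
      unfolding bloch_deriv_diff[OF assms(1,2) z] bloch_deriv_diff[OF assms(1,3) z]
        bloch_deriv_diff[OF assms(2,3) z] distrib_left[symmetric]
      by (intro mult_left_mono) (use norm_triangle_ineq[of "deriv f z - deriv g z" "deriv g z - deriv h z"] in auto)
    then have "ennreal (?w z * cmod (deriv (\<lambda>z. f z - h z) z)) \<le>
        ennreal (?w z * cmod (deriv (\<lambda>z. f z - g z) z)) + ennreal (?w z * cmod (deriv (\<lambda>z. g z - h z) z))"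
      by (subst ennreal_plus[symmetric]) (auto intro: ennreal_leI simp del: ennreal_plus)
    also have "\<dots> \<le> ?s (\<lambda>z. f z - g z) + ?s (\<lambda>z. g z - h z)"
      unfolding bloch_seminorm_def by (intro add_mono SUP_upper z)
    finally show "ennreal (?w z * cmod (deriv (\<lambda>z. f z - h z) z)) \<le> \<dots>" .
  qed
  moreover have "ennreal (cmod (f 0 - h 0)) \<le> ennreal (cmod (f 0 - g 0)) + ennreal (cmod (g 0 - h 0))"
    by (subst ennreal_plus[symmetric])
       (use norm_triangle_ineq[of "f 0 - g 0" "g 0 - h 0"] in \<open>auto intro: ennreal_leI simp del: ennreal_plus\<close>)
  ultimately show ?thesis
    unfolding bloch_norm_def by (metis (no_types, lifting) add.assoc add.left_commute add_mono)
qed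

lemma zero_in_bloch: "(\<lambda>z. 0) \<in> bloch \<alpha>"
  by (auto simp: bloch_def bloch_seminorm_def)

lemma bloch_norm_finite: "f \<in> bloch \<alpha> \<Longrightarrow> bloch_norm \<alpha> f < \<infinity>"
  by (auto simp: bloch_def bloch_norm_def)

lemma deriv_uminus_cmod: "cmod (deriv (\<lambda>z. - f z) z) = cmod (deriv f z)"
proof (cases "f field_differentiable at z")
  case True
  then have "deriv (\<lambda>z. - f z) z = - deriv f z" by (rule deriv_minus)
  then show ?thesis by simp
next
  case False
  then have "\<And>D. \<not> (f has_field_derivative D) (at z)"
    by (auto simp: field_differentiable_def)
  moreover have "\<And>D. \<not> ((\<lambda>z. - f z) has_field_derivative D) (at z)"
    using False field_differentiable_minus[of "\<lambda>z. - f z" "at z"]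
    by (auto simp: field_differentiable_def)
  ultimately show ?thesis unfolding deriv_def by simp
qed

lemma bloch_norm_minus_commute:
  "bloch_norm \<alpha> (\<lambda>z. f z - g z) = bloch_norm \<alpha> (\<lambda>z. g z - f z)"
proof -
  have "cmod (deriv (\<lambda>z. f z - g z) z) = cmod (deriv (\<lambda>z. g z - f z) z)" for z
    using deriv_uminus_cmod[of "\<lambda>z. f z - g z" z] by simp
  then show ?thesis
    by (simp add: bloch_norm_def bloch_seminorm_def norm_minus_commute)
qed

lemma bloch_norm_diff_finite:
  assumes "f \<in> bloch \<alpha>" "g \<in> bloch \<alpha>"
  shows "bloch_norm \<alpha> (\<lambda>z. f z - g z) < \<infinity>"
proof -
  have "bloch_norm \<alpha> (\<lambda>z. f z - g z) \<le> bloch_norm \<alpha> (\<lambda>z. f z - 0) + bloch_norm \<alpha> (\<lambda>z. g z - 0)"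
    using bloch_norm_triangle[OF assms(1) zero_in_bloch assms(2)]
    by (simp only: bloch_norm_minus_commute[of \<alpha> "\<lambda>z. 0" g])
  also have "\<dots> < \<infinity>"
    using bloch_norm_finite[OF assms(1)] bloch_norm_finite[OF assms(2)] by simp
  finally show ?thesis .
qed

lemma bloch_norm_diff_eq_0:
  assumes f: "f \<in> bloch \<alpha>" and g: "g \<in> bloch \<alpha>" and 0: "bloch_norm \<alpha> (\<lambda>z. f z - g z) = 0"
  shows "f = g"
proof -
  let ?d = "\<lambda>z. f z - g z"
  have d: "deriv ?d z = 0" if z: "z \<in> disk" for z
  proof -
    have "(cmod z)\<^sup>2 < 1" using z by (simp add: abs_square_less_1)
    then have w: "(1 - (cmod z)\<^sup>2) powr \<alpha> > 0" by simp
    have "ennreal ((1 - (cmod z)\<^sup>2) powr \<alpha> * cmod (deriv ?d z)) \<le> bloch_seminorm \<alpha> ?d"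
      unfolding bloch_seminorm_def by (rule SUP_upper) fact
    then have "(1 - (cmod z)\<^sup>2) powr \<alpha> * cmod (deriv ?d z) \<le> 0"
      using 0 by (simp add: bloch_norm_def ennreal_eq_0_iff)
    with w show ?thesis
      by (metis mult_le_0_iff norm_le_zero_iff not_less)
  qed
  have hol: "?d holomorphic_on disk"
    using f g by (auto simp: bloch_def intro!: holomorphic_intros)
  have "(?d has_field_derivative 0) (at z within disk)" if "z \<in> disk" for z
    using holomorphic_derivI[OF hol open_ball that] d[OF that]
    by (metis has_field_derivative_at_within)
  then obtain c where c: "\<And>z. z \<in> disk \<Longrightarrow> ?d z = c"
    using has_field_derivative_zero_constant[OF convex_ball] by (metis (no_types, lifting))
  have "?d 0 = 0" using 0 by (simp add: bloch_norm_def)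
  with c[of 0] have "c = 0" by simp
  have "f z = g z" for z
    using c[of z] \<open>c = 0\<close> f g by (cases "z \<in> disk") (auto simp: bloch_def)
  then show ?thesis by blast
qed

lemma Metric_space_bloch: "Metric_space (bloch \<alpha>) (bloch_dist \<alpha>)"
proof
  fix f g h
  show "0 \<le> bloch_dist \<alpha> f g" by (simp add: bloch_dist_def)
  show "bloch_dist \<alpha> f g = bloch_dist \<alpha> g f"
    unfolding bloch_dist_def by (subst bloch_norm_minus_commute) (rule refl)
  assume fg: "f \<in> bloch \<alpha>" "g \<in> bloch \<alpha>"
  show "bloch_dist \<alpha> f g = 0 \<longleftrightarrow> f = g"
  proof
    assume "bloch_dist \<alpha> f g = 0"
    then have "bloch_norm \<alpha> (\<lambda>z. f z - g z) = 0"
      using bloch_norm_diff_finite[OF fg] by (auto simp: bloch_dist_def enn2real_eq_0_iff)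
    with fg show "f = g" by (rule bloch_norm_diff_eq_0)
  qed (simp add: bloch_dist_def bloch_norm_def bloch_seminorm_def)
  assume h: "h \<in> bloch \<alpha>"
  show "bloch_dist \<alpha> f h \<le> bloch_dist \<alpha> f g + bloch_dist \<alpha> g h"
    unfolding bloch_dist_def
    using bloch_norm_diff_finite[OF fg] bloch_norm_diff_finite[OF fg(2) h]
      bloch_norm_triangle[OF fg h]
    by (subst enn2real_plus[symmetric]) (auto intro!: enn2real_mono)
qed

lemma gen_comp_linear:
  assumes g: "g holomorphic_on disk" and \<phi>: "\<phi> \<in> disk_self_maps"
    and f1: "f1 \<in> bloch \<alpha>" and f2: "f2 \<in> bloch \<alpha>"
  shows "gen_comp g \<phi> (\<lambda>z. f1 z + f2 z) = (\<lambda>z. gen_comp g \<phi> f1 z + gen_comp g \<phi> f2 z)"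
    and "gen_comp g \<phi> (\<lambda>z. c * f1 z) = (\<lambda>z. c * gen_comp g \<phi> f1 z)"
proof -
  have \<phi>': "\<phi> holomorphic_on disk" "\<And>z. z \<in> disk \<Longrightarrow> \<phi> z \<in> disk"
    using \<phi> unfolding disk_self_maps_def by blast+
  have fd: "f field_differentiable at (\<phi> z)" if "f \<in> bloch \<alpha>" "z \<in> disk" for f z
    using that \<phi>'(2) unfolding bloch_def
    by (auto intro!: holomorphic_on_imp_differentiable_at[OF _ open_ball])
  have seg: "closed_segment 0 z \<subseteq> disk" if "z \<in> disk" for z :: complex
    using that by (intro closed_segment_subset) auto
  have int: "(\<lambda>\<xi>. deriv f (\<phi> \<xi>) * g \<xi>) contour_integrable_on linepath 0 z"
    if f: "f \<in> bloch \<alpha>" and z: "z \<in> disk" for f z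
  proof -
    have "deriv f holomorphic_on disk"
      using f by (auto simp: bloch_def intro!: holomorphic_deriv)
    then have "(deriv f \<circ> \<phi>) holomorphic_on disk"
      using \<phi>' by (intro holomorphic_on_compose_gen[of _ _ _ disk]) auto
    then have "(\<lambda>\<xi>. deriv f (\<phi> \<xi>) * g \<xi>) holomorphic_on disk"
      using g by (auto simp: o_def intro!: holomorphic_intros)
    then show ?thesis
      using seg[OF z] by (intro contour_integrable_continuous_linepath)
        (meson continuous_on_subset holomorphic_on_imp_continuous_on)
  qed
  show "gen_comp g \<phi> (\<lambda>z. f1 z + f2 z) = (\<lambda>z. gen_comp g \<phi> f1 z + gen_comp g \<phi> f2 z)"
  proof
    fix z
    show "gen_comp g \<phi> (\<lambda>z. f1 z + f2 z) z = gen_comp g \<phi> f1 z + gen_comp g \<phi> f2 z"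
    proof (cases "z \<in> disk")
      case True
      have "contour_integral (linepath 0 z) (\<lambda>\<xi>. deriv (\<lambda>z. f1 z + f2 z) (\<phi> \<xi>) * g \<xi>)
          = contour_integral (linepath 0 z) (\<lambda>\<xi>. deriv f1 (\<phi> \<xi>) * g \<xi> + deriv f2 (\<phi> \<xi>) * g \<xi>)"
        using seg[OF True] fd[OF f1] fd[OF f2]
        by (intro contour_integral_eq) (auto simp: subset_iff distrib_right)
      then show ?thesis
        using True int[OF f1 True] int[OF f2 True]
        by (simp add: gen_comp_def contour_integral_add)
    qed (simp add: gen_comp_def)
  qed
  show "gen_comp g \<phi> (\<lambda>z. c * f1 z) = (\<lambda>z. c * gen_comp g \<phi> f1 z)"
  proof
    fix z
    show "gen_comp g \<phi> (\<lambda>z. c * f1 z) z = c * gen_comp g \<phi> f1 z"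
    proof (cases "z \<in> disk")
      case True
      have "contour_integral (linepath 0 z) (\<lambda>\<xi>. deriv (\<lambda>z. c * f1 z) (\<phi> \<xi>) * g \<xi>)
          = contour_integral (linepath 0 z) (\<lambda>\<xi>. c * (deriv f1 (\<phi> \<xi>) * g \<xi>))"
        using seg[OF True] fd[OF f1]
        by (intro contour_integral_eq) (auto simp: subset_iff mult.assoc)
      then show ?thesis
        using True int[OF f1 True]
        by (simp add: gen_comp_def contour_integral_lmul)
    qed (simp add: gen_comp_def)
  qed
qed

text \<open>The one-sided limits \<open>r \<rightarrow> 1\<^sup>-\<close> of the suprema exist, since these decrease in \<open>r\<close>; hence
  \<^const>\<open>Lim\<close> denotes them.\<close>

lemma antimono_tendsto_Lim_at_left:
  fixes F :: "real \<Rightarrow> ennreal"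
  assumes "antimono F"
  shows "(F \<longlongrightarrow> Lim (at_left a) F) (at_left a)"
proof -
  have "(F \<longlongrightarrow> (INF r\<in>{..<a}. F r)) (at_left a)"
  proof (rule decreasing_tendsto)
    show "\<forall>\<^sub>F r in at_left a. (INF r\<in>{..<a}. F r) \<le> F r"
      by (auto simp: eventually_at_filter intro!: always_eventually INF_lower)
  next
    fix x assume "(INF r\<in>{..<a}. F r) < x"
    then obtain r0 where "r0 < a" "F r0 < x" by (auto simp: INF_less_iff)
    then show "\<forall>\<^sub>F r in at_left a. F r < x"
      using assms unfolding eventually_at_left_field antimono_def
      by (metis le_less_trans less_imp_le)
  qed
  then show ?thesis
    by (metis tendsto_Lim trivial_limit_at_left_real)
qed

lemma tendsto_Lim_SUP_at_left:
  fixes F :: "complex \<Rightarrow> ennreal" and u :: "complex \<Rightarrow> real"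
  shows "((\<lambda>r. SUP z\<in>{z \<in> disk. u z > r}. F z) \<longlongrightarrow>
           Lim (at_left 1) (\<lambda>r. SUP z\<in>{z \<in> disk. u z > r}. F z)) (at_left 1)"
  by (intro antimono_tendsto_Lim_at_left antimonoI SUP_subset_mono) auto

end

theory Submission
  imports Defs "HOL-Real_Asymp.Real_Asymp"
begin

text \<open>
  Write \<open>E\<close> for the essential norm, \<open>A\<close> for the sum of the three limits and \<open>B\<close> for the limit
  superior. It suffices to close the circle \<open>E \<lesssim> A \<lesssim> B \<lesssim> E\<close>. Everything is expressed through
  derivatives, since \<open>(C\<^sub>\<phi>\<^sup>g f)' = (f' \<circ> \<phi>) g\<close>.

  \<open>E \<lesssim> A\<close>: replacing \<open>\<phi>, \<psi>\<close> by \<open>r\<phi>, r\<psi>\<close> yields, by Montel's theorem, compact operators. In the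
  error term \<open>f'\<close> is replaced by \<open>G(w) = f'(w) - f'(rw)\<close>, which is uniformly small on compact sets,
  while near the boundary \<open>(1 - |w|\<^sup>2)\<^sup>\<alpha> G(w)\<close> is bounded and Lipschitz for the pseudo-hyperbolic
  distance.

  \<open>A \<lesssim> B\<close>: the kernels \<open>(1 - |w|\<^sup>2)\<^sup>\<gamma> / (1 - cnj w \<zeta>)\<^sup>\<alpha>\<^sup>+\<^sup>\<gamma>\<close> with \<open>\<gamma> = \<alpha>, \<alpha> + 1\<close> and \<open>w = \<phi>(z)\<close> have
  nonnegative binomial coefficients, so that their power series transfer the bounds for monomials.

  \<open>B \<lesssim> E\<close>: the functions with derivative \<open>(n + 1)\<^sup>\<alpha> z\<^sup>n\<close> are bounded in norm and are mapped to
  norm null sequences by every compact operator.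
\<close>

text \<open>The constants must not depend on \<phi> and \<psi>, whereas the quantitative content of
  boundedness is a bound \<open>Q\<close> on the weighted symbols that does depend on them. Every
  estimate is therefore arranged so that \<open>Q\<close> enters only through a threshold: a radius
  beyond which |\<phi>(z)| or |\<psi>(z)| must lie, or a dilation factor close to 1. These
  thresholds disappear in the limits, and the constants that survive depend on \<alpha> alone. A
  bound for monomials of large degree suffices for the kernels because the terms of degree below any
  fixed \<open>N\<close> carry the factor \<open>weight \<gamma> w\<close>, which vanishes as |w|
  tends to 1. One kernel alone would not do: it shows only that X / weight and a multiple of Y
  nearly cancel. A second kernel with the same value at \<open>w\<close> separates the two terms,
  and the separation costs exactly one factor of the pseudo-hyperbolic distance. This is where
  \<rho> in the first two suprema comes from.\<close>

abbreviation weight :: "real \<Rightarrow> complex \<Rightarrow> real" where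
  "weight \<alpha> z \<equiv> (1 - (cmod z)\<^sup>2) powr \<alpha>"

section \<open>Bloch functions through their derivatives\<close>

lemma weight_base_pos: "z \<in> disk \<Longrightarrow> 0 < 1 - (cmod z)\<^sup>2"
  by (simp add: abs_square_less_1)

lemma weight_pos: "z \<in> disk \<Longrightarrow> 0 < weight \<alpha> z"
  using weight_base_pos[of z] by simp

lemma weight_le_1: "z \<in> disk \<Longrightarrow> 0 \<le> \<alpha> \<Longrightarrow> weight \<alpha> z \<le> 1"
  using weight_base_pos[of z] by (intro powr_le1) auto

text \<open>The value \<open>0\<close> off the disk makes a primitive an admissible representative
  in \<open>bloch \<alpha>\<close>, and its value \<open>0\<close> at the origin reduces the norm to
  the seminorm. Test functions can thus be prescribed by their derivatives.\<close>

definition primitive :: "(complex \<Rightarrow> complex) \<Rightarrow> complex \<Rightarrow> complex" where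
  "primitive F z = (if z \<in> disk then contour_integral (linepath 0 z) F else 0)"

lemma primitive_0 [simp]: "primitive F 0 = 0"
  by (simp add: primitive_def)

lemma has_field_derivative_primitive:
  assumes F: "F holomorphic_on disk" and z: "z \<in> disk"
  shows "(primitive F has_field_derivative F z) (at z)"
proof -
  obtain G where G: "\<And>x. x \<in> disk \<Longrightarrow> (G has_field_derivative F x) (at x within disk)"
    using holomorphic_convex_primitive'[OF convex_ball open_ball F] by metis
  have eq: "primitive F x = G x - G 0" if "x \<in> disk" for x
  proof -
    have "closed_segment 0 x \<subseteq> disk"
      using that by (intro closed_segment_subset) auto
    then have "(F has_contour_integral (G x - G 0)) (linepath 0 x)"
      using contour_integral_primitive[of disk G F "linepath 0 x"] G by auto
    then show ?thesis
      using that by (simp add: primitive_def contour_integral_unique)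
  qed
  have "((\<lambda>x. G x - G 0) has_field_derivative F z) (at z)"
    using G[OF z] z at_within_open[OF z open_ball] by (auto intro!: derivative_eq_intros)
  then show ?thesis
    by (rule has_field_derivative_transform_within_open[where S = disk]) (use eq z in auto)
qed


lemma holomorphic_on_primitive: "F holomorphic_on disk \<Longrightarrow> primitive F holomorphic_on disk"
  using has_field_derivative_primitive holomorphic_on_open[OF open_ball] by blast

lemma deriv_primitive: "F holomorphic_on disk \<Longrightarrow> z \<in> disk \<Longrightarrow> deriv (primitive F) z = F z"
  by (rule DERIV_imp_deriv[OF has_field_derivative_primitive])

lemma bloch_seminorm_le:
  assumes "\<And>z. z \<in> disk \<Longrightarrow> weight \<alpha> z * cmod (deriv f z) \<le> M"
  shows "bloch_seminorm \<alpha> f \<le> ennreal M"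
  unfolding bloch_seminorm_def using assms by (intro SUP_least ennreal_leI) auto

lemma blochI:
  assumes "f holomorphic_on disk" "\<And>z. z \<notin> disk \<Longrightarrow> f z = 0"
    and "\<And>z. z \<in> disk \<Longrightarrow> weight \<alpha> z * cmod (deriv f z) \<le> M"
  shows "f \<in> bloch \<alpha>"
proof -
  have "bloch_seminorm \<alpha> f < \<infinity>"
    using bloch_seminorm_le[of \<alpha> f M] assms(3) by (auto simp: le_less_trans)
  then show ?thesis
    using assms(1,2) by (simp add: bloch_def)
qed

lemma primitive_in_bloch:
  assumes F: "F holomorphic_on disk" and M: "\<And>z. z \<in> disk \<Longrightarrow> weight \<alpha> z * cmod (F z) \<le> M"
  shows "primitive F \<in> bloch \<alpha>" and "bloch_norm \<alpha> (primitive F) \<le> ennreal M"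
proof -
  have *: "weight \<alpha> z * cmod (deriv (primitive F) z) \<le> M" if "z \<in> disk" for z
    using M[OF that] deriv_primitive[OF F that] by simp
  show "primitive F \<in> bloch \<alpha>"
    by (rule blochI[OF holomorphic_on_primitive[OF F] _ *]) (auto simp: primitive_def)
  show "bloch_norm \<alpha> (primitive F) \<le> ennreal M"
    using bloch_seminorm_le[of \<alpha> "primitive F" M] * by (simp add: bloch_norm_def)
qed

lemma bloch_holomorphic: "f \<in> bloch \<alpha> \<Longrightarrow> f holomorphic_on disk"
  by (simp add: bloch_def)

lemma bloch_deriv_holomorphic: "f \<in> bloch \<alpha> \<Longrightarrow> deriv f holomorphic_on disk"
  by (simp add: bloch_def holomorphic_deriv)

lemma bloch_field_differentiable: "f \<in> bloch \<alpha> \<Longrightarrow> z \<in> disk \<Longrightarrow> f field_differentiable at z"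
  using holomorphic_on_imp_differentiable_at[OF bloch_holomorphic open_ball] .

lemma weight_deriv_le_norm:
  assumes "z \<in> disk"
  shows "ennreal (weight \<alpha> z * cmod (deriv f z)) \<le> bloch_norm \<alpha> f"
proof -
  have "ennreal (weight \<alpha> z * cmod (deriv f z)) \<le> bloch_seminorm \<alpha> f"
    unfolding bloch_seminorm_def by (rule SUP_upper) fact
  then show ?thesis
    unfolding bloch_norm_def by (metis add_increasing zero_le)
qed

lemma weight_deriv_le:
  assumes "bloch_norm \<alpha> f \<le> ennreal M" "0 \<le> M" "z \<in> disk"
  shows "weight \<alpha> z * cmod (deriv f z) \<le> M"
  using order_trans[OF weight_deriv_le_norm[OF assms(3)] assms(1)] assms(2) by (simp add: ennreal_le_iff)

lemma bloch_norm_le: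
  assumes "f 0 = 0" "\<And>z. z \<in> disk \<Longrightarrow> weight \<alpha> z * cmod (deriv f z) \<le> M"
  shows "bloch_norm \<alpha> f \<le> ennreal M"
  using bloch_seminorm_le[of \<alpha> f M] assms by (simp add: bloch_norm_def)

lemma bloch_norm_scale:
  assumes "f \<in> bloch \<alpha>"
  shows "bloch_norm \<alpha> (\<lambda>z. c * f z) = ennreal (cmod c) * bloch_norm \<alpha> f"
proof -
  have "ennreal (weight \<alpha> z * cmod (deriv (\<lambda>z. c * f z) z))
      = ennreal (cmod c) * ennreal (weight \<alpha> z * cmod (deriv f z))" if "z \<in> disk" for z
    using bloch_field_differentiable[OF assms that]
    by (simp add: deriv_cmult norm_mult ennreal_mult[symmetric] mult_ac)
  then have "bloch_seminorm \<alpha> (\<lambda>z. c * f z) = ennreal (cmod c) * bloch_seminorm \<alpha> f"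
    unfolding bloch_seminorm_def by (subst SUP_mult_left_ennreal) (intro SUP_cong, auto)
  then show ?thesis
    by (simp add: bloch_norm_def norm_mult ennreal_mult distrib_left)
qed

lemma bloch_scale:
  assumes "f \<in> bloch \<alpha>"
  shows "(\<lambda>z. c * f z) \<in> bloch \<alpha>"
proof -
  have "bloch_norm \<alpha> (\<lambda>z. c * f z) < \<infinity>"
    unfolding bloch_norm_scale[OF assms] using bloch_norm_finite[OF assms]
    by (simp add: ennreal_mult_less_top)
  then have "bloch_seminorm \<alpha> (\<lambda>z. c * f z) < \<infinity>"
    by (simp add: bloch_norm_def)
  then show ?thesis
    using assms by (auto simp: bloch_def intro!: holomorphic_intros)
qed

lemma bloch_diff:
  assumes "f \<in> bloch \<alpha>" "g \<in> bloch \<alpha>"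
  shows "(\<lambda>z. f z - g z) \<in> bloch \<alpha>"
  using bloch_norm_diff_finite[OF assms] assms
  by (auto simp: bloch_def bloch_norm_def intro!: holomorphic_intros)

lemma bloch_add:
  assumes "f \<in> bloch \<alpha>" "g \<in> bloch \<alpha>"
  shows "(\<lambda>z. f z + g z) \<in> bloch \<alpha>"
  using bloch_diff[OF assms(1) bloch_scale[OF assms(2), of "-1"]] by simp

lemma bloch_norm_add_le:
  assumes "f \<in> bloch \<alpha>" "g \<in> bloch \<alpha>"
  shows "bloch_norm \<alpha> (\<lambda>z. f z + g z) \<le> bloch_norm \<alpha> f + bloch_norm \<alpha> g"
  using bloch_norm_triangle[OF assms(1) zero_in_bloch bloch_scale[OF assms(2), of "-1"]] by simp

lemma bloch_sum:
  assumes "finite I" "\<And>i. i \<in> I \<Longrightarrow> f i \<in> bloch \<alpha>"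
  shows "(\<lambda>z. \<Sum>i\<in>I. f i z) \<in> bloch \<alpha>"
  using assms by (induction I) (auto simp: zero_in_bloch intro: bloch_add)

section \<open>Generalized composition operators\<close>

lemma disk_self_mapsD:
  assumes "\<phi> \<in> disk_self_maps"
  shows "\<phi> holomorphic_on disk" and "\<And>z. z \<in> disk \<Longrightarrow> \<phi> z \<in> disk"
  using assms unfolding disk_self_maps_def by blast+

lemma holomorphic_on_compose_self_map:
  assumes "\<phi> \<in> disk_self_maps" "F holomorphic_on disk"
  shows "(\<lambda>z. F (\<phi> z)) holomorphic_on disk"
  using holomorphic_on_compose_gen[of \<phi> disk F disk] assms
  by (simp add: disk_self_maps_def o_def)

lemma gen_comp_eq_primitive: "gen_comp g \<phi> f = primitive (\<lambda>\<xi>. deriv f (\<phi> \<xi>) * g \<xi>)"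
  by (simp add: gen_comp_def primitive_def fun_eq_iff)

lemma gen_comp_integrand_holomorphic:
  assumes "g holomorphic_on disk" "\<phi> \<in> disk_self_maps" "f \<in> bloch \<alpha>"
  shows "(\<lambda>\<xi>. deriv f (\<phi> \<xi>) * g \<xi>) holomorphic_on disk"
  by (intro holomorphic_on_mult holomorphic_on_compose_self_map[OF assms(2)]
      bloch_deriv_holomorphic[OF assms(3)] assms(1))

lemma deriv_gen_comp:
  assumes "g holomorphic_on disk" "\<phi> \<in> disk_self_maps" "f \<in> bloch \<alpha>" "z \<in> disk"
  shows "deriv (gen_comp g \<phi> f) z = deriv f (\<phi> z) * g z"
  unfolding gen_comp_eq_primitive
  using deriv_primitive[OF gen_comp_integrand_holomorphic[OF assms(1-3)] assms(4)] .

lemma gen_comp_0 [simp]: "gen_comp g \<phi> f 0 = 0"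
  by (simp add: gen_comp_eq_primitive)

text \<open>Boundedness applied to \<open>primitive F\<close> and read off at one point. In this
  form any holomorphic \<open>F\<close> of weighted size at most 1 is a test function, and it may be
  chosen depending on \<open>z\<close>.\<close>

lemma bloch_bounded_bound:
  assumes g: "g holomorphic_on disk" and \<phi>: "\<phi> \<in> disk_self_maps"
    and T: "bloch_bounded \<alpha> \<beta> (gen_comp g \<phi>)"
  obtains C where "C \<ge> 0" and
    "\<And>F z. F holomorphic_on disk \<Longrightarrow> (\<And>\<zeta>. \<zeta> \<in> disk \<Longrightarrow> weight \<alpha> \<zeta> * cmod (F \<zeta>) \<le> 1) \<Longrightarrow> z \<in> disk \<Longrightarrow>
        weight \<beta> z * cmod (F (\<phi> z) * g z) \<le> C"
proof -
  obtain C where C: "C \<ge> 0" "\<And>f. f \<in> bloch \<alpha> \<Longrightarrow> bloch_norm \<beta> (gen_comp g \<phi> f) \<le> ennreal C * bloch_norm \<alpha> f"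
    using T unfolding bloch_bounded_def by blast
  show ?thesis
  proof (rule that[OF C(1)])
    fix F z assume F: "F holomorphic_on disk" "\<And>\<zeta>. \<zeta> \<in> disk \<Longrightarrow> weight \<alpha> \<zeta> * cmod (F \<zeta>) \<le> 1"
      and z: "z \<in> disk"
    note p = primitive_in_bloch[OF F]
    have "bloch_norm \<beta> (gen_comp g \<phi> (primitive F)) \<le> ennreal C * 1"
      using C(2)[OF p(1)] p(2) by (metis ennreal_1 mult_left_mono order_trans zero_le)
    then have "weight \<beta> z * cmod (deriv (gen_comp g \<phi> (primitive F)) z) \<le> C"
      by (intro weight_deriv_le) (use C z in auto)
    then show "weight \<beta> z * cmod (F (\<phi> z) * g z) \<le> C"
      using deriv_gen_comp[OF g \<phi> p(1) z] deriv_primitive[OF F(1)] disk_self_mapsD(2)[OF \<phi> z] by simp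
  qed
qed

section \<open>A Lipschitz estimate in the pseudo-hyperbolic distance\<close>

definition rho :: "complex \<Rightarrow> complex \<Rightarrow> real" where
  "rho a b = cmod (b - a) / cmod (1 - cnj b * a)"

lemma pseudo_dist_eq_rho: "pseudo_dist \<phi> \<psi> z = rho (\<phi> z) (\<psi> z)"
  by (simp add: pseudo_dist_def rho_def norm_divide)

lemma rho_nonneg: "0 \<le> rho a b"
  by (simp add: rho_def)

lemma rho_commute: "rho a b = rho b a"
proof -
  have "cnj (1 - cnj b * a) = 1 - cnj a * b"
    by simp
  then have "cmod (1 - cnj b * a) = cmod (1 - cnj a * b)"
    by (metis complex_mod_cnj)
  then show ?thesis
    by (simp add: rho_def norm_minus_commute)
qed

lemma cmod_cnj_mult_less_1:
  assumes "a \<in> disk" "b \<in> disk"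
  shows "cmod (cnj b * a) < 1"
  using mult_strict_mono[of "cmod b" 1 "cmod a" 1] assms by (simp add: norm_mult)

lemma one_minus_cnj_mult_pos:
  assumes "a \<in> disk" "b \<in> disk"
  shows "0 < cmod (1 - cnj b * a)"
  using cmod_cnj_mult_less_1[OF assms] by auto

text \<open>Division by the left side gives the classical formula for 1 - rho^2. The bound rho \<le>
  1 and the norm estimate for the kernels each come from dropping one of the two summands.\<close>

lemma cmod_one_minus_cnj_mult:
  "(cmod (1 - cnj b * a))\<^sup>2 = (1 - (cmod a)\<^sup>2) * (1 - (cmod b)\<^sup>2) + (cmod (b - a))\<^sup>2"
  by (simp add: cmod_power2) algebra

lemma weight_mult_le:
  assumes "a \<in> disk" "b \<in> disk"
  shows "(1 - (cmod a)\<^sup>2) * (1 - (cmod b)\<^sup>2) \<le> (cmod (1 - cnj b * a))\<^sup>2"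
  by (simp add: cmod_one_minus_cnj_mult)

lemma rho_le_1:
  assumes "a \<in> disk" "b \<in> disk"
  shows "rho a b \<le> 1"
proof -
  have "(cmod (b - a))\<^sup>2 \<le> (cmod (1 - cnj b * a))\<^sup>2"
    unfolding cmod_one_minus_cnj_mult
    using weight_base_pos[OF assms(1)] weight_base_pos[OF assms(2)] by simp
  then have "cmod (b - a) \<le> cmod (1 - cnj b * a)"
    by (rule power2_le_imp_le) simp
  then show ?thesis
    using one_minus_cnj_mult_pos[OF assms] by (simp add: rho_def)
qed

text \<open>Splitting 1 - cnj b a into 1 - |a|^2 and cnj (a - b) a bounds its modulus D by 1 - |a|^2
  + rho D, and the last term is absorbed because rho is small. The threshold 1/16 also meets the
  smallness conditions of \<open>growth_lipschitz\<close> and \<open>powr_near_1\<close>, since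
  32/15 * 1/16 = 2/15.\<close>

lemma dist_le_rho:
  assumes a: "a \<in> disk" and b: "b \<in> disk" and r: "rho a b \<le> 1/16"
  shows "cmod (a - b) \<le> 16/15 * rho a b * (1 - (cmod a)\<^sup>2)"
proof -
  define D where "D = cmod (1 - cnj b * a)"
  have D: "D > 0" using one_minus_cnj_mult_pos[OF a b] by (simp add: D_def)
  have ab: "cmod (a - b) = rho a b * D"
    using D by (simp add: rho_def D_def norm_minus_commute)
  have "1 - cnj b * a = of_real (1 - (cmod a)\<^sup>2) + cnj (a - b) * a"
    by (subst of_real_diff) (simp add: complex_norm_square algebra_simps del: of_real_power)
  then have "D \<le> cmod (of_real (1 - (cmod a)\<^sup>2)) + cmod (cnj (a - b) * a)"
    unfolding D_def by (metis norm_triangle_ineq)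
  also have "cmod (of_real (1 - (cmod a)\<^sup>2)) = 1 - (cmod a)\<^sup>2"
    using weight_base_pos[OF a] by (simp only: norm_of_real abs_of_pos)
  also have "cmod (cnj (a - b) * a) \<le> cmod (a - b) * 1"
    unfolding norm_mult complex_mod_cnj using a by (intro mult_left_mono) auto
  also have "cmod (a - b) * 1 \<le> 1/16 * D"
    unfolding ab using r D by simp
  finally have "D \<le> 16/15 * (1 - (cmod a)\<^sup>2)"
    by simp
  then have "rho a b * D \<le> rho a b * (16/15 * (1 - (cmod a)\<^sup>2))"
    by (intro mult_left_mono rho_nonneg)
  then show ?thesis
    by (simp add: ab mult.assoc mult.left_commute)
qed

text \<open>Cauchy's inequality on discs of radius (1 - |a|)/4 whose centres lie within (1 - |a|)/4
  of a. All of these discs keep distance at least (1 - |a|)/2 from the unit circle, where the growth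
  condition gives the uniform bound \<open>Q\<close>.\<close>

lemma growth_lipschitz:
  assumes F: "F holomorphic_on disk" and M: "\<And>z. z \<in> disk \<Longrightarrow> weight \<alpha> z * cmod (F z) \<le> M"
    and \<alpha>: "0 < \<alpha>" and a: "a \<in> disk" and ab: "cmod (a - b) \<le> (1 - cmod a) / 4"
  shows "cmod (F a - F b) \<le> 4 * 2 powr \<alpha> * M * (1 - cmod a) powr (-\<alpha> - 1) * cmod (a - b)"
proof -
  define s where "s = 1 - cmod a"
  have s: "0 < s" using a by (simp add: s_def)
  define Q where "Q = M * (s / 2) powr (-\<alpha>)"
  have in_disk: "c \<in> disk" and bound: "cmod (F c) \<le> Q" if "cmod (a - c) \<le> s / 2" for c
  proof -
    have "cmod c \<le> cmod a + cmod (a - c)"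
      by (metis norm_minus_commute norm_triangle_sub add.commute)
    then have c: "s / 2 \<le> 1 - cmod c"
      using that by (simp add: s_def)
    then show "c \<in> disk" using s by simp
    have "(cmod c)\<^sup>2 \<le> cmod c"
      using \<open>c \<in> disk\<close> by (simp add: power2_eq_square mult_left_le)
    then have "(s / 2) powr \<alpha> \<le> weight \<alpha> c"
      using c s \<alpha> by (intro powr_mono2) auto
    then have "(s / 2) powr \<alpha> * cmod (F c) \<le> M"
      using M[OF \<open>c \<in> disk\<close>] by (meson mult_right_mono norm_ge_zero order_trans)
    then show "cmod (F c) \<le> Q"
      using s by (simp add: Q_def powr_minus field_simps)
  qed
  have deriv: "cmod (deriv F c) \<le> 4 * Q / s" if c: "c \<in> cball a (s / 4)" for c
  proof -
    have *: "cmod (a - x) \<le> s / 2" if "cmod (c - x) \<le> s / 4" for x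
      using that c norm_triangle_ineq[of "a - c" "c - x"] by (simp add: dist_norm)
    have "cball c (s / 4) \<subseteq> disk"
      using * in_disk by (auto simp: dist_norm)
    then have "cmod ((deriv ^^ 1) F c) \<le> fact 1 * Q / (s / 4) ^ 1"
      using s * bound
      by (intro Cauchy_inequality holomorphic_on_subset[OF F] holomorphic_on_imp_continuous_on) auto
    then show ?thesis by (simp add: mult.commute)
  qed
  have "cmod (F a - F b) \<le> (4 * Q / s) * cmod (a - b)"
  proof (rule field_differentiable_bound[where S = "cball a (s / 4)" and f' = "deriv F"])
    fix c assume c: "c \<in> cball a (s / 4)"
    then have "c \<in> disk" using in_disk s by (simp add: dist_norm)
    then show "(F has_field_derivative deriv F c) (at c within cball a (s / 4))"
      using holomorphic_derivI[OF F open_ball] by (simp add: has_field_derivative_at_within)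
  qed (use deriv ab s in \<open>auto simp: s_def dist_norm\<close>)
  also have "4 * Q / s = 4 * 2 powr \<alpha> * M * s powr (-\<alpha> - 1)"
    using s by (simp add: Q_def powr_minus powr_diff powr_divide powr_one field_simps)
  finally show ?thesis by (simp add: s_def)
qed

lemma powr_near_1:
  fixes t \<alpha> :: real
  assumes "\<bar>t - 1\<bar> \<le> 1/2" "0 < \<alpha>"
  shows "\<bar>t powr \<alpha> - 1\<bar> \<le> 2 * \<alpha> * 2 powr \<alpha> * \<bar>t - 1\<bar>"
proof -
  have "norm (t powr \<alpha> - 1 powr \<alpha>) \<le> (2 * \<alpha> * 2 powr \<alpha>) * norm (t - 1)"
  proof (rule field_differentiable_bound[where S = "{1/2..2}" and f' = "\<lambda>x. \<alpha> * x powr (\<alpha> - 1)"])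
    fix x :: real assume x: "x \<in> {1/2..2}"
    then show "((\<lambda>x. x powr \<alpha>) has_field_derivative \<alpha> * x powr (\<alpha> - 1)) (at x within {1/2..2})"
      by (intro has_field_derivative_at_within[OF has_real_derivative_powr]) auto
    have "x powr (\<alpha> - 1) = x powr \<alpha> / x"
      using x by (simp add: powr_diff)
    also have "\<dots> \<le> 2 powr \<alpha> / (1/2)"
      using x assms by (intro frac_le powr_mono2) auto
    finally show "norm (\<alpha> * x powr (\<alpha> - 1)) \<le> 2 * \<alpha> * 2 powr \<alpha>"
      using assms by (simp add: abs_mult mult.commute)
  qed (use assms in \<open>auto simp: abs_if split: if_splits\<close>)
  then show ?thesis by simp
qed

lemma weight_ratio:
  assumes a: "a \<in> disk" and b: "b \<in> disk" and r: "rho a b \<le> 1/16" and \<alpha>: "0 < \<alpha>"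
  shows "\<bar>weight \<alpha> a - weight \<alpha> b\<bar> \<le> 5 * \<alpha> * 2 powr \<alpha> * rho a b * weight \<alpha> b"
proof -
  define x y where "x = 1 - (cmod a)\<^sup>2" and "y = 1 - (cmod b)\<^sup>2"
  have pos: "0 < x" "0 < y"
    using weight_base_pos[OF a] weight_base_pos[OF b] by (simp_all add: x_def y_def)
  have "x - y = (cmod b - cmod a) * (cmod a + cmod b)"
    by (simp add: x_def y_def power2_eq_square algebra_simps)
  then have "\<bar>x - y\<bar> = \<bar>cmod b - cmod a\<bar> * (cmod a + cmod b)"
    by (simp add: abs_mult)
  also have "\<dots> \<le> cmod (b - a) * 2"
    using a b by (intro mult_mono norm_triangle_ineq3) auto
  also have "cmod (b - a) \<le> 16/15 * rho a b * y"
    using dist_le_rho[OF b a] r by (simp add: y_def rho_commute)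
  finally have "\<bar>x / y - 1\<bar> \<le> 32/15 * rho a b"
    using pos by (simp add: divide_simps abs_if split: if_splits)
  moreover from this have "\<bar>(x / y) powr \<alpha> - 1\<bar> \<le> 2 * \<alpha> * 2 powr \<alpha> * \<bar>x / y - 1\<bar>"
    using r \<alpha> by (intro powr_near_1) auto
  ultimately have "\<bar>(x / y) powr \<alpha> - 1\<bar> \<le> 2 * \<alpha> * 2 powr \<alpha> * (32/15 * rho a b)"
    by (meson \<alpha> mult_left_mono order_trans powr_ge_zero mult_nonneg_nonneg less_imp_le zero_le_numeral)
  \<comment> \<open>\<open>5\<close> rounds up 2 * 32/15.\<close>
  also have "\<dots> \<le> 5 * \<alpha> * 2 powr \<alpha> * rho a b"
    using rho_nonneg[of a b] \<alpha> by simp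
  finally have "\<bar>(x / y) powr \<alpha> - 1\<bar> * y powr \<alpha> \<le> 5 * \<alpha> * 2 powr \<alpha> * rho a b * y powr \<alpha>"
    by (rule mult_right_mono) simp
  moreover have "x powr \<alpha> - y powr \<alpha> = ((x / y) powr \<alpha> - 1) * y powr \<alpha>"
    using pos by (simp add: powr_divide left_diff_distrib)
  ultimately show ?thesis
    by (simp add: x_def y_def abs_mult)
qed

text \<open>For remote pairs the trivial bound 2 M suffices. For close pairs the increment of F and
  the increment of the weight are treated separately; the singular power of 1 - |a| in the Cauchy
  estimate cancels against \<open>weight \<alpha> a\<close> and against the factor 1 - |a| contained
  in |a - b|.\<close>

lemma weighted_lipschitz:
  fixes \<alpha> :: real
  assumes \<alpha>: "0 < \<alpha>"
  obtains C where "0 < C" and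
    "\<And>F M a b. F holomorphic_on disk \<Longrightarrow> (\<And>z. z \<in> disk \<Longrightarrow> weight \<alpha> z * cmod (F z) \<le> M) \<Longrightarrow>
        a \<in> disk \<Longrightarrow> b \<in> disk \<Longrightarrow>
        cmod (of_real (weight \<alpha> a) * F a - of_real (weight \<alpha> b) * F b) \<le> C * M * rho a b"
proof
  \<comment> \<open>\<open>32\<close> serves the case rho > 1/16, as 2 = 32/16. \<open>9\<close>
    rounds up 4 * 32/15, with one \<open>2 powr \<alpha>\<close> from
    \<open>growth_lipschitz\<close> and one from 1 - |a|^2 \<le> 2 (1 - |a|). The last summand comes
    from \<open>weight_ratio\<close>.\<close>
  define C where "C = 32 + 9 * (2 powr \<alpha> * 2 powr \<alpha>) + 5 * \<alpha> * 2 powr \<alpha>"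
  show "0 < C" using \<alpha> by (simp add: C_def add_pos_nonneg)
  fix F M a b
  assume F: "F holomorphic_on disk" and M: "\<And>z. z \<in> disk \<Longrightarrow> weight \<alpha> z * cmod (F z) \<le> M"
    and a: "a \<in> disk" and b: "b \<in> disk"
  have M0: "0 \<le> M"
    using M[OF a] by (rule order_trans[rotated]) simp
  note rho = rho_nonneg[of a b]
  show "cmod (of_real (weight \<alpha> a) * F a - of_real (weight \<alpha> b) * F b) \<le> C * M * rho a b"
  proof (cases "rho a b \<le> 1/16")
    case False
    have "cmod (of_real (weight \<alpha> a) * F a - of_real (weight \<alpha> b) * F b) \<le> 2 * M"
      by (rule order_trans[OF norm_triangle_ineq4]) (use M[OF a] M[OF b] in \<open>simp add: norm_mult\<close>)
    also have "\<dots> \<le> 32 * M * rho a b"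
      using False M0 mult_left_mono[of "1/16" "rho a b" "32 * M"] by simp
    also have "\<dots> \<le> C * M * rho a b"
      using M0 rho \<alpha> by (intro mult_right_mono) (auto simp: C_def)
    finally show ?thesis .
  next
    case True
    define s where "s = 1 - cmod a"
    have s: "0 < s" using a by (simp add: s_def)
    have "1 - (cmod a)\<^sup>2 = s * (1 + cmod a)"
      by (simp add: s_def power2_eq_square algebra_simps)
    also have "\<dots> \<le> s * 2"
      using s by (intro mult_left_mono) (auto simp: s_def)
    finally have xs: "1 - (cmod a)\<^sup>2 \<le> 2 * s" by simp
    have ab: "cmod (a - b) \<le> 32/15 * rho a b * s"
      using dist_le_rho[OF a b True] mult_left_mono[OF xs rho] by simp
    also have "\<dots> \<le> 32/15 * (1/16) * s"
      using True s by (intro mult_right_mono mult_left_mono) auto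
    finally have "cmod (a - b) \<le> (1 - cmod a) / 4"
      using s by (simp add: s_def)
    from growth_lipschitz[OF F M \<alpha> a this]
    have "cmod (F a - F b) \<le> 4 * 2 powr \<alpha> * M * s powr (-\<alpha> - 1) * cmod (a - b)"
      by (simp add: s_def)
    also have "\<dots> \<le> 4 * 2 powr \<alpha> * M * s powr (-\<alpha> - 1) * (32/15 * rho a b * s)"
      using M0 by (intro mult_left_mono ab) auto
    also have "\<dots> \<le> 9 * 2 powr \<alpha> * M * rho a b * (s powr (-\<alpha> - 1) * s)"
      using M0 rho s by (simp add: mult_ac)
    also have "s powr (-\<alpha> - 1) * s = s powr (-\<alpha>)"
      using s by (simp add: powr_diff)
    finally have 1: "cmod (F a - F b) \<le> 9 * 2 powr \<alpha> * M * rho a b * s powr (-\<alpha>)" .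
    have "weight \<alpha> a \<le> (2 * s) powr \<alpha>"
      using xs weight_base_pos[OF a] \<alpha> by (intro powr_mono2) auto
    also have "\<dots> = 2 powr \<alpha> * s powr \<alpha>"
      using s by (simp add: powr_mult)
    finally have "weight \<alpha> a * cmod (F a - F b) \<le>
        (2 powr \<alpha> * s powr \<alpha>) * (9 * 2 powr \<alpha> * M * rho a b * s powr (-\<alpha>))"
      by (intro mult_mono 1) auto
    also have "\<dots> = 9 * (2 powr \<alpha> * 2 powr \<alpha>) * M * rho a b"
      using s by (simp add: powr_minus)
    finally have 2: "weight \<alpha> a * cmod (F a - F b) \<le> 9 * (2 powr \<alpha> * 2 powr \<alpha>) * M * rho a b" .
    have "\<bar>weight \<alpha> a - weight \<alpha> b\<bar> * cmod (F b) \<le> 5 * \<alpha> * 2 powr \<alpha> * rho a b * weight \<alpha> b * cmod (F b)"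
      by (intro mult_right_mono weight_ratio a b True \<alpha>) simp
    also have "\<dots> = 5 * \<alpha> * 2 powr \<alpha> * rho a b * (weight \<alpha> b * cmod (F b))"
      by simp
    also have "\<dots> \<le> 5 * \<alpha> * 2 powr \<alpha> * rho a b * M"
      using \<alpha> rho by (intro mult_left_mono M b) auto
    finally have 3: "\<bar>weight \<alpha> a - weight \<alpha> b\<bar> * cmod (F b) \<le> 5 * \<alpha> * 2 powr \<alpha> * M * rho a b"
      by (simp add: mult_ac)
    have "of_real (weight \<alpha> a) * F a - of_real (weight \<alpha> b) * F b
        = of_real (weight \<alpha> a) * (F a - F b) + of_real (weight \<alpha> a - weight \<alpha> b) * F b"
      by (simp add: algebra_simps)
    then have "cmod (of_real (weight \<alpha> a) * F a - of_real (weight \<alpha> b) * F b)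
        \<le> cmod (of_real (weight \<alpha> a) * (F a - F b)) + cmod (of_real (weight \<alpha> a - weight \<alpha> b) * F b)"
      by (simp only: norm_triangle_ineq)
    also have "\<dots> = weight \<alpha> a * cmod (F a - F b) + \<bar>weight \<alpha> a - weight \<alpha> b\<bar> * cmod (F b)"
      by (simp only: norm_mult norm_of_real abs_of_nonneg powr_ge_zero)
    also have "\<dots> \<le> (9 * (2 powr \<alpha> * 2 powr \<alpha>) + 5 * \<alpha> * 2 powr \<alpha>) * M * rho a b"
      using 2 3 by (simp add: algebra_simps)
    also have "\<dots> \<le> C * M * rho a b"
      using M0 rho by (intro mult_right_mono) (auto simp: C_def)
    finally show ?thesis .
  qed
qed

lemma weight_small:
  assumes \<alpha>: "0 < \<alpha>" and e: "0 < e"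
  obtains r where "r < 1" "\<And>z. z \<in> disk \<Longrightarrow> r < cmod z \<Longrightarrow> weight \<alpha> z \<le> e"
proof (rule that[of "1 - e powr (1 / \<alpha>) / 2"])
  show "1 - e powr (1 / \<alpha>) / 2 < 1" using e by simp
  fix z :: complex
  assume z: "z \<in> disk" and r: "1 - e powr (1 / \<alpha>) / 2 < cmod z"
  have "(1 - cmod z) * (1 + cmod z) \<le> e powr (1 / \<alpha>) / 2 * 2"
    using r z by (intro mult_mono) auto
  then have "1 - (cmod z)\<^sup>2 \<le> e powr (1 / \<alpha>)"
    by (simp add: power2_eq_square algebra_simps)
  then have "weight \<alpha> z \<le> (e powr (1 / \<alpha>)) powr \<alpha>"
    using weight_base_pos[OF z] \<alpha> by (intro powr_mono2) auto
  also have "\<dots> = e"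
    using \<alpha> e by (simp add: powr_powr)
  finally show "weight \<alpha> z \<le> e" .
qed

section \<open>Binomial kernels\<close>

text \<open>The powers in numerator and denominator grow together, so \<gamma> changes the kernel
  off the diagonal but not its value at \<open>w\<close> itself.\<close>

definition kernel :: "real \<Rightarrow> real \<Rightarrow> complex \<Rightarrow> complex \<Rightarrow> complex" where
  "kernel \<alpha> \<gamma> w \<zeta> = of_real (weight \<gamma> w) * (1 - cnj w * \<zeta>) powr of_real (- (\<alpha> + \<gamma>))"

lemma kernel_holomorphic:
  assumes "w \<in> disk"
  shows "kernel \<alpha> \<gamma> w holomorphic_on disk"
proof -
  have "1 - cnj w * z \<notin> \<real>\<^sub>\<le>\<^sub>0" if "z \<in> disk" for z
    using cmod_cnj_mult_less_1[OF that assms] complex_Re_le_cmod[of "cnj w * z"]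
    by (auto simp: complex_nonpos_Reals_iff simp del: complex_mod_cnj)
  then show ?thesis
    unfolding kernel_def[abs_def] by (intro holomorphic_intros) auto
qed

lemma cmod_kernel:
  "cmod (kernel \<alpha> \<gamma> w \<zeta>) = weight \<gamma> w * cmod (1 - cnj w * \<zeta>) powr (- (\<alpha> + \<gamma>))"
  unfolding kernel_def norm_mult by (subst norm_powr_real_powr') auto

text \<open>This is \<open>weight_mult_le\<close> raised to the power \<alpha>. With \<gamma> =
  \<alpha> the kernel is the derivative of a Bloch function of norm at most 1, uniformly in
  \<open>w\<close>.\<close>

lemma weight_kernel_le:
  assumes w: "w \<in> disk" and z: "z \<in> disk" and \<alpha>: "0 < \<alpha>"
  shows "weight \<alpha> z * cmod (kernel \<alpha> \<alpha> w z) \<le> 1"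
proof -
  define d where "d = cmod (1 - cnj w * z)"
  have d: "0 < d" using one_minus_cnj_mult_pos[OF z w] by (simp add: d_def)
  have "weight \<alpha> z * weight \<alpha> w = ((1 - (cmod z)\<^sup>2) * (1 - (cmod w)\<^sup>2)) powr \<alpha>"
    using weight_base_pos[OF w] weight_base_pos[OF z] by (simp add: powr_mult)
  also have "\<dots> \<le> (d\<^sup>2) powr \<alpha>"
    using weight_mult_le[OF z w] weight_base_pos[OF w] weight_base_pos[OF z] \<alpha>
    by (intro powr_mono2) (auto simp: d_def)
  also have "\<dots> = d powr (\<alpha> + \<alpha>)"
    using d by (simp only: powr_add power2_eq_square powr_mult less_imp_le)
  finally have "weight \<alpha> z * weight \<alpha> w * d powr (- (\<alpha> + \<alpha>)) \<le> d powr (\<alpha> + \<alpha>) * d powr (- (\<alpha> + \<alpha>))"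
    by (rule mult_right_mono) simp
  then show ?thesis
    using d by (simp add: cmod_kernel d_def powr_minus mult.assoc)
qed

lemma kernel_self:
  assumes "w \<in> disk"
  shows "kernel \<alpha> \<gamma> w w = of_real (1 / weight \<alpha> w)"
proof -
  have pos: "0 < 1 - (cmod w)\<^sup>2"
    by (rule weight_base_pos[OF assms])
  have "1 - cnj w * w = of_real (1 - (cmod w)\<^sup>2)"
    by (subst of_real_diff) (simp add: complex_norm_square mult.commute del: of_real_power)
  then have "kernel \<alpha> \<gamma> w w = of_real (weight \<gamma> w * weight (- (\<alpha> + \<gamma>)) w)"
    unfolding kernel_def using pos by (simp only: powr_of_real less_imp_le of_real_mult)
  also have "weight \<gamma> w * weight (- (\<alpha> + \<gamma>)) w = weight (- \<alpha>) w"
    by (simp flip: powr_add)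
  also have "weight (- \<alpha>) w = 1 / weight \<alpha> w"
    by (rule powr_minus_divide)
  finally show ?thesis .
qed

text \<open>The second kernel is the first times (1 - |w|^2) / (1 - cnj w z), and 1 minus this
  factor is cnj w (w - z) / (1 - cnj w z). Hence the distance appears exactly, with an extra |w|
  that later requires \<open>w\<close> to stay away from 0.\<close>

lemma kernel_diff:
  assumes w: "w \<in> disk" and z: "z \<in> disk"
  shows "cmod (kernel \<alpha> \<alpha> w z - kernel \<alpha> (\<alpha> + 1) w z) = cmod (kernel \<alpha> \<alpha> w z) * cmod w * rho z w"
proof -
  define d where "d = 1 - cnj w * z"
  define x where "x = 1 - (cmod w)\<^sup>2"
  have d: "d \<noteq> 0" using one_minus_cnj_mult_pos[OF z w] by (auto simp: d_def)
  have x: "0 < x" using weight_base_pos[OF w] by (simp add: x_def)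
  have "of_real (- (\<alpha> + (\<alpha> + 1))) = of_real (- (\<alpha> + \<alpha>)) - (1 :: complex)"
    by simp
  then have 1: "d powr of_real (- (\<alpha> + (\<alpha> + 1))) = d powr of_real (- (\<alpha> + \<alpha>)) / d"
    using d by (simp only: powr_diff) simp
  have "x powr (\<alpha> + 1) = x powr \<alpha> * x"
    using x by (simp add: powr_add)
  then have "kernel \<alpha> \<alpha> w z - kernel \<alpha> (\<alpha> + 1) w z = kernel \<alpha> \<alpha> w z * (1 - of_real x / d)"
    unfolding kernel_def 1 d_def[symmetric] x_def[symmetric] by (simp add: algebra_simps)
  also have "1 - of_real x / d = cnj w * (w - z) / d"
  proof -
    have "d - of_real x = cnj w * (w - z)"
      unfolding x_def d_def of_real_diff complex_norm_square by (simp add: algebra_simps)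
    then show ?thesis
      using d by (metis diff_divide_distrib divide_self)
  qed
  finally show ?thesis
    by (simp add: norm_mult norm_divide rho_def d_def)
qed

section \<open>Binomial series and the transfer of monomial bounds to kernels\<close>

lemma binomial_sums_real:
  fixes x s :: real
  assumes "0 \<le> x" "x < 1"
  shows "(\<lambda>n. pochhammer s n / fact n * x ^ n) sums ((1 - x) powr (- s))"
proof -
  have "(\<lambda>n. (- s gchoose n) * (- x) ^ n) sums (1 + - x) powr (- s)"
    by (rule gen_binomial_real) (use assms in auto)
  moreover have "(- s gchoose n) * (- x) ^ n = pochhammer s n / fact n * x ^ n" for n
    by (simp add: gbinomial_pochhammer power_minus[of x])
  ultimately show ?thesis by simp
qed

lemma binomial_sums_complex:
  fixes x :: complex and s :: real
  assumes "cmod x < 1"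
  shows "(\<lambda>n. of_real (pochhammer s n / fact n) * x ^ n) sums ((1 - x) powr of_real (- s))"
proof -
  have "(\<lambda>n. (- of_real s gchoose n) * (- x) ^ n) sums (1 + - x) powr (- of_real s)"
    by (rule gen_binomial_complex) (use assms in auto)
  moreover have "(- of_real s gchoose n) * (- x) ^ n = of_real (pochhammer s n / fact n) * x ^ n" for n
    by (simp add: gbinomial_pochhammer power_minus[of x] pochhammer_of_real)
  ultimately show ?thesis by simp
qed

text \<open>The quotient of the two Gamma series is the Pochhammer quotient divided by n^\<alpha>.
  It converges to a quotient of Gamma values and is therefore bounded.\<close>

lemma pochhammer_ratio_bound:
  fixes \<alpha> \<gamma> :: real
  assumes "0 < \<alpha>" "0 < \<gamma>"
  obtains C where "0 < C" "\<And>n. pochhammer (\<alpha> + \<gamma>) n \<le> C * (real (n + 1) powr \<alpha> * pochhammer \<gamma> n)"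
proof -
  define q where "q n = Gamma_series' \<gamma> n / Gamma_series' (\<alpha> + \<gamma>) n" for n
  have "Gamma (\<alpha> + \<gamma>) > 0"
    using assms by (intro Gamma_real_pos) auto
  then have "q \<longlonglongrightarrow> Gamma \<gamma> / Gamma (\<alpha> + \<gamma>)"
    unfolding q_def by (intro tendsto_divide Gamma_series'_LIMSEQ) auto
  then have "Bseq q"
    by (intro convergent_imp_Bseq) (auto simp: convergent_def)
  then obtain K where K: "K > 0" "\<And>n. norm (q n) \<le> K"
    by (auto simp: Bseq_def)
  show ?thesis
  \<comment> \<open>The extra \<open>1\<close> covers n = 0, which is treated apart because the
    formula for \<open>q\<close> below holds only for positive n.\<close>
  proof (rule that[of "K + 1"])
    show "0 < K + 1" using K by simp
    fix n
    show "pochhammer (\<alpha> + \<gamma>) n \<le> (K + 1) * (real (n + 1) powr \<alpha> * pochhammer \<gamma> n)"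
    proof (cases "n = 0")
      case True
      then show ?thesis using K by simp
    next
      case False
      have pos: "pochhammer (\<alpha> + \<gamma>) n > 0" "pochhammer \<gamma> n > 0"
        using assms by (auto intro!: pochhammer_pos)
      have "exp ((\<alpha> + \<gamma>) * ln (real n)) = real n powr \<alpha> * exp (\<gamma> * ln (real n))"
        using False by (simp add: powr_def exp_add distrib_right)
      then have "q n = pochhammer (\<alpha> + \<gamma>) n / (pochhammer \<gamma> n * real n powr \<alpha>)"
        by (simp add: q_def Gamma_series'_def)
      moreover have "q n \<le> K"
        using K(2)[of n] by auto
      ultimately have "pochhammer (\<alpha> + \<gamma>) n / (pochhammer \<gamma> n * real n powr \<alpha>) \<le> K"
        by simp
      then have "pochhammer (\<alpha> + \<gamma>) n \<le> K * (pochhammer \<gamma> n * real n powr \<alpha>)"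
        using pos False by (simp add: divide_le_eq)
      also have "\<dots> \<le> (K + 1) * (pochhammer \<gamma> n * real (n + 1) powr \<alpha>)"
        using K pos assms by (intro mult_mono powr_mono2) auto
      finally show ?thesis by (simp add: mult_ac)
    qed
  qed
qed

text \<open>The difference is a power series in cnj w whose coefficients contain a^n X - b^n Y.
  Trading (\<alpha> + \<gamma>)_n for (n + 1)^\<alpha> (\<gamma>)_n makes the hypothesis applicable
  and leaves the binomial series of (1 - |w|)^(-\<gamma>), which \<open>weight \<gamma> w\<close>
  compensates. The finitely many terms below \<open>N\<close> are estimated trivially.\<close>

lemma kernel_difference_bound:
  fixes \<alpha> \<gamma> :: real
  assumes \<alpha>: "0 < \<alpha>" and \<gamma>: "0 < \<gamma>"
  obtains C where "0 < C" and
    "\<And>N Q L a b w X Y. a \<in> disk \<Longrightarrow> b \<in> disk \<Longrightarrow> w \<in> disk \<Longrightarrow> 0 \<le> L \<Longrightarrow> cmod X \<le> Q \<Longrightarrow> cmod Y \<le> Q \<Longrightarrow>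
      (\<And>n. n \<ge> N \<Longrightarrow> real (n + 1) powr \<alpha> * cmod (a ^ n * X - b ^ n * Y) \<le> L) \<Longrightarrow>
      cmod (kernel \<alpha> \<gamma> w a * X - kernel \<alpha> \<gamma> w b * Y)
        \<le> C * (L + weight \<gamma> w * (\<Sum>n<N. pochhammer \<gamma> n / fact n * (real (n + 1) powr \<alpha> * (2 * Q))))"
proof -
  obtain K where K: "0 < K" "\<And>n. pochhammer (\<alpha> + \<gamma>) n \<le> K * (real (n + 1) powr \<alpha> * pochhammer \<gamma> n)"
    using pochhammer_ratio_bound[OF \<alpha> \<gamma>] by blast
  show ?thesis
  proof (rule that[of "K * 2 powr \<gamma>"])
    show "0 < K * 2 powr \<gamma>" using K by simp
    fix N and Q L :: real and a b w X Y
    assume a: "a \<in> disk" and b: "b \<in> disk" and w: "w \<in> disk" and L: "0 \<le> L"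
      and X: "cmod X \<le> Q" and Y: "cmod Y \<le> Q"
      and N: "\<And>n. n \<ge> N \<Longrightarrow> real (n + 1) powr \<alpha> * cmod (a ^ n * X - b ^ n * Y) \<le> L"
    define c where "c n = pochhammer \<gamma> n / fact n" for n
    have c0: "c n \<ge> 0" for n
      using \<gamma> by (auto simp: c_def intro!: divide_nonneg_nonneg less_imp_le[OF pochhammer_pos])
    define e where "e n = real (n + 1) powr \<alpha> * (2 * Q)" for n
    have Q: "0 \<le> Q" using X by (rule order_trans[rotated]) simp
    define S where "S = (\<Sum>n<N. c n * e n)"
    define t where "t n = of_real (pochhammer (\<alpha> + \<gamma>) n / fact n) * cnj w ^ n * (a ^ n * X - b ^ n * Y)" for n
    have "(\<lambda>n. of_real (pochhammer (\<alpha> + \<gamma>) n / fact n) * (cnj w * a) ^ n * X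
        - of_real (pochhammer (\<alpha> + \<gamma>) n / fact n) * (cnj w * b) ^ n * Y) sums
        ((1 - cnj w * a) powr of_real (- (\<alpha> + \<gamma>)) * X - (1 - cnj w * b) powr of_real (- (\<alpha> + \<gamma>)) * Y)"
      by (intro sums_diff sums_mult2 binomial_sums_complex cmod_cnj_mult_less_1 a b w)
    then have t: "t sums ((1 - cnj w * a) powr of_real (- (\<alpha> + \<gamma>)) * X - (1 - cnj w * b) powr of_real (- (\<alpha> + \<gamma>)) * Y)"
      by (simp add: t_def[abs_def] power_mult_distrib algebra_simps diff_divide_distrib)
    \<comment> \<open>Below \<open>N\<close> only the trivial bound 2 Q is available. Keeping
      \<open>L\<close> there as well gives one formula for all n, whose first part sums to a
      complete binomial series.\<close>
    have D: "real (n + 1) powr \<alpha> * cmod (a ^ n * X - b ^ n * Y) \<le> L + (if n < N then e n else 0)" for n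
    proof (cases "n < N")
      case True
      have pw: "cmod (u ^ n * V) \<le> Q" if "u \<in> disk" "cmod V \<le> Q" for u V
        using mult_mono[of "cmod u ^ n" 1 "cmod V" Q] that
        by (simp add: norm_mult norm_power power_le_one)
      have "cmod (a ^ n * X - b ^ n * Y) \<le> 2 * Q"
        by (rule order_trans[OF norm_triangle_ineq4]) (use pw[OF a X] pw[OF b Y] in simp)
      then have "real (n + 1) powr \<alpha> * cmod (a ^ n * X - b ^ n * Y) \<le> e n"
        unfolding e_def by (intro mult_left_mono) auto
      then show ?thesis using True L by simp
    qed (use N in auto)
    have bd: "norm (t n) \<le> K * (L * (c n * cmod w ^ n) + (if n < N then c n * e n else 0))" for n
    proof -
      have "norm (t n) = (pochhammer (\<alpha> + \<gamma>) n / fact n) * cmod w ^ n * cmod (a ^ n * X - b ^ n * Y)"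
        using \<alpha> \<gamma> by (simp add: t_def norm_mult norm_divide norm_power pochhammer_nonneg)
      also have "\<dots> \<le> (K * (real (n + 1) powr \<alpha> * pochhammer \<gamma> n) / fact n) * cmod w ^ n * cmod (a ^ n * X - b ^ n * Y)"
        by (intro mult_right_mono divide_right_mono K) auto
      also have "\<dots> = K * (c n * cmod w ^ n) * (real (n + 1) powr \<alpha> * cmod (a ^ n * X - b ^ n * Y))"
        by (simp add: c_def)
      also have "\<dots> \<le> K * (c n * cmod w ^ n) * (L + (if n < N then e n else 0))"
        using K c0 by (intro mult_left_mono D) auto
      also have "\<dots> = K * (L * (c n * cmod w ^ n) + (if n < N then c n * e n else 0) * cmod w ^ n)"
        by (simp add: algebra_simps)
      also have "\<dots> \<le> K * (L * (c n * cmod w ^ n) + (if n < N then c n * e n else 0) * 1)"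
        using K c0 w Q by (intro mult_left_mono add_left_mono) (auto simp: power_le_one e_def)
      finally show ?thesis by simp
    qed
    have major: "(\<lambda>n. K * (L * (c n * cmod w ^ n) + (if n < N then c n * e n else 0))) sums
        (K * (L * (1 - cmod w) powr (- \<gamma>) + S))"
    proof -
      have "(\<lambda>n. c n * cmod w ^ n) sums ((1 - cmod w) powr (- \<gamma>))"
        unfolding c_def using w by (intro binomial_sums_real) auto
      moreover have "(\<lambda>n. if n < N then c n * e n else 0) sums S"
        unfolding S_def using sums_If_finite[of "\<lambda>n. n < N" "\<lambda>n. c n * e n"] by (simp add: lessThan_def)
      ultimately show ?thesis
        by (intro sums_mult sums_add)
    qed
    have "norm (suminf t) \<le> K * (L * (1 - cmod w) powr (- \<gamma>) + S)"
      using norm_suminf_le[OF bd sums_summable[OF major]] unfolding sums_unique[OF major, symmetric] .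
    then have "weight \<gamma> w * norm (suminf t) \<le> weight \<gamma> w * (K * (L * (1 - cmod w) powr (- \<gamma>) + S))"
      by (rule mult_left_mono) simp
    also have "\<dots> = K * (L * (weight \<gamma> w * (1 - cmod w) powr (- \<gamma>)) + weight \<gamma> w * S)"
      by (simp add: algebra_simps)
    \<comment> \<open>Here (1 - |w|^2)^\<gamma> meets (1 - |w|)^(-\<gamma>), leaving (1 +
      |w|)^\<gamma> \<le> 2^\<gamma>. The finite part is enlarged by the same factor so that it can
      be pulled out.\<close>
    also have "\<dots> \<le> K * (L * 2 powr \<gamma> + 2 powr \<gamma> * (weight \<gamma> w * S))"
    proof -
      have w1: "0 < 1 - cmod w" using w by simp
      have "1 - (cmod w)\<^sup>2 = (1 - cmod w) * (1 + cmod w)"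
        by (simp add: power2_eq_square algebra_simps)
      then have "weight \<gamma> w * (1 - cmod w) powr (- \<gamma>) = (1 + cmod w) powr \<gamma>"
        using w1 by (simp add: powr_mult powr_minus)
      also have "\<dots> \<le> 2 powr \<gamma>"
        using w \<gamma> by (intro powr_mono2) auto
      finally have 1: "weight \<gamma> w * (1 - cmod w) powr (- \<gamma>) \<le> 2 powr \<gamma>" .
      have "0 \<le> weight \<gamma> w * S"
        unfolding S_def e_def using c0 Q by (intro mult_nonneg_nonneg sum_nonneg) auto
      moreover have "1 \<le> 2 powr \<gamma>"
        using \<gamma> by (simp add: ge_one_powr_ge_zero)
      ultimately have "weight \<gamma> w * S \<le> 2 powr \<gamma> * (weight \<gamma> w * S)"
        using mult_right_mono[of 1 "2 powr \<gamma>" "weight \<gamma> w * S"] by simp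
      then show ?thesis
        using K L 1 by (intro mult_left_mono add_mono) auto
    qed
    also have "\<dots> = K * 2 powr \<gamma> * (L + weight \<gamma> w * S)"
      by (simp add: algebra_simps)
    finally have fin: "weight \<gamma> w * norm (suminf t) \<le> K * 2 powr \<gamma> * (L + weight \<gamma> w * S)" .
    have "kernel \<alpha> \<gamma> w a * X - kernel \<alpha> \<gamma> w b * Y = of_real (weight \<gamma> w) * suminf t"
      unfolding kernel_def sums_unique[OF t, symmetric] by (simp only: right_diff_distrib mult.assoc)
    then have "cmod (kernel \<alpha> \<gamma> w a * X - kernel \<alpha> \<gamma> w b * Y) = weight \<gamma> w * norm (suminf t)"
      by (simp add: norm_mult)
    with fin show "cmod (kernel \<alpha> \<gamma> w a * X - kernel \<alpha> \<gamma> w b * Y)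
        \<le> K * 2 powr \<gamma> * (L + weight \<gamma> w * (\<Sum>n<N. pochhammer \<gamma> n / fact n * (real (n + 1) powr \<alpha> * (2 * Q))))"
      by (simp add: S_def c_def e_def)
  qed
qed

text \<open>The finite sum in \<open>kernel_difference_bound\<close> carries
  \<open>weight \<gamma> w\<close>, which falls below any bound near the circle. Only the radius
  \<open>r\<close> depends on \<open>N\<close>, \<open>Q\<close> and \<open>L\<close>; the constant
  \<open>C\<close> is fixed before them.\<close>

lemma kernel_boundary_estimate:
  fixes \<alpha> \<gamma> :: real
  assumes \<alpha>: "0 < \<alpha>" and \<gamma>: "0 < \<gamma>"
  obtains C where "0 < C" and
    "\<And>N Q L. 0 < L \<Longrightarrow> \<exists>r<1. \<forall>a b w X Y. a \<in> disk \<longrightarrow> b \<in> disk \<longrightarrow> w \<in> disk \<longrightarrow> r < cmod w \<longrightarrow>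
      cmod X \<le> Q \<longrightarrow> cmod Y \<le> Q \<longrightarrow>
      (\<forall>n\<ge>N. real (n + 1) powr \<alpha> * cmod (a ^ n * X - b ^ n * Y) \<le> L) \<longrightarrow>
      cmod (kernel \<alpha> \<gamma> w a * X - kernel \<alpha> \<gamma> w b * Y) \<le> C * L"
proof -
  obtain C where C: "0 < C" "\<And>N Q L a b w X Y. a \<in> disk \<Longrightarrow> b \<in> disk \<Longrightarrow> w \<in> disk \<Longrightarrow> 0 \<le> L \<Longrightarrow> cmod X \<le> Q \<Longrightarrow> cmod Y \<le> Q \<Longrightarrow>
      (\<And>n. n \<ge> N \<Longrightarrow> real (n + 1) powr \<alpha> * cmod (a ^ n * X - b ^ n * Y) \<le> L) \<Longrightarrow>
      cmod (kernel \<alpha> \<gamma> w a * X - kernel \<alpha> \<gamma> w b * Y)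
        \<le> C * (L + weight \<gamma> w * (\<Sum>n<N. pochhammer \<gamma> n / fact n * (real (n + 1) powr \<alpha> * (2 * Q))))"
    using kernel_difference_bound[OF \<alpha> \<gamma>] by blast
  show ?thesis
  proof (rule that[of "2 * C"])
    show "0 < 2 * C" using C by simp
    fix N and Q L :: real assume L: "0 < L"
    define S where "S = (\<Sum>n<N. pochhammer \<gamma> n / fact n * (real (n + 1) powr \<alpha> * (2 * Q)))"
    obtain r where r: "r < 1" "\<And>z. z \<in> disk \<Longrightarrow> r < cmod z \<Longrightarrow> weight \<gamma> z \<le> L / (\<bar>S\<bar> + 1)"
      using weight_small[OF \<gamma>, of "L / (\<bar>S\<bar> + 1)"] L by (metis abs_ge_zero add_nonneg_pos divide_pos_pos zero_less_one)
    show "\<exists>r<1. \<forall>a b w X Y. a \<in> disk \<longrightarrow> b \<in> disk \<longrightarrow> w \<in> disk \<longrightarrow> r < cmod w \<longrightarrow>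
      cmod X \<le> Q \<longrightarrow> cmod Y \<le> Q \<longrightarrow>
      (\<forall>n\<ge>N. real (n + 1) powr \<alpha> * cmod (a ^ n * X - b ^ n * Y) \<le> L) \<longrightarrow>
      cmod (kernel \<alpha> \<gamma> w a * X - kernel \<alpha> \<gamma> w b * Y) \<le> 2 * C * L"
    proof (intro exI[of _ r] conjI allI impI)
      show "r < 1" by (rule r)
      fix a b w X Y
      assume a: "a \<in> disk" and b: "b \<in> disk" and w: "w \<in> disk" and rw: "r < cmod w"
        and XY: "cmod X \<le> Q" "cmod Y \<le> Q"
        and N: "\<forall>n\<ge>N. real (n + 1) powr \<alpha> * cmod (a ^ n * X - b ^ n * Y) \<le> L"
      have "weight \<gamma> w * (\<bar>S\<bar> + 1) \<le> L"
        using r(2)[OF w rw] by (simp add: le_divide_eq)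
      moreover have "weight \<gamma> w * S \<le> weight \<gamma> w * (\<bar>S\<bar> + 1)"
        by (intro mult_left_mono) auto
      ultimately have "C * (L + weight \<gamma> w * S) \<le> C * (L + L)"
        using C by (intro mult_left_mono) auto
      moreover have "cmod (kernel \<alpha> \<gamma> w a * X - kernel \<alpha> \<gamma> w b * Y) \<le> C * (L + weight \<gamma> w * S)"
        unfolding S_def using C(2)[OF a b w _ XY] L N by simp
      ultimately show "cmod (kernel \<alpha> \<gamma> w a * X - kernel \<alpha> \<gamma> w b * Y) \<le> 2 * C * L"
        by simp
    qed
  qed
qed

text \<open>The kernels with exponents \<open>\<alpha>\<close> and \<open>\<alpha> + 1\<close> agree at \<open>w = a\<close>, whereas at \<open>b\<close> they differ
  by a factor comparable to the pseudo-hyperbolic distance of \<open>a\<close> and \<open>b\<close>; this isolates the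
  contribution of \<open>Y\<close>.\<close>

lemma quotient_estimate:
  fixes \<alpha> :: real
  assumes \<alpha>: "0 < \<alpha>"
  obtains C where "0 < C" and
    "\<And>N Q L. 0 < L \<Longrightarrow> \<exists>r<1. \<forall>a b X Y. a \<in> disk \<longrightarrow> b \<in> disk \<longrightarrow>
      cmod X \<le> Q \<longrightarrow> cmod Y \<le> Q \<longrightarrow>
      (\<forall>n\<ge>N. real (n + 1) powr \<alpha> * cmod (a ^ n * X - b ^ n * Y) \<le> L) \<longrightarrow>
      (r < cmod a \<longrightarrow> cmod (X / of_real (weight \<alpha> a)) * rho a b \<le> C * L) \<and>
      (r < cmod b \<longrightarrow> cmod (Y / of_real (weight \<alpha> b)) * rho a b \<le> C * L) \<and>
      (r < cmod a \<longrightarrow> r < cmod b \<longrightarrow>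
        cmod (X / of_real (weight \<alpha> a) - Y / of_real (weight \<alpha> b)) \<le> C * L)"
proof -
  obtain C1 where C1: "0 < C1" "\<And>N Q L. 0 < L \<Longrightarrow> \<exists>r<1. \<forall>a b w X Y. a \<in> disk \<longrightarrow> b \<in> disk \<longrightarrow> w \<in> disk \<longrightarrow> r < cmod w \<longrightarrow>
      cmod X \<le> Q \<longrightarrow> cmod Y \<le> Q \<longrightarrow>
      (\<forall>n\<ge>N. real (n + 1) powr \<alpha> * cmod (a ^ n * X - b ^ n * Y) \<le> L) \<longrightarrow>
      cmod (kernel \<alpha> \<alpha> w a * X - kernel \<alpha> \<alpha> w b * Y) \<le> C1 * L"
    using kernel_boundary_estimate[OF \<alpha> \<alpha>] by blast
  obtain C2 where C2: "0 < C2" "\<And>N Q L. 0 < L \<Longrightarrow> \<exists>r<1. \<forall>a b w X Y. a \<in> disk \<longrightarrow> b \<in> disk \<longrightarrow> w \<in> disk \<longrightarrow> r < cmod w \<longrightarrow>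
      cmod X \<le> Q \<longrightarrow> cmod Y \<le> Q \<longrightarrow>
      (\<forall>n\<ge>N. real (n + 1) powr \<alpha> * cmod (a ^ n * X - b ^ n * Y) \<le> L) \<longrightarrow>
      cmod (kernel \<alpha> (\<alpha> + 1) w a * X - kernel \<alpha> (\<alpha> + 1) w b * Y) \<le> C2 * L"
    using kernel_boundary_estimate[OF \<alpha>, of "\<alpha> + 1"] \<alpha> by (metis add_pos_pos zero_less_one)
  obtain C3 where C3: "0 < C3" "\<And>F M a b. F holomorphic_on disk \<Longrightarrow> (\<And>z. z \<in> disk \<Longrightarrow> weight \<alpha> z * cmod (F z) \<le> M) \<Longrightarrow>
        a \<in> disk \<Longrightarrow> b \<in> disk \<Longrightarrow>
        cmod (of_real (weight \<alpha> a) * F a - of_real (weight \<alpha> b) * F b) \<le> C3 * M * rho a b"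
    using weighted_lipschitz[OF \<alpha>] by blast
  \<comment> \<open>\<open>C1 + C2\<close> arises from subtracting the two kernel estimates,
    \<open>2\<close> from |a| > 1/2, and the first \<open>C1\<close> from passing from the kernel
    term back to X / weight.\<close>
  define C0 where "C0 = C1 + 2 * (C1 + C2)"
  define C where "C = C0 + C1 + C0 * C3"
  have C0: "0 < C0" using C1 C2 by (simp add: C0_def)
  have "C0 \<le> C" using C1 C0 C3 by (simp add: C_def)
  show ?thesis
  proof (rule that[of C])
    show "0 < C" using C0 \<open>C0 \<le> C\<close> by simp
    fix N and Q L :: real assume L: "0 < L"
    obtain r1 where r1: "r1 < 1" "\<And>a b w X Y. a \<in> disk \<Longrightarrow> b \<in> disk \<Longrightarrow> w \<in> disk \<Longrightarrow> r1 < cmod w \<Longrightarrow>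
      cmod X \<le> Q \<Longrightarrow> cmod Y \<le> Q \<Longrightarrow>
      \<forall>n\<ge>N. real (n + 1) powr \<alpha> * cmod (a ^ n * X - b ^ n * Y) \<le> L \<Longrightarrow>
      cmod (kernel \<alpha> \<alpha> w a * X - kernel \<alpha> \<alpha> w b * Y) \<le> C1 * L"
      using C1(2)[OF L, where N = N and Q = Q] by blast
    obtain r2 where r2: "r2 < 1" "\<And>a b w X Y. a \<in> disk \<Longrightarrow> b \<in> disk \<Longrightarrow> w \<in> disk \<Longrightarrow> r2 < cmod w \<Longrightarrow>
      cmod X \<le> Q \<Longrightarrow> cmod Y \<le> Q \<Longrightarrow>
      \<forall>n\<ge>N. real (n + 1) powr \<alpha> * cmod (a ^ n * X - b ^ n * Y) \<le> L \<Longrightarrow>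
      cmod (kernel \<alpha> (\<alpha> + 1) w a * X - kernel \<alpha> (\<alpha> + 1) w b * Y) \<le> C2 * L"
      using C2(2)[OF L, where N = N and Q = Q] by blast
    \<comment> \<open>The \<open>1/2\<close> bounds the factor \<open>cmod a\<close> produced by
      \<open>kernel_diff\<close> from below.\<close>
    define r where "r = max (1/2) (max r1 r2)"
    have r: "r < 1" using r1 r2 by (simp add: r_def)
    have main: "cmod (kernel \<alpha> \<alpha> a b * Y) * rho a b \<le> 2 * (C1 + C2) * L \<and>
        cmod (X / of_real (weight \<alpha> a)) * rho a b \<le> C0 * L"
      if a: "a \<in> disk" and b: "b \<in> disk" and ra: "r < cmod a" and X: "cmod X \<le> Q" and Y: "cmod Y \<le> Q"
        and N: "\<forall>n\<ge>N. real (n + 1) powr \<alpha> * cmod (a ^ n * X - b ^ n * Y) \<le> L" for a b X Y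
    proof -
      let ?u = "X / of_real (weight \<alpha> a)"
      have e1: "cmod (?u - kernel \<alpha> \<alpha> a b * Y) \<le> C1 * L"
        using r1(2)[OF a b a _ X Y N] ra kernel_self[OF a, of \<alpha> \<alpha>] by (simp add: r_def)
      have e2: "cmod (?u - kernel \<alpha> (\<alpha> + 1) a b * Y) \<le> C2 * L"
        using r2(2)[OF a b a _ X Y N] ra kernel_self[OF a, of \<alpha> "\<alpha> + 1"] by (simp add: r_def)
      have "(kernel \<alpha> \<alpha> a b - kernel \<alpha> (\<alpha> + 1) a b) * Y
          = (?u - kernel \<alpha> (\<alpha> + 1) a b * Y) - (?u - kernel \<alpha> \<alpha> a b * Y)"
        by (simp add: algebra_simps)
      then have "cmod ((kernel \<alpha> \<alpha> a b - kernel \<alpha> (\<alpha> + 1) a b) * Y) \<le> C2 * L + C1 * L"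
        using norm_triangle_le_diff[OF add_mono[OF e2 e1]] by simp
      then have "cmod a * (cmod (kernel \<alpha> \<alpha> a b * Y) * rho a b) \<le> (C1 + C2) * L"
        by (simp add: norm_mult kernel_diff[OF a b] rho_commute[of b a] mult_ac distrib_left)
      moreover have "1/2 * (cmod (kernel \<alpha> \<alpha> a b * Y) * rho a b) \<le> cmod a * (cmod (kernel \<alpha> \<alpha> a b * Y) * rho a b)"
        using ra rho_nonneg[of a b] by (intro mult_right_mono) (auto simp: r_def)
      ultimately have 1: "cmod (kernel \<alpha> \<alpha> a b * Y) * rho a b \<le> 2 * (C1 + C2) * L"
        by linarith
      have "cmod ?u \<le> C1 * L + cmod (kernel \<alpha> \<alpha> a b * Y)"
        using e1 norm_triangle_sub[of ?u "kernel \<alpha> \<alpha> a b * Y"] by simp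
      then have "cmod ?u * rho a b \<le> C1 * L * rho a b + cmod (kernel \<alpha> \<alpha> a b * Y) * rho a b"
        using mult_right_mono[OF _ rho_nonneg[of a b]] by (fastforce simp: distrib_right)
      also have "C1 * L * rho a b \<le> C1 * L"
        using C1 L rho_le_1[OF a b] by (simp add: mult_left_le)
      finally show ?thesis using 1 by (simp add: C0_def algebra_simps)
    qed
    show "\<exists>r<1. \<forall>a b X Y. a \<in> disk \<longrightarrow> b \<in> disk \<longrightarrow>
      cmod X \<le> Q \<longrightarrow> cmod Y \<le> Q \<longrightarrow>
      (\<forall>n\<ge>N. real (n + 1) powr \<alpha> * cmod (a ^ n * X - b ^ n * Y) \<le> L) \<longrightarrow>
      (r < cmod a \<longrightarrow> cmod (X / of_real (weight \<alpha> a)) * rho a b \<le> C * L) \<and>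
      (r < cmod b \<longrightarrow> cmod (Y / of_real (weight \<alpha> b)) * rho a b \<le> C * L) \<and>
      (r < cmod a \<longrightarrow> r < cmod b \<longrightarrow>
        cmod (X / of_real (weight \<alpha> a) - Y / of_real (weight \<alpha> b)) \<le> C * L)"
    proof (intro exI[of _ r] conjI allI impI r)
      fix a b X Y
      assume a: "a \<in> disk" and b: "b \<in> disk" and X: "cmod X \<le> Q" and Y: "cmod Y \<le> Q"
        and N: "\<forall>n\<ge>N. real (n + 1) powr \<alpha> * cmod (a ^ n * X - b ^ n * Y) \<le> L"
      \<comment> \<open>The hypothesis is symmetric under exchanging (a, X) with (b, Y), so
        \<open>main\<close> also controls the quotient of Y.\<close>
      then have N': "\<forall>n\<ge>N. real (n + 1) powr \<alpha> * cmod (b ^ n * Y - a ^ n * X) \<le> L"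
        by (simp add: norm_minus_commute)
      have CL: "C0 * L \<le> C * L" using \<open>C0 \<le> C\<close> L by simp
      show "cmod (X / of_real (weight \<alpha> a)) * rho a b \<le> C * L" if "r < cmod a"
        using main[OF a b that X Y N] CL by linarith
      have vb: "cmod (Y / of_real (weight \<alpha> b)) * rho a b \<le> C0 * L" if "r < cmod b"
        using main[OF b a that Y X N'] rho_commute[of a b] by metis
      then show "cmod (Y / of_real (weight \<alpha> b)) * rho a b \<le> C * L" if "r < cmod b"
        using that CL by fastforce
      assume ra: "r < cmod a" and rb: "r < cmod b"
      let ?u = "X / of_real (weight \<alpha> a)" and ?v = "Y / of_real (weight \<alpha> b)"
      \<comment> \<open>Since the first product equals 1, \<open>k\<close> measures how far the
        kernel at b is from 1 / weight at b. Replacing one by the other costs |v| |k|, which is at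
        most a multiple of |v| rho, a quantity already bounded by \<open>vb\<close>.\<close>
      define k where "k = of_real (weight \<alpha> a) * kernel \<alpha> \<alpha> a a - of_real (weight \<alpha> b) * kernel \<alpha> \<alpha> a b"
      have e1: "cmod (?u - kernel \<alpha> \<alpha> a b * Y) \<le> C1 * L"
        using r1(2)[OF a b a _ X Y N] ra kernel_self[OF a, of \<alpha> \<alpha>] by (simp add: r_def)
      have k: "cmod k \<le> C3 * 1 * rho a b"
        unfolding k_def
        by (rule C3(2)[OF kernel_holomorphic[OF a] _ a b]) (use weight_kernel_le[OF a _ \<alpha>] in auto)
      have "of_real (weight \<alpha> a) * kernel \<alpha> \<alpha> a a = 1"
        using weight_pos[OF a, of \<alpha>] by (simp add: kernel_self[OF a])
      then have "?u - ?v = (?u - kernel \<alpha> \<alpha> a b * Y) - ?v * k"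
        unfolding k_def using weight_pos[OF b, of \<alpha>] by (simp add: field_simps)
      then have "cmod (?u - ?v) \<le> cmod (?u - kernel \<alpha> \<alpha> a b * Y) + cmod ?v * cmod k"
        by (metis norm_mult norm_triangle_ineq4)
      also have "\<dots> \<le> C1 * L + cmod ?v * (C3 * rho a b)"
        using e1 k by (intro add_mono mult_left_mono) auto
      also have "\<dots> = C1 * L + C3 * (cmod ?v * rho a b)"
        by simp
      also have "\<dots> \<le> C1 * L + C3 * (C0 * L)"
        using C3(1) vb[OF rb] by (intro add_left_mono mult_left_mono) auto
      also have "\<dots> \<le> C * L"
        using C0 L by (simp add: C_def algebra_simps)
      finally show "cmod (?u - ?v) \<le> C * L" .
    qed
  qed
qed

section \<open>Compact operators on null sequences\<close>

text \<open>Indices are chosen one at a time. The sum selected so far is small near the circle, and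
  the next index is taken so late that its hump is small on the remaining compact disc. At every
  point at most one of the two contributions is then large.\<close>

lemma gliding_hump:
  fixes p :: "nat \<Rightarrow> complex \<Rightarrow> real"
  assumes nonneg: "\<And>n z. z \<in> disk \<Longrightarrow> 0 \<le> p n z" and le1: "\<And>n z. z \<in> disk \<Longrightarrow> p n z \<le> 1"
    and little: "\<And>n e. 0 < e \<Longrightarrow> \<exists>r<1. \<forall>z\<in>disk. r < cmod z \<longrightarrow> p n z \<le> e"
    and null: "\<And>r e. r < 1 \<Longrightarrow> 0 < e \<Longrightarrow> \<exists>n0. \<forall>n\<ge>n0. \<forall>z. cmod z \<le> r \<longrightarrow> p n z \<le> e"
    and S: "infinite S"
  shows "\<exists>I\<subseteq>S. finite I \<and> card I = N \<and> (\<forall>z\<in>disk. (\<Sum>n\<in>I. p n z) \<le> 2)"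
proof -
  \<comment> \<open>Two strengthenings carry the induction: the bound 2 - 2^(-N) leaves room for the
    next hump, and the decay of the finite sum at the circle provides the radius beyond which the
    new hump may be large.\<close>
  have "\<exists>I\<subseteq>S. finite I \<and> card I = N \<and> (\<forall>z\<in>disk. (\<Sum>n\<in>I. p n z) \<le> 2 - (1/2) ^ N) \<and>
      (\<forall>e>0. \<exists>r<1. \<forall>z\<in>disk. r < cmod z \<longrightarrow> (\<Sum>n\<in>I. p n z) \<le> e)"
  proof (induction N)
    case 0
    show ?case by (intro exI[of _ "{}"]) (auto intro: exI[of _ 0])
  next
    case (Suc N)
    then obtain I where I: "I \<subseteq> S" "finite I" "card I = N"
      "\<And>z. z \<in> disk \<Longrightarrow> (\<Sum>n\<in>I. p n z) \<le> 2 - (1/2) ^ N"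
      "\<And>e. 0 < e \<Longrightarrow> \<exists>r<1. \<forall>z\<in>disk. r < cmod z \<longrightarrow> (\<Sum>n\<in>I. p n z) \<le> e"
      by blast
    let ?d = "(1/2 :: real) ^ Suc N"
    have d: "0 < ?d" by simp
    obtain r where r: "r < 1" "\<And>z. z \<in> disk \<Longrightarrow> r < cmod z \<Longrightarrow> (\<Sum>n\<in>I. p n z) \<le> ?d"
      using I(5)[OF d] by blast
    obtain n0 where n0: "\<And>n z. n \<ge> n0 \<Longrightarrow> cmod z \<le> r \<Longrightarrow> p n z \<le> ?d"
      using null[OF r(1) d] by blast
    have "infinite (S - (I \<union> {..<n0}))"
      using S I(2) by (simp add: Diff_infinite_finite)
    then obtain n where n: "n \<in> S" "n \<notin> I" "n \<ge> n0"
      by (metis DiffE UnI1 UnI2 finite.emptyI lessThan_iff not_le subsetI subset_empty ex_in_conv)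
    have sum: "(\<Sum>k\<in>insert n I. p k z) = p n z + (\<Sum>k\<in>I. p k z)" for z
      using n I by simp
    show ?case
    proof (intro exI[of _ "insert n I"] conjI ballI allI impI)
      show "insert n I \<subseteq> S" "finite (insert n I)" "card (insert n I) = Suc N"
        using n I by auto
    next
      fix z assume z: "z \<in> disk"
      \<comment> \<open>Outside radius r the sum is at most 1 + \<open>?d\<close>, which is at most
        2 - \<open>?d\<close> as \<open>?d\<close> \<le> 1/2. Inside, adding \<open>?d\<close> to 2
        - 2 \<open>?d\<close> gives 2 - \<open>?d\<close>.\<close>
      have half: "(1/2 :: real) ^ N = ?d + ?d" "?d \<le> 1/2"
        using power_le_one[of "1/2 :: real" N] by auto
      show "(\<Sum>k\<in>insert n I. p k z) \<le> 2 - ?d"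
      proof (cases "r < cmod z")
        case True
        then show ?thesis
          using r(2)[OF z True] le1[OF z, of n] half(2) unfolding sum by linarith
      next
        case False
        then have "p n z \<le> ?d" using n n0 by simp
        then show ?thesis
          using I(4)[OF z] half(1) unfolding sum by linarith
      qed
    next
      fix e :: real assume e: "0 < e"
      obtain r1 where r1: "r1 < 1" "\<And>z. z \<in> disk \<Longrightarrow> r1 < cmod z \<Longrightarrow> (\<Sum>n\<in>I. p n z) \<le> e / 2"
        using I(5)[of "e / 2"] e by auto
      obtain r2 where r2: "r2 < 1" "\<And>z. z \<in> disk \<Longrightarrow> r2 < cmod z \<Longrightarrow> p n z \<le> e / 2"
        using little[of "e / 2" n] e by auto
      show "\<exists>r<1. \<forall>z\<in>disk. r < cmod z \<longrightarrow> (\<Sum>k\<in>insert n I. p k z) \<le> e"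
      proof (intro exI[of _ "max r1 r2"] conjI ballI impI)
        show "max r1 r2 < 1" using r1 r2 by simp
        fix z assume "z \<in> disk" "max r1 r2 < cmod z"
        then show "(\<Sum>k\<in>insert n I. p k z) \<le> e"
          using r1(2)[of z] r2(2)[of z] unfolding sum by linarith
      qed
    qed
  qed
  then obtain I where I: "I \<subseteq> S" "finite I" "card I = N" "\<And>z. z \<in> disk \<Longrightarrow> (\<Sum>n\<in>I. p n z) \<le> 2 - (1/2) ^ N"
    by blast
  moreover have "(1/2 :: real) ^ N \<ge> 0" by simp
  ultimately show ?thesis
    by (intro exI[of _ I]) (smt (verit))
qed

section \<open>Linear combinations and real-valued norms\<close>

lemma bloch_linear_scale:
  "bloch_linear \<alpha> \<beta> T \<Longrightarrow> f \<in> bloch \<alpha> \<Longrightarrow> T (\<lambda>z. c * f z) = (\<lambda>z. c * T f z)"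
  by (simp add: bloch_linear_def)

lemma bloch_linear_sum:
  assumes T: "bloch_linear \<alpha> \<beta> T" and "finite I" "\<And>i. i \<in> I \<Longrightarrow> f i \<in> bloch \<alpha>"
  shows "T (\<lambda>z. \<Sum>i\<in>I. f i z) = (\<lambda>z. \<Sum>i\<in>I. T (f i) z)"
  using assms(2,3)
proof (induction I)
  case empty
  show ?case
    using bloch_linear_scale[OF T zero_in_bloch, of 0] by simp
next
  case (insert i I)
  have "T (\<lambda>z. f i z + (\<Sum>i\<in>I. f i z)) = (\<lambda>z. T (f i) z + T (\<lambda>z. \<Sum>i\<in>I. f i z) z)"
    using T insert bloch_sum[of I f \<alpha>] unfolding bloch_linear_def by simp
  then show ?case using insert by simp
qed

text \<open>A real-valued norm for arguments that subtract and compare multiples. It is faithful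
  only on \<open>bloch \<alpha>\<close>, because \<open>enn2real\<close> sends \<infinity> to
  \<open>0\<close>.\<close>

definition bloch_rnorm :: "real \<Rightarrow> (complex \<Rightarrow> complex) \<Rightarrow> real" where
  "bloch_rnorm \<alpha> f = enn2real (bloch_norm \<alpha> f)"

lemma ennreal_bloch_rnorm: "f \<in> bloch \<alpha> \<Longrightarrow> ennreal (bloch_rnorm \<alpha> f) = bloch_norm \<alpha> f"
  using bloch_norm_finite by (simp add: bloch_rnorm_def)

lemma bloch_rnorm_nonneg: "0 \<le> bloch_rnorm \<alpha> f"
  by (simp add: bloch_rnorm_def)

lemma bloch_rnorm_scale: "f \<in> bloch \<alpha> \<Longrightarrow> bloch_rnorm \<alpha> (\<lambda>z. c * f z) = cmod c * bloch_rnorm \<alpha> f"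
  by (simp add: bloch_rnorm_def bloch_norm_scale enn2real_mult)

lemma bloch_rnorm_add_le:
  assumes "f \<in> bloch \<alpha>" "g \<in> bloch \<alpha>"
  shows "bloch_rnorm \<alpha> (\<lambda>z. f z + g z) \<le> bloch_rnorm \<alpha> f + bloch_rnorm \<alpha> g"
  using bloch_norm_add_le[OF assms] assms bloch_add[OF assms]
  by (simp flip: ennreal_bloch_rnorm ennreal_plus add: bloch_rnorm_nonneg ennreal_le_iff)

lemma bloch_rnorm_sum_le:
  assumes "finite I" "\<And>i. i \<in> I \<Longrightarrow> f i \<in> bloch \<alpha>"
  shows "bloch_rnorm \<alpha> (\<lambda>z. \<Sum>i\<in>I. f i z) \<le> (\<Sum>i\<in>I. bloch_rnorm \<alpha> (f i))"
  using assms
proof (induction I)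
  case empty
  then show ?case by (simp add: bloch_rnorm_def bloch_norm_def bloch_seminorm_def)
next
  case (insert i I)
  then show ?case
    using bloch_rnorm_add_le[of "f i" \<alpha> "\<lambda>z. \<Sum>i\<in>I. f i z"] bloch_sum[of I f \<alpha>] by fastforce
qed

text \<open>If \<open>K f\<^sub>n\<close> does not tend to \<open>0\<close>, then infinitely many \<open>K f\<^sub>n\<close> lie close to one nonzero
  element, so that the norm of \<open>\<Sum> K f\<^sub>n\<close> grows linearly in the number of summands. On the other
  hand the \<open>f\<^sub>n\<close> can be selected with essentially disjoint humps, so that their sums stay
  bounded. This replaces weak convergence in the little Bloch space.\<close>

lemma bloch_compact_null_sequence:
  assumes K: "bloch_compact \<alpha> \<beta> K"
    and f: "\<And>n. f n \<in> bloch \<alpha>" and f0: "\<And>n. f n 0 = 0"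
    and le1: "\<And>n z. z \<in> disk \<Longrightarrow> weight \<alpha> z * cmod (deriv (f n) z) \<le> 1"
    and little: "\<And>n e. 0 < e \<Longrightarrow> \<exists>r<1. \<forall>z\<in>disk. r < cmod z \<longrightarrow> weight \<alpha> z * cmod (deriv (f n) z) \<le> e"
    and null: "\<And>r e. r < 1 \<Longrightarrow> 0 < e \<Longrightarrow>
      \<exists>n0. \<forall>n\<ge>n0. \<forall>z. cmod z \<le> r \<longrightarrow> weight \<alpha> z * cmod (deriv (f n) z) \<le> e"
    and e: "0 < e"
  shows "eventually (\<lambda>n. bloch_norm \<beta> (K (f n)) \<le> ennreal e) sequentially"
proof (rule ccontr)
  interpret B: Metric_space "bloch \<beta>" "bloch_dist \<beta>"
    by (rule Metric_space_bloch)
  let ?U = "{f \<in> bloch \<alpha>. bloch_norm \<alpha> f \<le> 1}"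
  have lin: "bloch_linear \<alpha> \<beta> K" using K by (simp add: bloch_compact_def)
  then have KU: "K ` ?U \<subseteq> bloch \<beta>" by (auto simp: bloch_linear_def)
  have Kf: "K (f n) \<in> bloch \<beta>" for n using lin f by (simp add: bloch_linear_def)
  have fU: "f n \<in> ?U" for n
    using bloch_norm_le[OF f0 le1, of n] f by simp
  have dist: "bloch_dist \<beta> x y = bloch_rnorm \<beta> (\<lambda>z. x z - y z)" for x y
    by (simp add: bloch_dist_def bloch_rnorm_def)
  have rnorm_le: "bloch_rnorm \<beta> x \<le> bloch_rnorm \<beta> y + bloch_dist \<beta> y x" if "x \<in> bloch \<beta>" "y \<in> bloch \<beta>" for x y
    using bloch_rnorm_add_le[OF that(2) bloch_diff[OF that]] B.commute[of x y] by (simp add: dist)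
  have tb: "B.mtotally_bounded (K ` ?U)"
    using K KU by (intro B.compact_closure_of_imp_mtotally_bounded) (simp_all add: bloch_compact_def)
  \<comment> \<open>A finite e/4-net of the image of the unit ball. It serves twice: for the norm
    bound \<open>b\<close> on the image and for the pigeonhole argument.\<close>
  then obtain F where F: "finite F" "F \<subseteq> K ` ?U" "K ` ?U \<subseteq> (\<Union>x\<in>F. B.mball x (e / 4))"
    using e unfolding B.mtotally_bounded_def by (meson zero_less_divide_iff zero_less_numeral)
  define b where "b = (\<Sum>y\<in>F. bloch_rnorm \<beta> y) + e / 4"
  have b: "bloch_rnorm \<beta> x \<le> b" if x: "x \<in> K ` ?U" for x
  proof -
    obtain y where y: "y \<in> F" "bloch_dist \<beta> y x < e / 4"
      using subsetD[OF F(3) x] by auto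
    have "x \<in> bloch \<beta>" "y \<in> bloch \<beta>"
      using x y(1) F(2) KU by blast+
    then have "bloch_rnorm \<beta> x \<le> bloch_rnorm \<beta> y + bloch_dist \<beta> y x"
      by (rule rnorm_le)
    also have "\<dots> \<le> b"
      unfolding b_def using y F(1) by (intro add_mono member_le_sum) (auto simp: bloch_rnorm_nonneg)
    finally show ?thesis .
  qed
  assume "\<not> ?thesis"
  then have "infinite {n. \<not> bloch_norm \<beta> (K (f n)) \<le> ennreal e}"
    by (simp add: not_eventually frequently_cofinite flip: cofinite_eq_sequentially)
  \<comment> \<open>Pigeonhole: infinitely many images of norm at least e lie within e/4 of the same
    net point.\<close>
  moreover have "{n. \<not> bloch_norm \<beta> (K (f n)) \<le> ennreal e}
      \<subseteq> (\<Union>y\<in>F. {n. e \<le> bloch_rnorm \<beta> (K (f n)) \<and> bloch_dist \<beta> y (K (f n)) < e / 4})"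
  proof
    fix n assume n: "n \<in> {n. \<not> bloch_norm \<beta> (K (f n)) \<le> ennreal e}"
    then have "e \<le> bloch_rnorm \<beta> (K (f n))"
      using ennreal_leI[of "bloch_rnorm \<beta> (K (f n))" e] by (fastforce simp: ennreal_bloch_rnorm[OF Kf])
    moreover have "K (f n) \<in> (\<Union>x\<in>F. B.mball x (e / 4))"
      using F(3) fU by blast
    ultimately show "n \<in> (\<Union>y\<in>F. {n. e \<le> bloch_rnorm \<beta> (K (f n)) \<and> bloch_dist \<beta> y (K (f n)) < e / 4})"
      by auto
  qed
  ultimately obtain y where y: "y \<in> F"
    and S: "infinite {n. e \<le> bloch_rnorm \<beta> (K (f n)) \<and> bloch_dist \<beta> y (K (f n)) < e / 4}"
    using F(1) by (meson finite_UN finite_subset)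
  define S where "S = {n. e \<le> bloch_rnorm \<beta> (K (f n)) \<and> bloch_dist \<beta> y (K (f n)) < e / 4}"
  have yB: "y \<in> bloch \<beta>" using y F(2) KU by blast
  \<comment> \<open>The final comparison reads N * 3e/4 \<le> 2 b + N * e/4, that is N e \<le> 4 b,
    which this choice excludes.\<close>
  obtain N :: nat where N: "4 * b < real N * e"
    using ex_less_of_nat_mult[OF e] by blast
  obtain I where I: "I \<subseteq> S" "finite I" "card I = N"
    "\<And>z. z \<in> disk \<Longrightarrow> (\<Sum>n\<in>I. weight \<alpha> z * cmod (deriv (f n) z)) \<le> 2"
  proof -
    have "\<exists>I\<subseteq>S. finite I \<and> card I = N \<and> (\<forall>z\<in>disk. (\<Sum>n\<in>I. weight \<alpha> z * cmod (deriv (f n) z)) \<le> 2)"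
      by (rule gliding_hump) (use le1 little null S in \<open>auto simp: S_def\<close>)
    then show ?thesis using that by blast
  qed
  \<comment> \<open>The factor 1/2 turns the bound 2 of \<open>gliding_hump\<close> into membership
    in the unit ball.\<close>
  define s where "s z = 1/2 * (\<Sum>n\<in>I. f n z)" for z
  have sum: "(\<lambda>z. \<Sum>n\<in>I. f n z) \<in> bloch \<alpha>"
    by (rule bloch_sum[OF I(2) f])
  have sB: "s \<in> bloch \<alpha>"
    unfolding s_def[abs_def] by (rule bloch_scale[OF sum])
  have "bloch_norm \<alpha> s \<le> ennreal 1"
  proof (rule bloch_norm_le)
    show "s 0 = 0" by (simp add: s_def f0)
    fix z assume z: "z \<in> disk"
    have fd: "f n field_differentiable at z" for n
      by (rule bloch_field_differentiable[OF f z])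
    then have "deriv s z = 1/2 * (\<Sum>n\<in>I. deriv (f n) z)"
      unfolding s_def[abs_def]
      by (intro DERIV_imp_deriv DERIV_cmult DERIV_sum) (auto simp: field_differentiable_derivI)
    then have "cmod (deriv s z) = 1/2 * cmod (\<Sum>n\<in>I. deriv (f n) z)"
      by (simp only: norm_mult) simp
    then have "cmod (deriv s z) \<le> 1/2 * (\<Sum>n\<in>I. cmod (deriv (f n) z))"
      using norm_sum[of "\<lambda>n. deriv (f n) z" I] by simp
    then have "weight \<alpha> z * cmod (deriv s z) \<le> weight \<alpha> z * (1/2 * (\<Sum>n\<in>I. cmod (deriv (f n) z)))"
      by (rule mult_left_mono) simp
    also have "\<dots> = 1/2 * (\<Sum>n\<in>I. weight \<alpha> z * cmod (deriv (f n) z))"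
      by (simp add: sum_distrib_left)
    also have "\<dots> \<le> 1" using I(4)[OF z] by simp
    finally show "weight \<alpha> z * cmod (deriv s z) \<le> 1" .
  qed
  then have "K s \<in> K ` ?U" using sB by auto
  then have bs: "bloch_rnorm \<beta> (K s) \<le> b" and KsB: "K s \<in> bloch \<beta>"
    using b KU by blast+
  have "K s = (\<lambda>z. 1/2 * K (\<lambda>z. \<Sum>n\<in>I. f n z) z)"
    unfolding s_def[abs_def] by (rule bloch_linear_scale[OF lin sum])
  also have "K (\<lambda>z. \<Sum>n\<in>I. f n z) = (\<lambda>z. \<Sum>n\<in>I. K (f n) z)"
    by (rule bloch_linear_sum[OF lin I(2) f])
  finally have Ks: "K s = (\<lambda>z. 1/2 * (\<Sum>n\<in>I. K (f n) z))" .
  have y_large: "3/4 * e \<le> bloch_rnorm \<beta> y"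
  proof -
    obtain n where "n \<in> S" using infinite_imp_nonempty[OF S] unfolding S_def by blast
    then show ?thesis
      using rnorm_le[OF Kf yB, of n] by (simp add: S_def)
  qed
  \<comment> \<open>N copies of y are compared with the N images K f_n: their sum is 2 K s, of norm
    at most 2 b regardless of N, and each difference costs less than e/4.\<close>
  have "(\<lambda>z. of_nat N * y z) = (\<lambda>z. 2 * K s z + (\<Sum>n\<in>I. y z - K (f n) z))"
    by (simp add: Ks sum_subtractf I(3))
  then have "real N * bloch_rnorm \<beta> y = bloch_rnorm \<beta> (\<lambda>z. 2 * K s z + (\<Sum>n\<in>I. y z - K (f n) z))"
    using bloch_rnorm_scale[OF yB, of "of_nat N"] by simp
  also have "bloch_rnorm \<beta> (\<lambda>z. 2 * K s z + (\<Sum>n\<in>I. y z - K (f n) z))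
      \<le> bloch_rnorm \<beta> (\<lambda>z. 2 * K s z) + bloch_rnorm \<beta> (\<lambda>z. \<Sum>n\<in>I. y z - K (f n) z)"
    by (intro bloch_rnorm_add_le bloch_scale bloch_sum[OF I(2)] bloch_diff[OF yB Kf] KsB)
  also have "\<dots> \<le> 2 * b + (\<Sum>n\<in>I. e / 4)"
  proof (rule add_mono)
    show "bloch_rnorm \<beta> (\<lambda>z. 2 * K s z) \<le> 2 * b"
      using bs by (simp add: bloch_rnorm_scale[OF KsB])
    have "bloch_rnorm \<beta> (\<lambda>z. \<Sum>n\<in>I. y z - K (f n) z) \<le> (\<Sum>n\<in>I. bloch_rnorm \<beta> (\<lambda>z. y z - K (f n) z))"
      by (rule bloch_rnorm_sum_le[OF I(2) bloch_diff[OF yB Kf]])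
    also have "\<dots> \<le> (\<Sum>n\<in>I. e / 4)"
      using I(1) by (intro sum_mono) (auto simp: S_def dist less_imp_le)
    finally show "bloch_rnorm \<beta> (\<lambda>z. \<Sum>n\<in>I. y z - K (f n) z) \<le> (\<Sum>n\<in>I. e / 4)" .
  qed
  finally have "real N * bloch_rnorm \<beta> y \<le> 2 * b + real N * (e / 4)"
    by (simp add: I(3))
  moreover have "real N * (3/4 * e) \<le> real N * bloch_rnorm \<beta> y"
    by (intro mult_left_mono y_large) simp
  ultimately show False using N by simp
qed

section \<open>Monomials as test functions and the lower estimate\<close>

text \<open>With t = 1 - |z| one has |z|^n \<le> exp (- n t), while (1 - |z|^2)(n + 1) grows at most
  linearly in n t. The exponential compensates this growth even after raising it to the power
  \<alpha>.\<close>

lemma power_weight_le: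
  fixes \<alpha> :: real
  assumes \<alpha>: "0 < \<alpha>" and z: "z \<in> disk"
  shows "weight \<alpha> z * (real (n + 1) powr \<alpha> * cmod z ^ n) \<le> (2 * (1 + \<alpha>)) powr \<alpha>"
proof -
  define t where "t = 1 - cmod z"
  have t: "0 < t" "t \<le> 1" using z by (auto simp: t_def)
  have "cmod z ^ n \<le> exp (- t) ^ n"
    using exp_ge_add_one_self[of "- t"] by (intro power_mono) (auto simp: t_def)
  then have pw: "cmod z ^ n \<le> exp (- (real n * t))"
    by (simp flip: exp_of_nat_mult)
  have "1 - (cmod z)\<^sup>2 = t * (1 + cmod z)"
    by (simp add: t_def power2_eq_square algebra_simps)
  also have "\<dots> \<le> t * 2"
    using t by (intro mult_left_mono) (auto simp: t_def)
  finally have "(1 - (cmod z)\<^sup>2) * real (n + 1) \<le> 2 * t * real (n + 1)"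
    by (intro mult_right_mono) auto
  also have "\<dots> \<le> 2 * (1 + real n * t)"
    using t by (simp add: algebra_simps)
  \<comment> \<open>The argument n t is divided by \<alpha> so that the later power \<alpha> of the
    exponential is exactly exp (n t), the inverse of the bound on |z|^n.\<close>
  also have "\<dots> \<le> 2 * ((1 + \<alpha>) * (1 + real n * t / \<alpha>))"
  proof -
    have "(1 + \<alpha>) * (1 + real n * t / \<alpha>) = 1 + real n * t + (\<alpha> + real n * t / \<alpha>)"
      using \<alpha> by (simp add: field_simps)
    moreover have "0 \<le> \<alpha> + real n * t / \<alpha>" using \<alpha> t by simp
    ultimately show ?thesis by simp
  qed
  also have "\<dots> \<le> 2 * ((1 + \<alpha>) * exp (real n * t / \<alpha>))"
    using \<alpha> by (intro mult_left_mono exp_ge_add_one_self) auto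
  finally have "((1 - (cmod z)\<^sup>2) * real (n + 1)) powr \<alpha> \<le> (2 * ((1 + \<alpha>) * exp (real n * t / \<alpha>))) powr \<alpha>"
    using \<alpha> weight_base_pos[OF z] by (intro powr_mono2) auto
  also have "2 * ((1 + \<alpha>) * exp (real n * t / \<alpha>)) = 2 * (1 + \<alpha>) * exp (real n * t / \<alpha>)"
    by simp
  also have "\<dots> powr \<alpha> = (2 * (1 + \<alpha>)) powr \<alpha> * exp (real n * t / \<alpha>) powr \<alpha>"
    using \<alpha> by (subst powr_mult) auto
  also have "exp (real n * t / \<alpha>) powr \<alpha> = exp (real n * t)"
    using \<alpha> by (simp add: exp_powr_real)
  finally have "weight \<alpha> z * real (n + 1) powr \<alpha> \<le> (2 * (1 + \<alpha>)) powr \<alpha> * exp (real n * t)"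
    using weight_base_pos[OF z] by (simp add: powr_mult)
  then have "weight \<alpha> z * real (n + 1) powr \<alpha> * cmod z ^ n
      \<le> (2 * (1 + \<alpha>)) powr \<alpha> * exp (real n * t) * exp (- (real n * t))"
    by (rule mult_mono[OF _ pw]) auto
  then show ?thesis
    by (simp add: exp_minus mult.assoc)
qed

lemma power_sequence_null:
  fixes r \<alpha> :: real
  assumes "0 \<le> r" "r < 1"
  shows "(\<lambda>n. real (n + 1) powr \<alpha> * r ^ n) \<longlonglongrightarrow> 0"
proof (cases "r = 0")
  case True
  show ?thesis
    by (rule tendsto_eventually) (auto simp: True eventually_sequentially intro!: exI[of _ 1])
next
  case False
  then have "0 < r" using assms by simp
  then show ?thesis using assms(2) by real_asymp
qed

lemma limsup_le_essential_norm:
  assumes \<alpha>: "0 < \<alpha>" and g: "g holomorphic_on disk" and h: "h holomorphic_on disk"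
    and \<phi>: "\<phi> \<in> disk_self_maps" and \<psi>: "\<psi> \<in> disk_self_maps"
    and Tg: "\<And>f. f \<in> bloch \<alpha> \<Longrightarrow> gen_comp g \<phi> f \<in> bloch \<beta>"
    and Th: "\<And>f. f \<in> bloch \<alpha> \<Longrightarrow> gen_comp h \<psi> f \<in> bloch \<beta>"
  shows "limsup (\<lambda>n. SUP z\<in>disk. ennreal (real (n + 1) powr \<alpha> * weight \<beta> z
            * cmod (\<phi> z ^ n * g z - \<psi> z ^ n * h z)))
    \<le> ennreal ((2 * (1 + \<alpha>)) powr \<alpha>)
        * essential_norm \<alpha> \<beta> (\<lambda>f z. gen_comp g \<phi> f z - gen_comp h \<psi> f z)"
proof -
  define M where "M = (2 * (1 + \<alpha>)) powr \<alpha>"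
  have M: "0 < M" using \<alpha> by (simp add: M_def)
  define T where "T = (\<lambda>f z. gen_comp g \<phi> f z - gen_comp h \<psi> f z)"
  define b where "b n = (SUP z\<in>disk. ennreal (real (n + 1) powr \<alpha> * weight \<beta> z
            * cmod (\<phi> z ^ n * g z - \<psi> z ^ n * h z)))" for n
  \<comment> \<open>Division by \<open>M\<close>, the constant of \<open>power_weight_le\<close>,
    puts the primitives in the unit ball; \<open>M\<close> then reappears as the constant of the
    estimate.\<close>
  define F where "F n z = of_real (real (n + 1) powr \<alpha> / M) * z ^ n" for n and z :: complex
  define f where "f n = primitive (F n)" for n
  have F: "F n holomorphic_on disk" for n
    unfolding F_def by (intro holomorphic_intros)
  have cF: "cmod (F n z) = real (n + 1) powr \<alpha> / M * cmod z ^ n" for n z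
    unfolding F_def norm_mult norm_power norm_of_real using M by simp
  have F1: "weight \<alpha> z * cmod (F n z) \<le> 1" if "z \<in> disk" for n z
    using power_weight_le[OF \<alpha> that, of n, folded M_def] M by (simp add: cF field_simps)
  have df: "deriv (f n) z = F n z" if "z \<in> disk" for n z
    using deriv_primitive[OF F that] by (simp add: f_def)
  have fB: "f n \<in> bloch \<alpha>" "bloch_norm \<alpha> (f n) \<le> 1" for n
    using primitive_in_bloch[OF F F1, of n] by (simp_all add: f_def)
  have TB: "T f \<in> bloch \<beta>" if "f \<in> bloch \<alpha>" for f
    unfolding T_def using bloch_diff[OF Tg[OF that] Th[OF that]] .
  have bT: "b n \<le> ennreal M * bloch_norm \<beta> (T (f n))" for n
    unfolding b_def
  proof (rule SUP_least)
    fix z assume z: "z \<in> disk"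
    have "deriv (T (f n)) z = F n (\<phi> z) * g z - F n (\<psi> z) * h z"
      unfolding T_def bloch_deriv_diff[OF Tg[OF fB(1)] Th[OF fB(1)] z]
        deriv_gen_comp[OF g \<phi> fB(1) z] deriv_gen_comp[OF h \<psi> fB(1) z]
      using df disk_self_mapsD(2)[OF \<phi> z] disk_self_mapsD(2)[OF \<psi> z] by simp
    also have "\<dots> = of_real (real (n + 1) powr \<alpha> / M) * (\<phi> z ^ n * g z - \<psi> z ^ n * h z)"
      by (simp add: F_def right_diff_distrib mult.assoc)
    finally have "cmod (deriv (T (f n)) z) = real (n + 1) powr \<alpha> / M * cmod (\<phi> z ^ n * g z - \<psi> z ^ n * h z)"
      using M by (simp add: norm_mult norm_divide)
    then have "ennreal (real (n + 1) powr \<alpha> * weight \<beta> z * cmod (\<phi> z ^ n * g z - \<psi> z ^ n * h z))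
        = ennreal M * ennreal (weight \<beta> z * cmod (deriv (T (f n)) z))"
      using M by (simp add: ennreal_mult[symmetric])
    also have "\<dots> \<le> ennreal M * bloch_norm \<beta> (T (f n))"
      by (intro mult_left_mono weight_deriv_le_norm z) simp
    finally show "ennreal (real (n + 1) powr \<alpha> * weight \<beta> z * cmod (\<phi> z ^ n * g z - \<psi> z ^ n * h z))
        \<le> ennreal M * bloch_norm \<beta> (T (f n))" .
  qed
  have key: "limsup b \<le> ennreal M * bloch_opnorm \<alpha> \<beta> (\<lambda>f z. T f z - K f z)" (is "_ \<le> ennreal M * ?op")
    if K: "bloch_compact \<alpha> \<beta> K" for K
  proof (rule ennreal_le_epsilon)
    fix e :: real assume e: "0 < e"
    have KB: "K f \<in> bloch \<beta>" if "f \<in> bloch \<alpha>" for f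
      using K that by (simp add: bloch_compact_def bloch_linear_def)
    have "eventually (\<lambda>n. bloch_norm \<beta> (K (f n)) \<le> ennreal (e / M)) sequentially"
    proof (rule bloch_compact_null_sequence[OF K fB(1)])
      show "f n 0 = 0" for n by (simp add: f_def)
      show "weight \<alpha> z * cmod (deriv (f n) z) \<le> 1" if "z \<in> disk" for n z
        using F1 df that by simp
      show "\<exists>r<1. \<forall>z\<in>disk. r < cmod z \<longrightarrow> weight \<alpha> z * cmod (deriv (f n) z) \<le> d" if d: "0 < d" for n d
      proof -
        define c where "c = real (n + 1) powr \<alpha> / M"
        have c: "0 < c" using M by (simp add: c_def)
        obtain r where r: "r < 1" "\<And>z. z \<in> disk \<Longrightarrow> r < cmod z \<Longrightarrow> weight \<alpha> z \<le> d / c"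
          using weight_small[OF \<alpha>, of "d / c"] c d by (metis divide_pos_pos)
        show ?thesis
        proof (intro exI[of _ r] conjI ballI impI r(1))
          fix z assume z: "z \<in> disk" "r < cmod z"
          have "weight \<alpha> z * cmod (F n z) \<le> d / c * (c * 1)"
            unfolding cF c_def[symmetric] using z c d
            by (intro mult_mono r(2)) (auto simp: power_le_one)
          then show "weight \<alpha> z * cmod (deriv (f n) z) \<le> d"
            using c df z by simp
        qed
      qed
      show "\<exists>n0. \<forall>n\<ge>n0. \<forall>z. cmod z \<le> r \<longrightarrow> weight \<alpha> z * cmod (deriv (f n) z) \<le> d"
        if r: "r < 1" and d: "0 < d" for r d
      proof -
        \<comment> \<open>A negative \<open>r\<close> admits no z; the maximum merely gives the
          geometric sequence a nonnegative base.\<close>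
        define q where "q = max r 0"
        have q: "0 \<le> q" "q < 1" using r by (auto simp: q_def)
        have "eventually (\<lambda>n. real (n + 1) powr \<alpha> * q ^ n < d * M) sequentially"
          using power_sequence_null[OF q] d M by (intro order_tendstoD(2)) auto
        then obtain n0 where n0: "\<And>n. n \<ge> n0 \<Longrightarrow> real (n + 1) powr \<alpha> * q ^ n < d * M"
          unfolding eventually_sequentially by blast
        show ?thesis
        proof (intro exI[of _ n0] allI impI)
          fix n z assume n: "n0 \<le> n" and z: "cmod z \<le> r"
          then have zd: "z \<in> disk" and zq: "cmod z \<le> q" using r by (auto simp: q_def)
          have "weight \<alpha> z * cmod (F n z) \<le> 1 * cmod (F n z)"
            using weight_le_1[OF zd, of \<alpha>] \<alpha> by (intro mult_right_mono) auto
          also have "\<dots> \<le> real (n + 1) powr \<alpha> / M * q ^ n"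
            unfolding cF using M zq by (simp add: divide_right_mono mult_left_mono power_mono)
          also have "\<dots> \<le> d"
            using n0[OF n] M by (simp add: field_simps)
          finally show "weight \<alpha> z * cmod (deriv (f n) z) \<le> d"
            using df zd by simp
        qed
      qed
    qed (use e M in simp)
    then have "eventually (\<lambda>n. b n \<le> ennreal M * ?op + ennreal e) sequentially"
    proof eventually_elim
      case (elim n)
      have "bloch_norm \<beta> (T (f n)) \<le> bloch_norm \<beta> (\<lambda>z. T (f n) z - K (f n) z) + bloch_norm \<beta> (K (f n))"
        using bloch_norm_triangle[OF TB[OF fB(1)] KB[OF fB(1)] zero_in_bloch, of n n] by simp
      also have "\<dots> \<le> ?op + ennreal (e / M)"
        unfolding bloch_opnorm_def using fB elim by (intro add_mono SUP_upper) auto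
      finally have "b n \<le> ennreal M * (?op + ennreal (e / M))"
        using bT[of n] by (meson mult_left_mono order_trans zero_le)
      also have "\<dots> = ennreal M * ?op + ennreal e"
        using M e by (simp add: distrib_left ennreal_mult[symmetric])
      finally show ?case .
    qed
    then show "limsup b \<le> ennreal M * ?op + ennreal e"
      by (rule Limsup_bounded)
  qed
  have cancel: "ennreal M * (ennreal (1 / M) * x) = x" "ennreal (1 / M) * (ennreal M * x) = x" for x
    using M by (simp_all add: mult.assoc[symmetric] ennreal_mult[symmetric])
  \<comment> \<open>The constant is moved to the left before the infimum over \<open>K\<close> is
    taken, so that every competitor bounds the same quantity.\<close>
  have "ennreal (1 / M) * limsup b \<le> essential_norm \<alpha> \<beta> T"
    unfolding essential_norm_def
  proof (rule INF_greatest)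
    fix K assume "K \<in> {K. bloch_compact \<alpha> \<beta> K}"
    then show "ennreal (1 / M) * limsup b \<le> bloch_opnorm \<alpha> \<beta> (\<lambda>f z. T f z - K f z)"
      using mult_left_mono[OF key, of K "ennreal (1 / M)"] by (simp add: cancel)
  qed
  then have "ennreal M * (ennreal (1 / M) * limsup b) \<le> ennreal M * essential_norm \<alpha> \<beta> T"
    by (rule mult_left_mono) simp
  then show ?thesis
    unfolding cancel unfolding b_def[abs_def] M_def T_def .
qed

section \<open>The upper estimate of the essential norm\<close>

lemma scaled_self_map:
  assumes \<phi>: "\<phi> \<in> disk_self_maps" and r: "0 \<le> r" "r < 1"
  shows "(\<lambda>z. of_real r * \<phi> z) \<in> disk_self_maps"
    and "\<And>z. z \<in> disk \<Longrightarrow> cmod (of_real r * \<phi> z) \<le> r"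
proof -
  show *: "cmod (of_real r * \<phi> z) \<le> r" if "z \<in> disk" for z
    using disk_self_mapsD(2)[OF \<phi> that] r by (simp add: norm_mult mult_left_le)
  have "(\<lambda>z. of_real r * \<phi> z) holomorphic_on disk"
    using disk_self_mapsD(1)[OF \<phi>] by (intro holomorphic_intros)
  then show "(\<lambda>z. of_real r * \<phi> z) \<in> disk_self_maps"
    using * r unfolding disk_self_maps_def by fastforce
qed

lemma scaled_gen_comp_bound:
  assumes \<alpha>: "0 < \<alpha>" and \<phi>: "\<phi> \<in> disk_self_maps" and r: "0 \<le> r" "r < 1"
    and F: "\<And>w. w \<in> disk \<Longrightarrow> weight \<alpha> w * cmod (F w) \<le> M" and z: "z \<in> disk"
  shows "cmod (F (of_real r * \<phi> z)) \<le> M / (1 - r\<^sup>2) powr \<alpha>"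
proof -
  let ?w = "of_real r * \<phi> z"
  have r2: "0 < 1 - r\<^sup>2" using r by (simp add: abs_square_less_1)
  have w: "?w \<in> disk" "cmod ?w \<le> r"
    using scaled_self_map[OF \<phi> r] disk_self_mapsD(2) z by blast+
  have "(1 - r\<^sup>2) powr \<alpha> \<le> weight \<alpha> ?w"
    using w r2 \<alpha> by (intro powr_mono2) (auto intro: power_mono)
  then have "(1 - r\<^sup>2) powr \<alpha> * cmod (F ?w) \<le> M"
    using F[OF w(1)] by (meson mult_right_mono norm_ge_zero order_trans)
  then show ?thesis
    using r2 by (simp add: field_simps)
qed

text \<open>The dilated map takes values in the closed disc of radius r, where f' is bounded. A
  weighted bound on g alone therefore suffices.\<close>

lemma scaled_gen_comp_in_bloch:
  assumes \<alpha>: "0 < \<alpha>" and g: "g holomorphic_on disk" and Q: "\<And>z. z \<in> disk \<Longrightarrow> weight \<beta> z * cmod (g z) \<le> Q"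
    and \<phi>: "\<phi> \<in> disk_self_maps" and r: "0 \<le> r" "r < 1" and f: "f \<in> bloch \<alpha>"
  shows "gen_comp g (\<lambda>z. of_real r * \<phi> z) f \<in> bloch \<beta>"
proof -
  obtain M where M: "bloch_norm \<alpha> f = ennreal M" "0 \<le> M"
    using bloch_norm_finite[OF f] by (cases "bloch_norm \<alpha> f" rule: ennreal_cases) auto
  have *: "weight \<beta> z * cmod (deriv f (of_real r * \<phi> z) * g z) \<le> M / (1 - r\<^sup>2) powr \<alpha> * Q" if z: "z \<in> disk" for z
  proof -
    have "cmod (deriv f (of_real r * \<phi> z)) \<le> M / (1 - r\<^sup>2) powr \<alpha>"
      by (rule scaled_gen_comp_bound[OF \<alpha> \<phi> r _ z]) (use weight_deriv_le M in auto)
    then have "cmod (deriv f (of_real r * \<phi> z)) * (weight \<beta> z * cmod (g z)) \<le> M / (1 - r\<^sup>2) powr \<alpha> * Q"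
      using M by (intro mult_mono Q z) auto
    then show ?thesis
      by (simp add: norm_mult mult_ac)
  qed
  show ?thesis
    unfolding gen_comp_eq_primitive
    by (rule primitive_in_bloch(1)[OF gen_comp_integrand_holomorphic[OF g scaled_self_map(1)[OF \<phi> r] f] *])
qed

text \<open>Montel's theorem is applied to the derivatives. Both dilated maps take values in
  \<open>cball 0 r\<close>, so uniform convergence of the derivatives there gives norm convergence
  of the images. The weighted bound passes to the limit, so the image of the unit ball is itself
  compact.\<close>

lemma scaled_gen_comp_diff_compact:
  fixes \<alpha> \<beta> r :: real
  assumes \<alpha>: "0 < \<alpha>" and g: "g holomorphic_on disk" and h: "h holomorphic_on disk"
    and \<phi>: "\<phi> \<in> disk_self_maps" and \<psi>: "\<psi> \<in> disk_self_maps" and r: "0 \<le> r" "r < 1"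
    and Qg: "\<And>z. z \<in> disk \<Longrightarrow> weight \<beta> z * cmod (g z) \<le> Q"
    and Qh: "\<And>z. z \<in> disk \<Longrightarrow> weight \<beta> z * cmod (h z) \<le> Q"
  shows "bloch_compact \<alpha> \<beta>
    (\<lambda>f z. gen_comp g (\<lambda>z. of_real r * \<phi> z) f z - gen_comp h (\<lambda>z. of_real r * \<psi> z) f z)"
proof -
  let ?p = "\<lambda>z. of_real r * \<phi> z" and ?q = "\<lambda>z. of_real r * \<psi> z"
  define K where "K = (\<lambda>f z. gen_comp g ?p f z - gen_comp h ?q f z)"
  note p = scaled_self_map(1)[OF \<phi> r] and q = scaled_self_map(1)[OF \<psi> r]
  have Q0: "0 \<le> Q"
    using Qg[of 0] by (rule order_trans[rotated]) auto
  have pB: "gen_comp g ?p f \<in> bloch \<beta>" if "f \<in> bloch \<alpha>" for f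
    by (rule scaled_gen_comp_in_bloch[OF \<alpha> g Qg \<phi> r that])
  have qB: "gen_comp h ?q f \<in> bloch \<beta>" if "f \<in> bloch \<alpha>" for f
    by (rule scaled_gen_comp_in_bloch[OF \<alpha> h Qh \<psi> r that])
  have KB: "K f \<in> bloch \<beta>" if "f \<in> bloch \<alpha>" for f
    unfolding K_def by (rule bloch_diff[OF pB[OF that] qB[OF that]])
  have dK: "deriv (K f) z = deriv f (?p z) * g z - deriv f (?q z) * h z" if "f \<in> bloch \<alpha>" "z \<in> disk" for f z
    unfolding K_def bloch_deriv_diff[OF pB[OF that(1)] qB[OF that(1)] that(2)]
      deriv_gen_comp[OF g p that] deriv_gen_comp[OF h q that] by simp
  have lin: "bloch_linear \<alpha> \<beta> K"
    unfolding bloch_linear_def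
  proof (intro conjI ballI allI KB)
    fix f1 f2 assume f: "f1 \<in> bloch \<alpha>" "f2 \<in> bloch \<alpha>"
    show "K (\<lambda>z. f1 z + f2 z) = (\<lambda>z. K f1 z + K f2 z)"
      unfolding K_def gen_comp_linear(1)[OF g p f] gen_comp_linear(1)[OF h q f] by (simp add: algebra_simps)
  next
    fix c f assume f: "f \<in> bloch \<alpha>"
    show "K (\<lambda>z. c * f z) = (\<lambda>z. c * K f z)"
      unfolding K_def gen_comp_linear(2)[OF g p f f] gen_comp_linear(2)[OF h q f f] by (simp add: algebra_simps)
  qed
  interpret B: Metric_space "bloch \<beta>" "bloch_dist \<beta>"
    by (rule Metric_space_bloch)
  let ?U = "{f \<in> bloch \<alpha>. bloch_norm \<alpha> f \<le> 1}"
  have "compactin B.mtopology (K ` ?U)"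
    unfolding B.compactin_sequentially
  proof (intro conjI allI impI)
    show "K ` ?U \<subseteq> bloch \<beta>" using KB by auto
    fix \<sigma> :: "nat \<Rightarrow> complex \<Rightarrow> complex" assume "range \<sigma> \<subseteq> K ` ?U"
    then have "\<forall>n. \<exists>f. f \<in> ?U \<and> \<sigma> n = K f" by blast
    then obtain f where f: "\<And>n. f n \<in> ?U" and \<sigma>: "\<And>n. \<sigma> n = K (f n)" by metis
    define \<H> where "\<H> = {F. F holomorphic_on disk \<and> (\<forall>z\<in>disk. weight \<alpha> z * cmod (F z) \<le> 1)}"
    have f1: "weight \<alpha> z * cmod (deriv (f n) z) \<le> 1" if "z \<in> disk" for n z
      using weight_deriv_le[of \<alpha> "f n" 1 z] f that by simp
    obtain F s where F: "F holomorphic_on disk" and s: "strict_mono (s :: nat \<Rightarrow> nat)"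
      and lim: "\<And>z. z \<in> disk \<Longrightarrow> (\<lambda>n. deriv (f (s n)) z) \<longlonglongrightarrow> F z"
      and unif: "\<And>X. compact X \<Longrightarrow> X \<subseteq> disk \<Longrightarrow> uniform_limit X ((\<lambda>n. deriv (f n)) \<circ> s) F sequentially"
    proof (rule Montel[of disk \<H> "\<lambda>n. deriv (f n)"])
      show "\<exists>B. \<forall>G\<in>\<H>. \<forall>z\<in>X. cmod (G z) \<le> B" if X: "compact X" "X \<subseteq> disk" for X
      proof -
        have "continuous_on X (\<lambda>z. 1 / weight \<alpha> z)"
          using X(2) weight_base_pos by (intro continuous_intros) fastforce+
        then have "bounded ((\<lambda>z. 1 / weight \<alpha> z) ` X)"
          by (intro compact_imp_bounded compact_continuous_image X(1))
        then obtain B where B': "\<forall>y\<in>(\<lambda>z. 1 / weight \<alpha> z) ` X. norm y \<le> B"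
          unfolding bounded_iff by blast
        have B: "1 / weight \<alpha> z \<le> B" if "z \<in> X" for z
          using bspec[OF B' imageI[OF that]] unfolding real_norm_def by (rule abs_le_D1)
        have "cmod (G z) \<le> B" if "G \<in> \<H>" "z \<in> X" for G z
        proof -
          have z: "z \<in> disk" using X that by auto
          then have "cmod (G z) \<le> 1 / weight \<alpha> z"
            using weight_pos[OF z, of \<alpha>] that by (simp add: \<H>_def field_simps)
          then show ?thesis using B[OF that(2)] by linarith
        qed
        then show ?thesis by blast
      qed
      show "range (\<lambda>n. deriv (f n)) \<subseteq> \<H>"
      proof -
        have "deriv (f n) \<in> \<H>" for n
          using f1 bloch_deriv_holomorphic[of "f n" \<alpha>] f[of n] by (simp add: \<H>_def)
        then show ?thesis by blast
      qed
    qed (auto simp: \<H>_def)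
    have F1: "weight \<alpha> z * cmod (F z) \<le> 1" if "z \<in> disk" for z
      by (rule LIMSEQ_le_const2[OF tendsto_mult[OF tendsto_const tendsto_norm[OF lim[OF that]]]])
        (use f1[OF that] in auto)
    \<comment> \<open>The values f n 0 may fail to converge; this does no harm, as \<open>K\<close>
      sees only derivatives and the primitive vanishing at 0 stays in the unit ball.\<close>
    define f0 where "f0 = primitive F"
    have f0: "f0 \<in> ?U"
      using primitive_in_bloch[OF F F1] by (simp add: f0_def)
    have df0: "deriv f0 z = F z" if "z \<in> disk" for z
      using deriv_primitive[OF F that] by (simp add: f0_def)
    have "limitin B.mtopology (\<sigma> \<circ> s) (K f0) sequentially"
      unfolding B.limitin_metric
    proof (intro conjI allI impI)
      show "K f0 \<in> bloch \<beta>" using f0 KB by auto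
      fix e :: real assume e: "0 < e"
      \<comment> \<open>Each symbol contributes at most d Q. The \<open>+ 1\<close> keeps the
        denominator positive for Q = 0, and the outer \<open>2\<close> makes the final inequality
        strict.\<close>
      define d where "d = e / (2 * (2 * Q + 1))"
      have d: "0 < d" using e Q0 by (simp add: d_def)
      have "uniform_limit (cball 0 r) ((\<lambda>n. deriv (f n)) \<circ> s) F sequentially"
        using r by (intro unif) auto
      then have "eventually (\<lambda>n. \<forall>w\<in>cball 0 r. dist (deriv (f (s n)) w) (F w) < d) sequentially"
        using d unfolding uniform_limit_iff by auto
      then show "eventually (\<lambda>n. (\<sigma> \<circ> s) n \<in> bloch \<beta> \<and> bloch_dist \<beta> ((\<sigma> \<circ> s) n) (K f0) < e) sequentially"
      proof eventually_elim
        case (elim n)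
        let ?f = "f (s n)"
        have fB: "?f \<in> bloch \<alpha>" and f0B: "f0 \<in> bloch \<alpha>" using f f0 by auto
        have near: "cmod (deriv ?f (of_real r * \<phi>' z) - deriv f0 (of_real r * \<phi>' z)) \<le> d"
          if "\<phi>' \<in> disk_self_maps" "z \<in> disk" for \<phi>' z
        proof -
          have w: "of_real r * \<phi>' z \<in> cball 0 r" "of_real r * \<phi>' z \<in> disk"
            using scaled_self_map(2)[OF that(1) r that(2)] r by auto
          then show ?thesis using elim df0 by (auto simp: dist_norm less_imp_le)
        qed
        have "bloch_norm \<beta> (\<lambda>z. K ?f z - K f0 z) \<le> ennreal (e / 2)"
        proof (rule bloch_norm_le)
          show "K ?f 0 - K f0 0 = 0" by (simp add: K_def)
          fix z assume z: "z \<in> disk"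
          have "deriv (\<lambda>z. K ?f z - K f0 z) z
              = (deriv ?f (?p z) - deriv f0 (?p z)) * g z - (deriv ?f (?q z) - deriv f0 (?q z)) * h z"
            unfolding bloch_deriv_diff[OF KB[OF fB] KB[OF f0B] z] dK[OF fB z] dK[OF f0B z]
            by (simp add: algebra_simps)
          then have "cmod (deriv (\<lambda>z. K ?f z - K f0 z) z) \<le> d * cmod (g z) + d * cmod (h z)"
            using mult_right_mono[OF near[OF \<phi> z], of "cmod (g z)"] mult_right_mono[OF near[OF \<psi> z], of "cmod (h z)"]
              norm_triangle_ineq4[of "(deriv ?f (?p z) - deriv f0 (?p z)) * g z" "(deriv ?f (?q z) - deriv f0 (?q z)) * h z"]
            by (simp add: norm_mult)
          then have "weight \<beta> z * cmod (deriv (\<lambda>z. K ?f z - K f0 z) z) \<le> weight \<beta> z * (d * cmod (g z) + d * cmod (h z))"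
            by (rule mult_left_mono) simp
          also have "\<dots> = d * (weight \<beta> z * cmod (g z)) + d * (weight \<beta> z * cmod (h z))"
            by (simp add: algebra_simps)
          also have "\<dots> \<le> d * Q + d * Q"
            using d by (intro add_mono mult_left_mono Qg Qh z) auto
          also have "\<dots> \<le> d * (2 * Q + 1)"
            using d by (simp add: algebra_simps)
          also have "\<dots> = e / 2"
            using Q0 by (simp add: d_def field_simps)
          finally show "weight \<beta> z * cmod (deriv (\<lambda>z. K ?f z - K f0 z) z) \<le> e / 2" .
        qed
        then have "bloch_dist \<beta> (K ?f) (K f0) \<le> enn2real (ennreal (e / 2))"
          unfolding bloch_dist_def by (intro enn2real_mono) auto
        then show ?case
          using e KB[OF fB] by (simp add: \<sigma>)
      qed
    qed
    then show "\<exists>l r. l \<in> K ` ?U \<and> strict_mono r \<and> limitin B.mtopology (\<sigma> \<circ> r) l sequentially"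
      using f0 s by blast
  qed
  \<comment> \<open>A compact set in a metric topology is closed, so the closure in the definition
    of compactness adds nothing.\<close>
  then have "B.mtopology closure_of (K ` ?U) = K ` ?U" and "compactin B.mtopology (K ` ?U)"
    using compactin_imp_closedin[OF B.Hausdorff_space_mtopology] by (auto simp: closure_of_eq)
  then show ?thesis
    using lin unfolding bloch_compact_def K_def by simp
qed

section \<open>A priori bounds on the symbols and the error of dilation\<close>

text \<open>Two test functions: the constant 1 for the first bound, and for the second the kernel
  centred at \<phi>(z) and evaluated on the diagonal.\<close>

lemma bloch_bounded_weights:
  assumes \<alpha>: "0 < \<alpha>" and g: "g holomorphic_on disk" and \<phi>: "\<phi> \<in> disk_self_maps"
    and T: "bloch_bounded \<alpha> \<beta> (gen_comp g \<phi>)"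
  shows "\<exists>Q\<ge>0. \<forall>z\<in>disk. weight \<beta> z * cmod (g z) \<le> Q \<and> cmod (weight_quot \<alpha> \<beta> \<phi> g z) \<le> Q"
proof -
  obtain Q where Q: "0 \<le> Q" "\<And>F z. F holomorphic_on disk \<Longrightarrow> (\<And>\<zeta>. \<zeta> \<in> disk \<Longrightarrow> weight \<alpha> \<zeta> * cmod (F \<zeta>) \<le> 1) \<Longrightarrow> z \<in> disk \<Longrightarrow>
      weight \<beta> z * cmod (F (\<phi> z) * g z) \<le> Q"
    using bloch_bounded_bound[OF g \<phi> T] by blast
  show ?thesis
  proof (intro exI[of _ Q] conjI ballI Q(1))
    fix z assume z: "z \<in> disk"
    show "weight \<beta> z * cmod (g z) \<le> Q"
      using Q(2)[of "\<lambda>_. 1" z] weight_le_1[of _ \<alpha>] \<alpha> z by simp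
    note w = disk_self_mapsD(2)[OF \<phi> z]
    have "weight \<beta> z * cmod (kernel \<alpha> \<alpha> (\<phi> z) (\<phi> z) * g z) \<le> Q"
      by (rule Q(2)[OF kernel_holomorphic[OF w] weight_kernel_le[OF w _ \<alpha>] z])
    then show "cmod (weight_quot \<alpha> \<beta> \<phi> g z) \<le> Q"
      unfolding kernel_self[OF w] by (simp add: weight_quot_def norm_mult norm_divide)
  qed
qed

lemma ennreal_le_plusI:
  assumes "x \<le> a + b" "0 \<le> a" "0 \<le> b"
  shows "ennreal x \<le> ennreal a + ennreal b"
  using ennreal_leI[OF assms(1)] assms(2,3) by simp

text \<open>The radius \<delta> is fixed first; the dilation r is then taken so close to 1 that
  points with \<phi>(z) or \<psi>(z) inside radius \<delta> contribute only an error e. The a priori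
  bounds \<open>Q1\<close> and \<open>Q2\<close> influence r but not the constant, so \<delta> may
  afterwards tend to 1.\<close>

lemma essential_norm_le_suprema:
  fixes \<alpha> \<beta> :: real
  assumes \<alpha>: "0 < \<alpha>"
  obtains C where "0 < C" and
    "\<And>g h \<phi> \<psi> \<delta>. g holomorphic_on disk \<Longrightarrow> h holomorphic_on disk \<Longrightarrow>
      \<phi> \<in> disk_self_maps \<Longrightarrow> \<psi> \<in> disk_self_maps \<Longrightarrow>
      bloch_bounded \<alpha> \<beta> (gen_comp g \<phi>) \<Longrightarrow> bloch_bounded \<alpha> \<beta> (gen_comp h \<psi>) \<Longrightarrow> \<delta> < 1 \<Longrightarrow>
      essential_norm \<alpha> \<beta> (\<lambda>f z. gen_comp g \<phi> f z - gen_comp h \<psi> f z) \<le> ennreal C *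
       ((SUP z\<in>{z \<in> disk. cmod (\<phi> z) > \<delta>}. ennreal (cmod (weight_quot \<alpha> \<beta> \<phi> g z) * pseudo_dist \<phi> \<psi> z))
      + (SUP z\<in>{z \<in> disk. cmod (\<psi> z) > \<delta>}. ennreal (cmod (weight_quot \<alpha> \<beta> \<psi> h z) * pseudo_dist \<phi> \<psi> z))
      + (SUP z\<in>{z \<in> disk. cmod (\<phi> z) > \<delta> \<and> cmod (\<psi> z) > \<delta>}.
           ennreal (cmod (weight_quot \<alpha> \<beta> \<phi> g z - weight_quot \<alpha> \<beta> \<psi> h z))))"
proof -
  obtain C3 where C3: "0 < C3" "\<And>F M a b. F holomorphic_on disk \<Longrightarrow> (\<And>z. z \<in> disk \<Longrightarrow> weight \<alpha> z * cmod (F z) \<le> M) \<Longrightarrow>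
        a \<in> disk \<Longrightarrow> b \<in> disk \<Longrightarrow>
        cmod (of_real (weight \<alpha> a) * F a - of_real (weight \<alpha> b) * F b) \<le> C3 * M * rho a b"
    using weighted_lipschitz[OF \<alpha>] by blast
  show ?thesis
  \<comment> \<open>The weighted error \<open>W\<close> is bounded by 2 and hence Lipschitz with
    constant 2 C3; the sum covers both uses.\<close>
  proof (rule that[of "2 * C3 + 2"])
    show "0 < 2 * C3 + 2" using C3 by simp
    fix \<delta> :: real and g h \<phi> \<psi>
    assume g: "g holomorphic_on disk" and h: "h holomorphic_on disk"
      and \<phi>: "\<phi> \<in> disk_self_maps" and \<psi>: "\<psi> \<in> disk_self_maps"
      and Tg: "bloch_bounded \<alpha> \<beta> (gen_comp g \<phi>)" and Th: "bloch_bounded \<alpha> \<beta> (gen_comp h \<psi>)" and \<delta>: "\<delta> < 1"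
    define u where "u = weight_quot \<alpha> \<beta> \<phi> g"
    define v where "v = weight_quot \<alpha> \<beta> \<psi> h"
    define A1 where "A1 = (SUP z\<in>{z \<in> disk. cmod (\<phi> z) > \<delta>}. ennreal (cmod (u z) * pseudo_dist \<phi> \<psi> z))"
    define A2 where "A2 = (SUP z\<in>{z \<in> disk. cmod (\<psi> z) > \<delta>}. ennreal (cmod (v z) * pseudo_dist \<phi> \<psi> z))"
    define A3 where "A3 = (SUP z\<in>{z \<in> disk. cmod (\<phi> z) > \<delta> \<and> cmod (\<psi> z) > \<delta>}. ennreal (cmod (u z - v z)))"
    define T where "T = (\<lambda>f z. gen_comp g \<phi> f z - gen_comp h \<psi> f z)"
    obtain Q1 where Q1: "0 \<le> Q1" "\<And>z. z \<in> disk \<Longrightarrow> weight \<beta> z * cmod (g z) \<le> Q1" "\<And>z. z \<in> disk \<Longrightarrow> cmod (u z) \<le> Q1"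
      using bloch_bounded_weights[OF \<alpha> g \<phi> Tg] unfolding u_def by blast
    obtain Q2 where Q2: "0 \<le> Q2" "\<And>z. z \<in> disk \<Longrightarrow> weight \<beta> z * cmod (h z) \<le> Q2" "\<And>z. z \<in> disk \<Longrightarrow> cmod (v z) \<le> Q2"
      using bloch_bounded_weights[OF \<alpha> h \<psi> Th] unfolding v_def by blast
    have TBg: "gen_comp g \<phi> f \<in> bloch \<beta>" and TBh: "gen_comp h \<psi> f \<in> bloch \<beta>" if "f \<in> bloch \<alpha>" for f
      using Tg Th that by (auto simp: bloch_bounded_def bloch_linear_def)
    have "essential_norm \<alpha> \<beta> T \<le> ennreal (2 * C3 + 2) * (A1 + A2 + A3)"
    proof (rule ennreal_le_epsilon)
      fix e :: real assume e: "0 < e"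
      \<comment> \<open>Chosen so that (Q1 + Q2) \<eta> \<le> e; the \<open>+ 1\<close> keeps the
        denominator positive.\<close>
      define \<eta> where "\<eta> = e / (Q1 + Q2 + 1)"
      have \<eta>: "0 < \<eta>" using e Q1 Q2 by (simp add: \<eta>_def)
      define D where "D = 4 * 2 powr \<alpha> * (1 - \<delta>) powr (- \<alpha> - 1)"
      have D: "0 < D" using \<delta> by (simp add: D_def)
      \<comment> \<open>The three bounds on 1 - r give r \<ge> 0, the closeness condition of
        \<open>growth_lipschitz\<close> for |z| \<le> \<delta>, and D m \<le> \<eta>.\<close>
      define m where "m = min 1 (min ((1 - \<delta>) / 4) (\<eta> / D))"
      define r where "r = 1 - m"
      have "0 < m" using \<delta> \<eta> D by (simp add: m_def)
      moreover have "m \<le> 1" "m \<le> (1 - \<delta>) / 4" "m \<le> \<eta> / D"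
        unfolding m_def by (meson min.cobounded1 min.cobounded2 order_trans)+
      ultimately have m: "0 < m" "m \<le> 1" "m \<le> (1 - \<delta>) / 4" "m \<le> \<eta> / D"
        by blast+
      have r: "0 \<le> r" "r < 1" using m by (simp_all add: r_def)
      let ?p = "\<lambda>z. of_real r * \<phi> z" and ?q = "\<lambda>z. of_real r * \<psi> z"
      note p = scaled_self_map(1)[OF \<phi> r] and q = scaled_self_map(1)[OF \<psi> r]
      define K where "K = (\<lambda>f z. gen_comp g ?p f z - gen_comp h ?q f z)"
      have comp: "bloch_compact \<alpha> \<beta> K"
        unfolding K_def
      proof (rule scaled_gen_comp_diff_compact[OF \<alpha> g h \<phi> \<psi> r, where Q = "max Q1 Q2"])
        fix z assume "z \<in> disk"
        then show "weight \<beta> z * cmod (g z) \<le> max Q1 Q2" "weight \<beta> z * cmod (h z) \<le> max Q1 Q2"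
          using Q1(2)[of z] Q2(2)[of z] by linarith+
      qed
      have "bloch_opnorm \<alpha> \<beta> (\<lambda>f z. T f z - K f z) \<le> ennreal (2 * C3 + 2) * (A1 + A2 + A3) + ennreal e"
        unfolding bloch_opnorm_def
      proof (rule SUP_least)
        fix f assume "f \<in> {f \<in> bloch \<alpha>. bloch_norm \<alpha> f \<le> 1}"
        then have f: "f \<in> bloch \<alpha>" and f1: "bloch_norm \<alpha> f \<le> ennreal 1" by auto
        define F where "F = deriv f"
        have F: "F holomorphic_on disk" "\<And>z. z \<in> disk \<Longrightarrow> weight \<alpha> z * cmod (F z) \<le> 1"
          using bloch_deriv_holomorphic[OF f] weight_deriv_le[OF f1] by (auto simp: F_def)
        define G where "G z = F z - F (of_real r * z)" for z
        have rz: "of_real r * z \<in> disk" if "z \<in> disk" for z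
        proof -
          have "r * cmod z \<le> cmod z" using r by (simp add: mult_left_le_one_le)
          then show ?thesis using that r by (simp add: norm_mult)
        qed
        have sm: "(\<lambda>z. of_real r * z) \<in> disk_self_maps"
          using rz by (auto simp: disk_self_maps_def intro!: holomorphic_intros)
        have G: "G holomorphic_on disk"
          unfolding G_def[abs_def]
          by (rule holomorphic_on_diff[OF F(1) holomorphic_on_compose_self_map[OF sm F(1)]])
        have G2: "weight \<alpha> z * cmod (G z) \<le> 2" if z: "z \<in> disk" for z
        proof -
          have "cmod (of_real r * z) \<le> cmod z"
            using r by (simp add: norm_mult mult_left_le_one_le)
          then have "weight \<alpha> z \<le> weight \<alpha> (of_real r * z)"
            using weight_base_pos[OF z] \<alpha> by (intro powr_mono2) (auto intro!: power_mono)
          then have "weight \<alpha> z * cmod (F (of_real r * z)) \<le> 1"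
            using F(2)[OF rz[OF z]] by (meson mult_right_mono norm_ge_zero order_trans)
          moreover have "weight \<alpha> z * cmod (G z) \<le> weight \<alpha> z * (cmod (F z) + cmod (F (of_real r * z)))"
            unfolding G_def by (intro mult_left_mono norm_triangle_ineq4) auto
          ultimately show ?thesis
            using F(2)[OF z] by (simp add: distrib_left)
        qed
        define W where "W z = of_real (weight \<alpha> z) * G z" for z
        have W2: "cmod (W z) \<le> 2" if "z \<in> disk" for z
          using G2[OF that] by (simp add: W_def norm_mult)
        have W\<eta>: "cmod (W z) \<le> \<eta>" if z: "z \<in> disk" "cmod z \<le> \<delta>" for z
        proof -
          have "z - of_real r * z = of_real m * z"
            by (simp add: r_def algebra_simps)
          then have zm: "cmod (z - of_real r * z) = m * cmod z"
            using m by (simp add: norm_mult)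
          also have mz: "\<dots> \<le> m" using m z by (simp add: mult_left_le)
          also have "m \<le> (1 - \<delta>) / 4" by (rule m)
          also have "\<dots> \<le> (1 - cmod z) / 4" using z by simp
          finally have close: "cmod (z - of_real r * z) \<le> (1 - cmod z) / 4" .
          have "cmod (G z) \<le> 4 * 2 powr \<alpha> * 1 * (1 - cmod z) powr (- \<alpha> - 1) * cmod (z - of_real r * z)"
            unfolding G_def by (rule growth_lipschitz[OF F \<alpha> z(1) close])
          also have "\<dots> \<le> 4 * 2 powr \<alpha> * 1 * (1 - \<delta>) powr (- \<alpha> - 1) * m"
            unfolding zm by (rule mult_mono[OF mult_left_mono[OF powr_mono2'] mz]) (use z \<delta> \<alpha> m in auto)
          also have "\<dots> = D * m" by (simp add: D_def)
          also have "\<dots> \<le> D * (\<eta> / D)" using D m by (intro mult_left_mono) auto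
          also have "\<dots> = \<eta>" using D by simp
          finally have "cmod (G z) \<le> \<eta>" .
          moreover have "cmod (W z) \<le> 1 * cmod (G z)"
            unfolding W_def norm_mult norm_of_real using weight_le_1[OF z(1), of \<alpha>] \<alpha> by (intro mult_right_mono) auto
          ultimately show ?thesis by simp
        qed
        have main: "ennreal (weight \<beta> z * cmod (deriv (\<lambda>z. T f z - K f z) z)) \<le> ennreal (2 * C3 + 2) * (A1 + A2 + A3) + ennreal e"
          if z: "z \<in> disk" for z
        proof -
          note a = disk_self_mapsD(2)[OF \<phi> z] and b = disk_self_mapsD(2)[OF \<psi> z]
          let ?\<rho> = "pseudo_dist \<phi> \<psi> z"
          have KB: "K f \<in> bloch \<beta>" "T f \<in> bloch \<beta>"
            using comp f bloch_diff[OF TBg[OF f] TBh[OF f]] by (auto simp: T_def bloch_compact_def bloch_linear_def)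
          have pq: "gen_comp g ?p f \<in> bloch \<beta>" "gen_comp h ?q f \<in> bloch \<beta>"
            by (rule scaled_gen_comp_in_bloch[OF \<alpha> g Q1(2) \<phi> r f], assumption)
              (rule scaled_gen_comp_in_bloch[OF \<alpha> h Q2(2) \<psi> r f])
          have "deriv (\<lambda>z. T f z - K f z) z = G (\<phi> z) * g z - G (\<psi> z) * h z"
            unfolding bloch_deriv_diff[OF KB(2,1) z] unfolding T_def K_def
              bloch_deriv_diff[OF TBg[OF f] TBh[OF f] z] bloch_deriv_diff[OF pq z]
              deriv_gen_comp[OF g \<phi> f z] deriv_gen_comp[OF h \<psi> f z]
              deriv_gen_comp[OF g p f z] deriv_gen_comp[OF h q f z]
            by (simp add: G_def F_def algebra_simps)
          then have "of_real (weight \<beta> z) * deriv (\<lambda>z. T f z - K f z) z = u z * W (\<phi> z) - v z * W (\<psi> z)"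
            using weight_pos[OF a, of \<alpha>] weight_pos[OF b, of \<alpha>]
            by (simp add: u_def v_def W_def weight_quot_def right_diff_distrib)
          then have eq: "weight \<beta> z * cmod (deriv (\<lambda>z. T f z - K f z) z) = cmod (u z * W (\<phi> z) - v z * W (\<psi> z))"
            by (metis norm_mult norm_of_real abs_of_nonneg powr_ge_zero)
          have lip: "cmod (W (\<phi> z) - W (\<psi> z)) \<le> 2 * C3 * ?\<rho>"
            using C3(2)[OF G G2 a b] by (simp add: W_def pseudo_dist_eq_rho mult_ac)
          have \<rho>: "0 \<le> ?\<rho>" by (simp add: pseudo_dist_eq_rho rho_nonneg)
          \<comment> \<open>Two splittings of the same difference. If only one of the maps is beyond
            radius \<delta>, the Lipschitz term is attached to the weight of that map, and the
            remaining \<open>W\<close> is evaluated at the other map, where it is at most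
            \<eta>.\<close>
          have t1: "cmod (u z * W (\<phi> z) - v z * W (\<psi> z)) \<le> 2 * C3 * (cmod (u z) * ?\<rho>) + cmod (u z - v z) * cmod (W (\<psi> z))"
          proof -
            have "u z * W (\<phi> z) - v z * W (\<psi> z) = u z * (W (\<phi> z) - W (\<psi> z)) + (u z - v z) * W (\<psi> z)"
              by (simp add: algebra_simps)
            then have "cmod (u z * W (\<phi> z) - v z * W (\<psi> z)) \<le> cmod (u z) * cmod (W (\<phi> z) - W (\<psi> z)) + cmod (u z - v z) * cmod (W (\<psi> z))"
              by (metis norm_mult norm_triangle_ineq)
            also have "cmod (u z) * cmod (W (\<phi> z) - W (\<psi> z)) \<le> cmod (u z) * (2 * C3 * ?\<rho>)"
              by (intro mult_left_mono lip) auto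
            finally show ?thesis by (simp add: mult_ac)
          qed
          have t2: "cmod (u z * W (\<phi> z) - v z * W (\<psi> z)) \<le> 2 * C3 * (cmod (v z) * ?\<rho>) + cmod (u z - v z) * cmod (W (\<phi> z))"
          proof -
            have "u z * W (\<phi> z) - v z * W (\<psi> z) = v z * (W (\<phi> z) - W (\<psi> z)) + (u z - v z) * W (\<phi> z)"
              by (simp add: algebra_simps)
            then have "cmod (u z * W (\<phi> z) - v z * W (\<psi> z)) \<le> cmod (v z) * cmod (W (\<phi> z) - W (\<psi> z)) + cmod (u z - v z) * cmod (W (\<phi> z))"
              by (metis norm_mult norm_triangle_ineq)
            also have "cmod (v z) * cmod (W (\<phi> z) - W (\<psi> z)) \<le> cmod (v z) * (2 * C3 * ?\<rho>)"
              by (intro mult_left_mono lip) auto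
            finally show ?thesis by (simp add: mult_ac)
          qed
          have uv: "cmod (u z - v z) \<le> Q1 + Q2"
            using norm_triangle_ineq4[of "u z" "v z"] Q1(3)[OF z] Q2(3)[OF z] by linarith
          have \<eta>e: "(Q1 + Q2) * \<eta> \<le> e"
            using e Q1(1) Q2(1) by (simp add: \<eta>_def divide_simps)
          have small: "cmod (u z - v z) * cmod (W w) \<le> e" if "w \<in> disk" "cmod w \<le> \<delta>" for w
            by (rule order_trans[OF mult_mono[OF uv W\<eta>[OF that]] \<eta>e]) (use Q1 Q2 in auto)
          have A1: "ennreal (cmod (u z) * ?\<rho>) \<le> A1" if "\<delta> < cmod (\<phi> z)"
            unfolding A1_def by (rule SUP_upper) (use that z in auto)
          have A2: "ennreal (cmod (v z) * ?\<rho>) \<le> A2" if "\<delta> < cmod (\<psi> z)"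
            unfolding A2_def by (rule SUP_upper) (use that z in auto)
          have A3: "ennreal (cmod (u z - v z)) \<le> A3" if "\<delta> < cmod (\<phi> z)" "\<delta> < cmod (\<psi> z)"
            unfolding A3_def by (rule SUP_upper) (use that z in auto)
          have A_le: "A1 + A3 \<le> A1 + A2 + A3" "A1 \<le> A1 + A2 + A3" "A2 \<le> A1 + A2 + A3"
            by (simp_all add: add_increasing add_increasing2 add_right_mono)
          have c1: "ennreal (2 * C3 * x) \<le> ennreal (2 * C3 + 2) * A" if "ennreal x \<le> A" "0 \<le> x" for x A
          proof -
            have "ennreal (2 * C3 * x) \<le> ennreal ((2 * C3 + 2) * x)"
              using that by (intro ennreal_leI mult_right_mono) auto
            also have "\<dots> = ennreal (2 * C3 + 2) * ennreal x"
              using C3 that by (intro ennreal_mult) auto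
            also have "\<dots> \<le> ennreal (2 * C3 + 2) * A"
              by (intro mult_left_mono that) auto
            finally show ?thesis .
          qed
          have c2: "ennreal (x * 2) \<le> ennreal (2 * C3 + 2) * A" if "ennreal x \<le> A" "0 \<le> x" for x A
          proof -
            have "ennreal (x * 2) \<le> ennreal ((2 * C3 + 2) * x)"
              using that C3 by (intro ennreal_leI) (simp add: algebra_simps)
            also have "\<dots> = ennreal (2 * C3 + 2) * ennreal x"
              using C3 that by (intro ennreal_mult) auto
            also have "\<dots> \<le> ennreal (2 * C3 + 2) * A"
              by (intro mult_left_mono that) auto
            finally show ?thesis .
          qed
          consider "\<delta> < cmod (\<phi> z)" "\<delta> < cmod (\<psi> z)" | "\<delta> < cmod (\<phi> z)" "cmod (\<psi> z) \<le> \<delta>"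
            | "cmod (\<phi> z) \<le> \<delta>" "\<delta> < cmod (\<psi> z)" | "cmod (\<phi> z) \<le> \<delta>" "cmod (\<psi> z) \<le> \<delta>"
            by linarith
          then show ?thesis
          proof cases
            case 1
            have "cmod (u z * W (\<phi> z) - v z * W (\<psi> z)) \<le> 2 * C3 * (cmod (u z) * ?\<rho>) + cmod (u z - v z) * 2"
              by (rule order_trans[OF t1]) (intro add_left_mono mult_left_mono W2 b, auto)
            then have "ennreal (cmod (u z * W (\<phi> z) - v z * W (\<psi> z)))
                \<le> ennreal (2 * C3 * (cmod (u z) * ?\<rho>)) + ennreal (cmod (u z - v z) * 2)"
              by (rule ennreal_le_plusI) (use C3(1) \<rho> in auto)
            also have "\<dots> \<le> ennreal (2 * C3 + 2) * A1 + ennreal (2 * C3 + 2) * A3"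
              by (rule add_mono[OF c1[OF A1] c2[OF A3]]) (use \<rho> 1 in auto)
            also have "\<dots> = ennreal (2 * C3 + 2) * (A1 + A3) + 0"
              by (simp add: distrib_left)
            also have "\<dots> \<le> ennreal (2 * C3 + 2) * (A1 + A2 + A3) + ennreal e"
              by (rule add_mono[OF mult_left_mono]) (use A_le in auto)
            finally show ?thesis unfolding eq .
          next
            case 2
            have "cmod (u z * W (\<phi> z) - v z * W (\<psi> z)) \<le> 2 * C3 * (cmod (u z) * ?\<rho>) + e"
              using t1 small[OF b 2(2)] by linarith
            then have "ennreal (cmod (u z * W (\<phi> z) - v z * W (\<psi> z))) \<le> ennreal (2 * C3 * (cmod (u z) * ?\<rho>)) + ennreal e"
              by (rule ennreal_le_plusI) (use C3(1) \<rho> e in auto)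
            also have "\<dots> \<le> ennreal (2 * C3 + 2) * A1 + ennreal e"
              by (rule add_mono[OF c1[OF A1]]) (use \<rho> 2 in auto)
            also have "\<dots> \<le> ennreal (2 * C3 + 2) * (A1 + A2 + A3) + ennreal e"
              by (rule add_mono[OF mult_left_mono]) (use A_le in auto)
            finally show ?thesis unfolding eq .
          next
            case 3
            have "cmod (u z * W (\<phi> z) - v z * W (\<psi> z)) \<le> 2 * C3 * (cmod (v z) * ?\<rho>) + e"
              using t2 small[OF a 3(1)] by linarith
            then have "ennreal (cmod (u z * W (\<phi> z) - v z * W (\<psi> z))) \<le> ennreal (2 * C3 * (cmod (v z) * ?\<rho>)) + ennreal e"
              by (rule ennreal_le_plusI) (use C3(1) \<rho> e in auto)
            also have "\<dots> \<le> ennreal (2 * C3 + 2) * A2 + ennreal e"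
              by (rule add_mono[OF c1[OF A2]]) (use \<rho> 3 in auto)
            also have "\<dots> \<le> ennreal (2 * C3 + 2) * (A1 + A2 + A3) + ennreal e"
              by (rule add_mono[OF mult_left_mono]) (use A_le in auto)
            finally show ?thesis unfolding eq .
          next
            case 4
            have "cmod (u z * W (\<phi> z) - v z * W (\<psi> z)) \<le> cmod (u z) * cmod (W (\<phi> z)) + cmod (v z) * cmod (W (\<psi> z))"
              by (metis norm_mult norm_triangle_ineq4)
            also have "\<dots> \<le> Q1 * \<eta> + Q2 * \<eta>"
              using Q1 Q2 z by (intro add_mono mult_mono W\<eta> a b 4) auto
            also have "\<dots> \<le> e" using \<eta>e by (simp add: distrib_right)
            finally have "ennreal (cmod (u z * W (\<phi> z) - v z * W (\<psi> z))) \<le> ennreal e"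
              by (rule ennreal_leI)
            then show ?thesis unfolding eq by (simp add: add_increasing)
          qed
        qed
        have "bloch_norm \<beta> (\<lambda>z. T f z - K f z) = bloch_seminorm \<beta> (\<lambda>z. T f z - K f z)"
          by (simp add: bloch_norm_def T_def K_def)
        also have "\<dots> \<le> ennreal (2 * C3 + 2) * (A1 + A2 + A3) + ennreal e"
          unfolding bloch_seminorm_def by (rule SUP_least) (rule main)
        finally show "bloch_norm \<beta> (\<lambda>z. T f z - K f z) \<le> ennreal (2 * C3 + 2) * (A1 + A2 + A3) + ennreal e" .
      qed
      moreover have "essential_norm \<alpha> \<beta> T \<le> bloch_opnorm \<alpha> \<beta> (\<lambda>f z. T f z - K f z)"
        unfolding essential_norm_def by (rule INF_lower) (use comp in simp)
      ultimately show "essential_norm \<alpha> \<beta> T \<le> ennreal (2 * C3 + 2) * (A1 + A2 + A3) + ennreal e"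
        by (rule order_trans[rotated])
    qed
    then show "essential_norm \<alpha> \<beta> (\<lambda>f z. gen_comp g \<phi> f z - gen_comp h \<psi> f z) \<le> ennreal (2 * C3 + 2) *
       ((SUP z\<in>{z \<in> disk. cmod (\<phi> z) > \<delta>}. ennreal (cmod (weight_quot \<alpha> \<beta> \<phi> g z) * pseudo_dist \<phi> \<psi> z))
      + (SUP z\<in>{z \<in> disk. cmod (\<psi> z) > \<delta>}. ennreal (cmod (weight_quot \<alpha> \<beta> \<psi> h z) * pseudo_dist \<phi> \<psi> z))
      + (SUP z\<in>{z \<in> disk. cmod (\<phi> z) > \<delta> \<and> cmod (\<psi> z) > \<delta>}.
           ennreal (cmod (weight_quot \<alpha> \<beta> \<phi> g z - weight_quot \<alpha> \<beta> \<psi> h z))))"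
      by (simp only: A1_def A2_def A3_def u_def v_def T_def)
  qed
qed

section \<open>The limit superior dominates the suprema\<close>

lemma Lim_at_left_le:
  fixes F :: "real \<Rightarrow> ennreal"
  assumes "antimono F" "r < a"
  shows "Lim (at_left a) F \<le> F r"
proof (rule tendsto_upperbound[OF antimono_tendsto_Lim_at_left[OF assms(1)]])
  show "eventually (\<lambda>x. F x \<le> F r) (at_left a)"
    by (rule eventually_at_leftI[OF _ assms(2)]) (auto intro!: antimonoD[OF assms(1)])
qed simp

lemma antimono_SUP_superlevel:
  fixes F :: "complex \<Rightarrow> ennreal" and P :: "real \<Rightarrow> complex \<Rightarrow> bool"
  assumes "\<And>r s z. r \<le> s \<Longrightarrow> P s z \<Longrightarrow> P r z"
  shows "antimono (\<lambda>r. SUP z\<in>{z \<in> disk. P r z}. F z)"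
proof (rule antimonoI)
  fix r s :: real assume "r \<le> s"
  then show "(SUP z\<in>{z \<in> disk. P s z}. F z) \<le> (SUP z\<in>{z \<in> disk. P r z}. F z)"
    using assms[of r s] by (intro SUP_subset_mono) auto
qed

text \<open>\<open>quotient_estimate\<close> is used pointwise, with a = \<phi>(z), b = \<psi>(z)
  and the weighted symbols as X and Y. Any L above the limit superior supplies the index
  \<open>N\<close>; the bound \<open>Q\<close> affects only the radius.\<close>

lemma suprema_le_limsup:
  fixes \<alpha> \<beta> :: real
  assumes \<alpha>: "0 < \<alpha>"
  obtains C where "0 < C" and
    "\<And>Q g h \<phi> \<psi>. \<phi> \<in> disk_self_maps \<Longrightarrow> \<psi> \<in> disk_self_maps \<Longrightarrow>
      \<forall>z\<in>disk. weight \<beta> z * cmod (g z) \<le> Q \<Longrightarrow> \<forall>z\<in>disk. weight \<beta> z * cmod (h z) \<le> Q \<Longrightarrow>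
      Lim (at_left 1) (\<lambda>r::real. SUP z\<in>{z \<in> disk. cmod (\<phi> z) > r}.
         ennreal (cmod (weight_quot \<alpha> \<beta> \<phi> g z) * pseudo_dist \<phi> \<psi> z))
      + Lim (at_left 1) (\<lambda>r::real. SUP z\<in>{z \<in> disk. cmod (\<psi> z) > r}.
         ennreal (cmod (weight_quot \<alpha> \<beta> \<psi> h z) * pseudo_dist \<phi> \<psi> z))
      + Lim (at_left 1) (\<lambda>r::real. SUP z\<in>{z \<in> disk. cmod (\<phi> z) > r \<and> cmod (\<psi> z) > r}.
         ennreal (cmod (weight_quot \<alpha> \<beta> \<phi> g z - weight_quot \<alpha> \<beta> \<psi> h z)))
      \<le> ennreal C * limsup (\<lambda>n::nat. SUP z\<in>disk. ennreal (real (n + 1) powr \<alpha> * weight \<beta> z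
                 * cmod (\<phi> z ^ n * g z - \<psi> z ^ n * h z)))"
proof -
  obtain C where C: "0 < C"
    "\<And>N Q L. 0 < L \<Longrightarrow> \<exists>r<1. \<forall>a b X Y. a \<in> disk \<longrightarrow> b \<in> disk \<longrightarrow>
      cmod X \<le> Q \<longrightarrow> cmod Y \<le> Q \<longrightarrow>
      (\<forall>n\<ge>N. real (n + 1) powr \<alpha> * cmod (a ^ n * X - b ^ n * Y) \<le> L) \<longrightarrow>
      (r < cmod a \<longrightarrow> cmod (X / of_real (weight \<alpha> a)) * rho a b \<le> C * L) \<and>
      (r < cmod b \<longrightarrow> cmod (Y / of_real (weight \<alpha> b)) * rho a b \<le> C * L) \<and>
      (r < cmod a \<longrightarrow> r < cmod b \<longrightarrow>
        cmod (X / of_real (weight \<alpha> a) - Y / of_real (weight \<alpha> b)) \<le> C * L)"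
    using quotient_estimate[OF \<alpha>] by blast
  show ?thesis
  proof (rule that[of "3 * C"])
    show "0 < 3 * C" using C by simp
    fix Q :: real and g h \<phi> \<psi>
    assume \<phi>: "\<phi> \<in> disk_self_maps" and \<psi>: "\<psi> \<in> disk_self_maps"
      and Qg: "\<forall>z\<in>disk. weight \<beta> z * cmod (g z) \<le> Q"
      and Qh: "\<forall>z\<in>disk. weight \<beta> z * cmod (h z) \<le> Q"
    define u where "u = weight_quot \<alpha> \<beta> \<phi> g"
    define v where "v = weight_quot \<alpha> \<beta> \<psi> h"
    define A1 where "A1 = (\<lambda>r. SUP z\<in>{z \<in> disk. cmod (\<phi> z) > r}. ennreal (cmod (u z) * pseudo_dist \<phi> \<psi> z))"
    define A2 where "A2 = (\<lambda>r. SUP z\<in>{z \<in> disk. cmod (\<psi> z) > r}. ennreal (cmod (v z) * pseudo_dist \<phi> \<psi> z))"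
    define A3 where "A3 = (\<lambda>r. SUP z\<in>{z \<in> disk. cmod (\<phi> z) > r \<and> cmod (\<psi> z) > r}. ennreal (cmod (u z - v z)))"
    define b where "b n = (SUP z\<in>disk. ennreal (real (n + 1) powr \<alpha> * weight \<beta> z
                 * cmod (\<phi> z ^ n * g z - \<psi> z ^ n * h z)))" for n
    have anti: "antimono A1" "antimono A2" "antimono A3"
      unfolding A1_def A2_def A3_def by (rule antimono_SUP_superlevel, simp)+
    have "Lim (at_left 1) A1 + Lim (at_left 1) A2 + Lim (at_left 1) A3 \<le> ennreal (3 * C) * limsup b"
    proof (cases "limsup b" rule: ennreal_cases)
      case top
      then show ?thesis using C by (simp add: ennreal_mult_top)
    next
      case (real l)
      show ?thesis
      proof (rule ennreal_le_epsilon)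
        fix e :: real assume e: "0 < e"
        \<comment> \<open>The increment makes L positive even if l = 0, places it strictly above the
          limit superior, and becomes exactly e after multiplication by 3 C.\<close>
        define L where "L = l + e / (3 * C)"
        have L: "0 < L" using real e C by (simp add: L_def add_nonneg_pos)
        have "limsup b < ennreal L"
          using real e C by (simp add: L_def ennreal_less_iff)
        then have "eventually (\<lambda>n. b n < ennreal L) sequentially"
          by (rule Limsup_lessD)
        then obtain N where N: "\<And>n. n \<ge> N \<Longrightarrow> b n < ennreal L"
          unfolding eventually_sequentially by blast
        obtain r where r: "r < 1" "\<And>a b X Y. a \<in> disk \<Longrightarrow> b \<in> disk \<Longrightarrow> cmod X \<le> Q \<Longrightarrow> cmod Y \<le> Q \<Longrightarrow>
            \<forall>n\<ge>N. real (n + 1) powr \<alpha> * cmod (a ^ n * X - b ^ n * Y) \<le> L \<Longrightarrow>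
            (r < cmod a \<longrightarrow> cmod (X / of_real (weight \<alpha> a)) * rho a b \<le> C * L) \<and>
            (r < cmod b \<longrightarrow> cmod (Y / of_real (weight \<alpha> b)) * rho a b \<le> C * L) \<and>
            (r < cmod a \<longrightarrow> r < cmod b \<longrightarrow>
              cmod (X / of_real (weight \<alpha> a) - Y / of_real (weight \<alpha> b)) \<le> C * L)"
          using C(2)[OF L, where N = N and Q = Q] by blast
        have main: "(r < cmod (\<phi> z) \<longrightarrow> cmod (u z) * pseudo_dist \<phi> \<psi> z \<le> C * L) \<and>
            (r < cmod (\<psi> z) \<longrightarrow> cmod (v z) * pseudo_dist \<phi> \<psi> z \<le> C * L) \<and>
            (r < cmod (\<phi> z) \<longrightarrow> r < cmod (\<psi> z) \<longrightarrow> cmod (u z - v z) \<le> C * L)" if z: "z \<in> disk" for z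
        proof -
          define X Y where "X = of_real (weight \<beta> z) * g z" and "Y = of_real (weight \<beta> z) * h z"
          have XY: "cmod X \<le> Q" "cmod Y \<le> Q"
            using bspec[OF Qg z] bspec[OF Qh z] by (simp_all add: X_def Y_def norm_mult)
          have "\<forall>n\<ge>N. real (n + 1) powr \<alpha> * cmod (\<phi> z ^ n * X - \<psi> z ^ n * Y) \<le> L"
          proof (intro allI impI)
            fix n assume "n \<ge> N"
            have "\<phi> z ^ n * X - \<psi> z ^ n * Y = of_real (weight \<beta> z) * (\<phi> z ^ n * g z - \<psi> z ^ n * h z)"
              by (simp add: X_def Y_def algebra_simps)
            then have "cmod (\<phi> z ^ n * X - \<psi> z ^ n * Y) = weight \<beta> z * cmod (\<phi> z ^ n * g z - \<psi> z ^ n * h z)"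
              by (simp add: norm_mult)
            moreover have "ennreal (real (n + 1) powr \<alpha> * weight \<beta> z * cmod (\<phi> z ^ n * g z - \<psi> z ^ n * h z)) \<le> b n"
              unfolding b_def by (rule SUP_upper[OF z])
            ultimately have "ennreal (real (n + 1) powr \<alpha> * cmod (\<phi> z ^ n * X - \<psi> z ^ n * Y)) \<le> ennreal L"
              using N[OF \<open>n \<ge> N\<close>] by (simp add: mult.assoc)
            then show "real (n + 1) powr \<alpha> * cmod (\<phi> z ^ n * X - \<psi> z ^ n * Y) \<le> L"
              using L by (simp add: ennreal_le_iff)
          qed
          from r(2)[OF disk_self_mapsD(2)[OF \<phi> z] disk_self_mapsD(2)[OF \<psi> z] XY this]
          show ?thesis
            by (simp only: u_def v_def weight_quot_def X_def Y_def pseudo_dist_eq_rho simp_thms)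
        qed
        have "A1 r \<le> ennreal (C * L)" "A2 r \<le> ennreal (C * L)" "A3 r \<le> ennreal (C * L)"
          unfolding A1_def A2_def A3_def using main by (auto intro!: SUP_least ennreal_leI)
        then have "Lim (at_left 1) A1 + Lim (at_left 1) A2 + Lim (at_left 1) A3
            \<le> ennreal (C * L) + ennreal (C * L) + ennreal (C * L)"
          by (intro add_mono order_trans[OF Lim_at_left_le[OF _ r(1)]] anti)
        also have "\<dots> = ennreal (3 * C * L)"
          using C L by (simp flip: ennreal_plus)
        also have "3 * C * L = 3 * C * l + e"
          using C by (simp add: L_def field_simps)
        also have "ennreal (3 * C * l + e) = ennreal (3 * C) * limsup b + ennreal e"
          using C e real by (simp add: ennreal_mult)
        finally show "Lim (at_left 1) A1 + Lim (at_left 1) A2 + Lim (at_left 1) A3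
            \<le> ennreal (3 * C) * limsup b + ennreal e" .
      qed
    qed
    then show "Lim (at_left 1) (\<lambda>r::real. SUP z\<in>{z \<in> disk. cmod (\<phi> z) > r}.
         ennreal (cmod (weight_quot \<alpha> \<beta> \<phi> g z) * pseudo_dist \<phi> \<psi> z))
      + Lim (at_left 1) (\<lambda>r::real. SUP z\<in>{z \<in> disk. cmod (\<psi> z) > r}.
         ennreal (cmod (weight_quot \<alpha> \<beta> \<psi> h z) * pseudo_dist \<phi> \<psi> z))
      + Lim (at_left 1) (\<lambda>r::real. SUP z\<in>{z \<in> disk. cmod (\<phi> z) > r \<and> cmod (\<psi> z) > r}.
         ennreal (cmod (weight_quot \<alpha> \<beta> \<phi> g z - weight_quot \<alpha> \<beta> \<psi> h z)))
      \<le> ennreal (3 * C) * limsup (\<lambda>n::nat. SUP z\<in>disk. ennreal (real (n + 1) powr \<alpha> * weight \<beta> z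
                 * cmod (\<phi> z ^ n * g z - \<psi> z ^ n * h z)))"
      unfolding A1_def A2_def A3_def b_def[abs_def] u_def v_def .
  qed
qed

section \<open>Combination of the three estimates\<close>

theorem theorem4p4:
  fixes \<alpha> \<beta> :: real and g h :: "complex \<Rightarrow> complex"
  assumes "0 < \<alpha>" and "0 < \<beta>"
    and "g holomorphic_on disk" and "h holomorphic_on disk"
  shows "\<exists>C>0. \<forall>\<phi>\<in>disk_self_maps. \<forall>\<psi>\<in>disk_self_maps.
    bloch_bounded \<alpha> \<beta> (gen_comp g \<phi>) \<longrightarrow> bloch_bounded \<alpha> \<beta> (gen_comp h \<psi>) \<longrightarrow>
    (let E = essential_norm \<alpha> \<beta> (\<lambda>f z. gen_comp g \<phi> f z - gen_comp h \<psi> f z);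
         A = Lim (at_left 1) (\<lambda>r::real. SUP z\<in>{z \<in> disk. cmod (\<phi> z) > r}.
               ennreal (cmod (weight_quot \<alpha> \<beta> \<phi> g z) * pseudo_dist \<phi> \<psi> z))
           + Lim (at_left 1) (\<lambda>r::real. SUP z\<in>{z \<in> disk. cmod (\<psi> z) > r}.
               ennreal (cmod (weight_quot \<alpha> \<beta> \<psi> h z) * pseudo_dist \<phi> \<psi> z))
           + Lim (at_left 1) (\<lambda>r::real. SUP z\<in>{z \<in> disk. cmod (\<phi> z) > r \<and> cmod (\<psi> z) > r}.
               ennreal (cmod (weight_quot \<alpha> \<beta> \<phi> g z - weight_quot \<alpha> \<beta> \<psi> h z)));
         B = limsup (\<lambda>n::nat. SUP z\<in>disk.
               ennreal (real (n + 1) powr \<alpha> * (1 - (cmod z)\<^sup>2) powr \<beta>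
                 * cmod (\<phi> z ^ n * g z - \<psi> z ^ n * h z)))
     in E \<le> ennreal C * A \<and> A \<le> ennreal C * E \<and>
        E \<le> ennreal C * B \<and> B \<le> ennreal C * E)"
proof -
  obtain C1 where C1: "0 < C1" "\<And>g h \<phi> \<psi> \<delta>. g holomorphic_on disk \<Longrightarrow> h holomorphic_on disk \<Longrightarrow>
      \<phi> \<in> disk_self_maps \<Longrightarrow> \<psi> \<in> disk_self_maps \<Longrightarrow>
      bloch_bounded \<alpha> \<beta> (gen_comp g \<phi>) \<Longrightarrow> bloch_bounded \<alpha> \<beta> (gen_comp h \<psi>) \<Longrightarrow> \<delta> < 1 \<Longrightarrow>
      essential_norm \<alpha> \<beta> (\<lambda>f z. gen_comp g \<phi> f z - gen_comp h \<psi> f z) \<le> ennreal C1 *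
       ((SUP z\<in>{z \<in> disk. cmod (\<phi> z) > \<delta>}. ennreal (cmod (weight_quot \<alpha> \<beta> \<phi> g z) * pseudo_dist \<phi> \<psi> z))
      + (SUP z\<in>{z \<in> disk. cmod (\<psi> z) > \<delta>}. ennreal (cmod (weight_quot \<alpha> \<beta> \<psi> h z) * pseudo_dist \<phi> \<psi> z))
      + (SUP z\<in>{z \<in> disk. cmod (\<phi> z) > \<delta> \<and> cmod (\<psi> z) > \<delta>}.
           ennreal (cmod (weight_quot \<alpha> \<beta> \<phi> g z - weight_quot \<alpha> \<beta> \<psi> h z))))"
  proof (rule essential_norm_le_suprema[OF \<open>0 < \<alpha>\<close>])
  qed (rule that)
  obtain C2 where C2: "0 < C2" "\<And>Q g h \<phi> \<psi>. \<phi> \<in> disk_self_maps \<Longrightarrow> \<psi> \<in> disk_self_maps \<Longrightarrow>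
      \<forall>z\<in>disk. weight \<beta> z * cmod (g z) \<le> Q \<Longrightarrow> \<forall>z\<in>disk. weight \<beta> z * cmod (h z) \<le> Q \<Longrightarrow>
      Lim (at_left 1) (\<lambda>r::real. SUP z\<in>{z \<in> disk. cmod (\<phi> z) > r}.
         ennreal (cmod (weight_quot \<alpha> \<beta> \<phi> g z) * pseudo_dist \<phi> \<psi> z))
      + Lim (at_left 1) (\<lambda>r::real. SUP z\<in>{z \<in> disk. cmod (\<psi> z) > r}.
         ennreal (cmod (weight_quot \<alpha> \<beta> \<psi> h z) * pseudo_dist \<phi> \<psi> z))
      + Lim (at_left 1) (\<lambda>r::real. SUP z\<in>{z \<in> disk. cmod (\<phi> z) > r \<and> cmod (\<psi> z) > r}.
         ennreal (cmod (weight_quot \<alpha> \<beta> \<phi> g z - weight_quot \<alpha> \<beta> \<psi> h z)))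
      \<le> ennreal C2 * limsup (\<lambda>n::nat. SUP z\<in>disk. ennreal (real (n + 1) powr \<alpha> * weight \<beta> z
                 * cmod (\<phi> z ^ n * g z - \<psi> z ^ n * h z)))"
  proof (rule suprema_le_limsup[OF \<open>0 < \<alpha>\<close>])
  qed (rule that)
  define M where "M = (2 * (1 + \<alpha>)) powr \<alpha>"
  have M: "0 < M" using \<open>0 < \<alpha>\<close> by (simp add: M_def)
  \<comment> \<open>The four summands serve, in order, E \<le> C1 A, A \<le> C2 M E, E \<le> C1 C2 B
    and B \<le> M E.\<close>
  define C where "C = C1 + C2 * M + C1 * C2 + M"
  have C: "0 < C" "C1 \<le> C" "C2 * M \<le> C" "C1 * C2 \<le> C" "M \<le> C"
    using C1(1) C2(1) M by (simp_all add: C_def add_pos_pos add_nonneg_nonneg)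
  have chain: "x \<le> ennreal C * y" if "x \<le> ennreal c * y" "c \<le> C" for x y c
    using that by (meson ennreal_leI mult_right_mono order_trans zero_le)
  have compose: "x \<le> ennreal (c * d) * z" if "x \<le> ennreal c * y" "y \<le> ennreal d * z" "0 < c" "0 < d" for x y z c d
    using order_trans[OF that(1) mult_left_mono[OF that(2)]] that(3,4) by (simp add: ennreal_mult mult.assoc)
  show ?thesis
  proof (intro exI[of _ C] conjI ballI impI C(1))
    fix \<phi> \<psi> assume \<phi>: "\<phi> \<in> disk_self_maps" and \<psi>: "\<psi> \<in> disk_self_maps"
      and Tg: "bloch_bounded \<alpha> \<beta> (gen_comp g \<phi>)" and Th: "bloch_bounded \<alpha> \<beta> (gen_comp h \<psi>)"
    define E where "E = essential_norm \<alpha> \<beta> (\<lambda>f z. gen_comp g \<phi> f z - gen_comp h \<psi> f z)"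
    define A1 where "A1 = (\<lambda>r::real. SUP z\<in>{z \<in> disk. cmod (\<phi> z) > r}.
               ennreal (cmod (weight_quot \<alpha> \<beta> \<phi> g z) * pseudo_dist \<phi> \<psi> z))"
    define A2 where "A2 = (\<lambda>r::real. SUP z\<in>{z \<in> disk. cmod (\<psi> z) > r}.
               ennreal (cmod (weight_quot \<alpha> \<beta> \<psi> h z) * pseudo_dist \<phi> \<psi> z))"
    define A3 where "A3 = (\<lambda>r::real. SUP z\<in>{z \<in> disk. cmod (\<phi> z) > r \<and> cmod (\<psi> z) > r}.
               ennreal (cmod (weight_quot \<alpha> \<beta> \<phi> g z - weight_quot \<alpha> \<beta> \<psi> h z)))"
    define A where "A = Lim (at_left 1) A1 + Lim (at_left 1) A2 + Lim (at_left 1) A3"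
    define B where "B = limsup (\<lambda>n::nat. SUP z\<in>disk.
               ennreal (real (n + 1) powr \<alpha> * weight \<beta> z * cmod (\<phi> z ^ n * g z - \<psi> z ^ n * h z)))"
    have "antimono A1" "antimono A2" "antimono A3"
      unfolding A1_def A2_def A3_def by (rule antimono_SUP_superlevel, simp)+
    \<comment> \<open>The constant \<open>C1\<close> is the same for all \<delta>, so the inequality
      for fixed \<delta> survives the passage to the limit; monotonicity in \<delta> provides the
      three limits.\<close>
    then have "((\<lambda>\<delta>. ennreal C1 * (A1 \<delta> + A2 \<delta> + A3 \<delta>)) \<longlongrightarrow> ennreal C1 * A) (at_left 1)"
      unfolding A_def by (intro ennreal_tendsto_cmult tendsto_add antimono_tendsto_Lim_at_left) auto
    moreover have "eventually (\<lambda>\<delta>. E \<le> ennreal C1 * (A1 \<delta> + A2 \<delta> + A3 \<delta>)) (at_left 1)"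
    proof (rule eventually_at_leftI[of 0])
      fix \<delta> :: real assume "\<delta> \<in> {0<..<1}"
      then show "E \<le> ennreal C1 * (A1 \<delta> + A2 \<delta> + A3 \<delta>)"
        unfolding E_def A1_def A2_def A3_def
        by (intro C1(2) \<phi> \<psi> Tg Th \<open>g holomorphic_on disk\<close> \<open>h holomorphic_on disk\<close>) auto
    qed simp
    ultimately have EA: "E \<le> ennreal C1 * A"
      by (rule tendsto_lowerbound) simp
    obtain Q1 where Q1: "\<forall>z\<in>disk. weight \<beta> z * cmod (g z) \<le> Q1"
      using bloch_bounded_weights[OF \<open>0 < \<alpha>\<close> \<open>g holomorphic_on disk\<close> \<phi> Tg] by blast
    obtain Q2 where Q2: "\<forall>z\<in>disk. weight \<beta> z * cmod (h z) \<le> Q2"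
      using bloch_bounded_weights[OF \<open>0 < \<alpha>\<close> \<open>h holomorphic_on disk\<close> \<psi> Th] by blast
    have AB: "A \<le> ennreal C2 * B"
      unfolding A_def A1_def A2_def A3_def B_def
    proof (rule C2(2)[OF \<phi> \<psi>, where Q = "max Q1 Q2"])
      show "\<forall>z\<in>disk. weight \<beta> z * cmod (g z) \<le> max Q1 Q2"
        using Q1 by (simp add: le_max_iff_disj)
      show "\<forall>z\<in>disk. weight \<beta> z * cmod (h z) \<le> max Q1 Q2"
        using Q2 by (simp add: le_max_iff_disj)
    qed
    have BE: "B \<le> ennreal M * E"
      unfolding B_def E_def M_def
      by (rule limsup_le_essential_norm[OF \<open>0 < \<alpha>\<close> \<open>g holomorphic_on disk\<close> \<open>h holomorphic_on disk\<close> \<phi> \<psi>])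
        (use Tg Th in \<open>auto simp: bloch_bounded_def bloch_linear_def\<close>)
    have "E \<le> ennreal C * A \<and> A \<le> ennreal C * E \<and> E \<le> ennreal C * B \<and> B \<le> ennreal C * E"
      using chain[OF EA C(2)] chain[OF compose[OF AB BE C2(1) M] C(3)]
        chain[OF compose[OF EA AB C1(1) C2(1)] C(4)] chain[OF BE C(5)] by blast
    then show "let E = essential_norm \<alpha> \<beta> (\<lambda>f z. gen_comp g \<phi> f z - gen_comp h \<psi> f z);
         A = Lim (at_left 1) (\<lambda>r::real. SUP z\<in>{z \<in> disk. cmod (\<phi> z) > r}.
               ennreal (cmod (weight_quot \<alpha> \<beta> \<phi> g z) * pseudo_dist \<phi> \<psi> z))
           + Lim (at_left 1) (\<lambda>r::real. SUP z\<in>{z \<in> disk. cmod (\<psi> z) > r}.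
               ennreal (cmod (weight_quot \<alpha> \<beta> \<psi> h z) * pseudo_dist \<phi> \<psi> z))
           + Lim (at_left 1) (\<lambda>r::real. SUP z\<in>{z \<in> disk. cmod (\<phi> z) > r \<and> cmod (\<psi> z) > r}.
               ennreal (cmod (weight_quot \<alpha> \<beta> \<phi> g z - weight_quot \<alpha> \<beta> \<psi> h z)));
         B = limsup (\<lambda>n::nat. SUP z\<in>disk.
               ennreal (real (n + 1) powr \<alpha> * (1 - (cmod z)\<^sup>2) powr \<beta>
                 * cmod (\<phi> z ^ n * g z - \<psi> z ^ n * h z)))
     in E \<le> ennreal C * A \<and> A \<le> ennreal C * E \<and> E \<le> ennreal C * B \<and> B \<le> ennreal C * E"
      unfolding Let_def E_def A_def A1_def A2_def A3_def B_def .
  qed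
qed

end
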